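(* Let $1 \leq p < \infty$, let $\phi$ be analytic on $\mathbb{D}$ and let $\varphi$ be an analytic self-map of $\mathbb{D}$. Suppose that $W_{\phi,\varphi}\colon S^p \to S^p$ is bounded. If $m(E_\varphi)>0$, where $E_\varphi=\{\zeta\in\partial\mathbb{D}: |\varphi(\zeta)|=1\}$, and $\phi\varphi'$ is not identically zero, then $W_{\phi,\varphi}$ fixes an isomorphic copy of $\ell^2$ in $S^p$.
   Context: $\mathbb{D}$ is the open unit disk, $m$ the normalized Lebesgue measure on $\partial\mathbb{D}$, and $\varphi(\zeta)$ for $\zeta\in\partial\mathbb{D}$ denotes the radial limit of $\varphi$ (which exists for $m$-almost every $\zeta$). For $0<p<\infty$, $H^p$ is the Hardy space of analytic $f$ on $\mathbb{D}$ with $\|f\|_{H^p}=\sup_{0\le r<1}\left(\int_{\partial\mathbb{D}}|f(r\xi)|^p\,dm(\xi)\right)^{1/p}<\infty$. The derivative Hardy space is $S^p=\{f \text{ analytic on } \mathbb{D}: \|f\|_{S^p}:=|f(0)|+\|f'\|_{H^p}<\infty\}$. The weighted composition operator is $W_{\phi,\varphi}f=\phi\cdot(f\circ\varphi)$. A bounded operator $T\colon X\to Y$ fixes a copy of a Banach space $E$ if there is a closed subspace $M\subset X$ linearly isomorphic to $E$ such that $T|_M$ is an isomorphism from $M$ onto $T(M)$. *)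

theory Defs
  imports "HOL-Complex_Analysis.Complex_Analysis"
begin

abbreviation unit_disk :: "complex set" where
  "unit_disk \<equiv> ball 0 1"

definition int_mean :: "real \<Rightarrow> (complex \<Rightarrow> complex) \<Rightarrow> real \<Rightarrow> real" where
  "int_mean p f r = integral {0..2*pi} (\<lambda>t. norm (f (of_real r * cis t)) powr p) / (2*pi)"

definition hardy :: "real \<Rightarrow> (complex \<Rightarrow> complex) set" where
  "hardy p = {f. f holomorphic_on unit_disk \<and> bdd_above (int_mean p f ` {0..<1})}"

definition hardy_norm :: "real \<Rightarrow> (complex \<Rightarrow> complex) \<Rightarrow> real" where
  "hardy_norm p f = (SUP r\<in>{0..<1}. int_mean p f r) powr (1/p)"

text \<open>Derivative Hardy space S^p. Elements are represented canonically:
  functions on the disk, extended by 0 outside the disk.\<close>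
definition Sp :: "real \<Rightarrow> (complex \<Rightarrow> complex) set" where
  "Sp p = {f. f holomorphic_on unit_disk \<and> (\<forall>z. z \<notin> unit_disk \<longrightarrow> f z = 0)
              \<and> deriv f \<in> hardy p}"

definition Sp_norm :: "real \<Rightarrow> (complex \<Rightarrow> complex) \<Rightarrow> real" where
  "Sp_norm p f = norm (f 0) + hardy_norm p (deriv f)"

definition wcomp :: "(complex \<Rightarrow> complex) \<Rightarrow> (complex \<Rightarrow> complex) \<Rightarrow> (complex \<Rightarrow> complex) \<Rightarrow> (complex \<Rightarrow> complex)" where
  "wcomp w v f = (\<lambda>z. if z \<in> unit_disk then w z * f (v z) else 0)"

definition bounded_on_Sp :: "real \<Rightarrow> ((complex \<Rightarrow> complex) \<Rightarrow> (complex \<Rightarrow> complex)) \<Rightarrow> bool" where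
  "bounded_on_Sp p T \<longleftrightarrow> (\<forall>f\<in>Sp p. T f \<in> Sp p) \<and>
      (\<exists>C. \<forall>f\<in>Sp p. Sp_norm p (T f) \<le> C * Sp_norm p f)"

definition l2 :: "(nat \<Rightarrow> complex) set" where
  "l2 = {a. summable (\<lambda>n. (norm (a n))^2)}"

definition l2_norm :: "(nat \<Rightarrow> complex) \<Rightarrow> real" where
  "l2_norm a = sqrt (\<Sum>n. (norm (a n))^2)"

definition Sp_subspace :: "real \<Rightarrow> (complex \<Rightarrow> complex) set \<Rightarrow> bool" where
  "Sp_subspace p M \<longleftrightarrow> M \<subseteq> Sp p \<and> (\<lambda>_. 0) \<in> M \<and>
     (\<forall>f\<in>M. \<forall>g\<in>M. (\<lambda>z. f z + g z) \<in> M) \<and> (\<forall>c. \<forall>f\<in>M. (\<lambda>z. c * f z) \<in> M)"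

definition Sp_closed :: "real \<Rightarrow> (complex \<Rightarrow> complex) set \<Rightarrow> bool" where
  "Sp_closed p M \<longleftrightarrow> (\<forall>F g. (\<forall>n. F n \<in> M) \<longrightarrow> g \<in> Sp p \<longrightarrow>
       (\<lambda>n. Sp_norm p (\<lambda>z. F n z - g z)) \<longlonglongrightarrow> 0 \<longrightarrow> g \<in> M)"

definition isomorphic_to_l2 :: "real \<Rightarrow> (complex \<Rightarrow> complex) set \<Rightarrow> bool" where
  "isomorphic_to_l2 p M \<longleftrightarrow> (\<exists>L c C. bij_betw L l2 M \<and> c > 0 \<and> C > 0 \<and>
     (\<forall>a\<in>l2. \<forall>b\<in>l2. L (\<lambda>n. a n + b n) = (\<lambda>z. L a z + L b z)) \<and>
     (\<forall>k. \<forall>a\<in>l2. L (\<lambda>n. k * a n) = (\<lambda>z. k * L a z)) \<and>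
     (\<forall>a\<in>l2. c * l2_norm a \<le> Sp_norm p (L a) \<and> Sp_norm p (L a) \<le> C * l2_norm a))"

text \<open>T fixes a copy of l^2 in S^p: a closed subspace M isomorphic to l^2 on which
  T is an isomorphism onto T(M) (T bounded, so this means T is bounded below on M).\<close>
definition fixes_copy_of_l2 :: "real \<Rightarrow> ((complex \<Rightarrow> complex) \<Rightarrow> (complex \<Rightarrow> complex)) \<Rightarrow> bool" where
  "fixes_copy_of_l2 p T \<longleftrightarrow> (\<exists>M. Sp_subspace p M \<and> Sp_closed p M \<and> isomorphic_to_l2 p M \<and>
     (\<exists>c>0. \<forall>f\<in>M. c * Sp_norm p f \<le> Sp_norm p (T f)))"

definition has_radial_limit :: "(complex \<Rightarrow> complex) \<Rightarrow> complex \<Rightarrow> complex \<Rightarrow> bool" where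
  "has_radial_limit f \<zeta> l \<longleftrightarrow> ((\<lambda>r::real. f (of_real r * \<zeta>)) \<longlongrightarrow> l) (at_left 1)"

definition circle_measure :: "complex set \<Rightarrow> real" where
  "circle_measure E = measure lebesgue {t\<in>{0..2*pi}. cis t \<in> E} / (2*pi)"

definition E_set :: "(complex \<Rightarrow> complex) \<Rightarrow> complex set" where
  "E_set v = {\<zeta>. norm \<zeta> = 1 \<and> (\<exists>l. has_radial_limit v \<zeta> l \<and> norm l = 1)}"

end

theory Submission
  imports Defs
begin

text \<open>
  The copy of \<open>\<ell>\<^sup>2\<close> is spanned by the functions \<open>z\<^bsup>n(k)+1\<^esup> / (n(k)+1)\<close> for an extremely sparse
  sequence \<open>n(k)\<close>. Sparseness makes the powers \<open>\<zeta>\<^bsup>n(k)\<^esup>\<close> on the circle, and the powers \<open>V\<^bsup>n(k)\<^esup>\<close>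
  of the boundary function \<open>V\<close> of \<open>v\<close> on the set \<open>E\<close> where \<open>\<bar>V\<bar> = 1\<close>, behave like independent
  random variables: second moments are comparable with the \<open>\<ell>\<^sup>2\<close> norm of the coefficients and all
  even moments are bounded by it. On \<open>E\<close> this works because \<open>\<integral>\<^sub>E V\<^sup>n \<rightarrow> 0\<close>. The even moments on the
  circle bound the \<open>S\<^sup>p\<close> norm from above. For the lower bound of the image, the term \<open>w' f(v)\<close> of
  the derivative is negligible since \<open>n(0)\<close> is large, and in the main term \<open>w v' f'(v)\<close> the factor
  \<open>w v'\<close> is, by Jensen's inequality, bounded below off a set of small measure on circles of radius
  close to \<open>1\<close>; second and fourth moments show that \<open>f'(v)\<close> cannot concentrate on that small set.
\<close>

section \<open>Moments of sparse unimodular sums\<close>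

text \<open>Neither \<open>E\<close> nor \<open>w * deriv v\<close> has any structure, so the powers
  of \<open>V\<close> on \<open>E\<close> are not orthogonal; all that is known about them is that
  their means over \<open>E\<close> tend to 0. This is why the exponents are chosen one after
  another, each so large that its term, multiplied by boundedly many earlier ones, integrates to
  almost nothing. The order of the moments depends on \<open>p\<close>: an even order
  \<open>2*N\<close> that is at least \<open>p\<close> gives the upper bound, and for small
  \<open>p\<close> the p-th mean is recovered from the second moment, which the fourth keeps from
  concentrating. Boundary values are taken of \<open>v\<close> alone and only on \<open>E\<close>,
  where they exist by the definition of \<open>E_set\<close>. The weight \<open>w * deriv v\<close>
  is studied on circles inside the disk, and its small values are controlled by one bound valid for
  radii tending to 1. Estimates are made first for finite sums, which are polynomials in
  \<open>v\<close> and so follow the radial limit of \<open>v\<close>; their constants do not depend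
  on the number of terms, and density then gives all of \<open>l2\<close>.\<close>

text \<open>A second-order expansion in \<open>y\<close> whose linear term is kept exactly, since
  after integration it is a nearly vanishing cross term. The remainder carries the summable factor
  \<open>(norm y)^2\<close> and only the next lower even power of \<open>norm x\<close>, which
  permits induction on the order of the moment. The restriction \<open>norm y \<le> 1\<close>
  absorbs higher powers of \<open>norm y\<close>.\<close>

lemma power_norm_add_le:
  assumes "q \<ge> 1"
  shows "\<exists>C\<ge>0. \<forall>x y :: complex. norm y \<le> 1 \<longrightarrow>
    norm (x + y) ^ (2*q) \<le> norm x ^ (2*q) + 2 * real q * norm x ^ (2*(q-1)) * Re (x * cnj y)
       + (norm y)\<^sup>2 * (C * (1 + norm x ^ (2*(q-1))))"
  using assms
proof (induction q rule: dec_induct)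
  case base
  have "norm (x + y) ^ 2 = norm x ^ 2 + 2 * Re (x * cnj y) + (norm y)\<^sup>2" for x y :: complex
    unfolding cmod_power2 by (simp add: algebra_simps power2_eq_square)
  then show ?case
    by (intro exI[of _ 1]) auto
next
  case (step q)
  then obtain C where C: "C \<ge> 0" and IH: "\<And>x y :: complex. norm y \<le> 1 \<Longrightarrow>
    norm (x + y) ^ (2*q) \<le> norm x ^ (2*q) + 2 * real q * norm x ^ (2*(q-1)) * Re (x * cnj y)
       + (norm y)\<^sup>2 * (C * (1 + norm x ^ (2*(q-1))))" by blast
  show ?case
  proof (intro exI[of _ "1 + 8 * real q + 8 * C"] conjI allI impI)
    show "0 \<le> 1 + 8 * real q + 8 * C" using C by simp
    fix x y :: complex
    assume y: "norm y \<le> 1"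
    define X where "X = (norm x)\<^sup>2"
    define Y where "Y = (norm y)\<^sup>2"
    define R where "R = Re (x * cnj y)"
    have sq: "(norm (x + y))\<^sup>2 = X + 2 * R + Y"
      unfolding X_def Y_def R_def cmod_power2 by (simp add: algebra_simps power2_eq_square)
    have X0: "X \<ge> 0" "Y \<ge> 0" by (auto simp: X_def Y_def)
    have R: "\<bar>R\<bar> \<le> norm x * norm y"
      unfolding R_def by (metis abs_Re_le_cmod complex_mod_cnj norm_mult)
    have nx: "norm x \<le> 1 + X"
    proof -
      have "0 \<le> (norm x - 1)\<^sup>2 + norm x" by simp
      moreover have "(norm x - 1)\<^sup>2 + norm x = X + 1 - norm x"
        by (simp add: X_def power2_eq_square algebra_simps)
      ultimately show ?thesis by simp
    qed
    have t1: "\<bar>2 * R + Y\<bar> \<le> norm y * (2 * norm x + 1)"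
    proof -
      have "Y \<le> norm y" unfolding Y_def using y
        by (metis mult_left_le norm_ge_zero power2_eq_square)
      then show ?thesis using R X0 by (simp add: algebra_simps)
    qed
    have tR: "(2 * R + Y) * R \<le> Y * (3 * X + 1)"
    proof -
      have "(2 * R + Y) * R \<le> \<bar>2 * R + Y\<bar> * \<bar>R\<bar>"
        by (metis abs_ge_self abs_mult)
      also have "\<dots> \<le> (norm y * (2 * norm x + 1)) * (norm x * norm y)"
        using t1 R by (intro mult_mono) auto
      also have "\<dots> = Y * (2 * X + norm x)"
        by (simp add: X_def Y_def power2_eq_square algebra_simps)
      also have "\<dots> \<le> Y * (3 * X + 1)"
        using X0 nx by (intro mult_left_mono) auto
      finally show ?thesis .
    qed
    have S: "X + 2 * R + Y \<le> 2 * X + 2"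
    proof -
      have "\<bar>R\<bar> \<le> norm x" using R y by (meson mult_left_le norm_ge_zero order_trans)
      moreover have "2 * norm x \<le> 1 + X"
        using sum_squares_bound[of "norm x" 1] by (simp add: X_def)
      moreover have "Y \<le> 1" using y by (simp add: Y_def power_le_one)
      ultimately show ?thesis by linarith
    qed
    have Xq: "X ^ (q-1) \<le> 1 + X ^ q" 
    proof (cases "X \<le> 1")
      case True then have "X ^ (q-1) \<le> 1" using X0 by (intro power_le_one)
      then show ?thesis using zero_le_power[OF X0(1), of q] by linarith
    next
      case False then have "X ^ (q-1) \<le> X ^ q" by (intro power_increasing) auto
      then show ?thesis by simp
    qed
    have XX: "X * X ^ (q-1) = X ^ q" using step(1) by (simp add: power_eq_if)
    \<comment> \<open>The induction hypothesis is multiplied by the nonnegative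
      \<open>X + 2 * R + Y\<close>. The linear terms, with \<open>2 * q\<close> from the hypothesis
      and 2 from the new factor, add up to \<open>2 * Suc q\<close>; everything else is bounded by a
      multiple of \<open>Y\<close>, the product \<open>(2 * R + Y) * R\<close> by
      \<open>tR\<close>.\<close>
    have "norm (x + y) ^ (2 * Suc q) = (X + 2 * R + Y) * norm (x + y) ^ (2*q)"
      unfolding sq[symmetric] by (simp add: power_add[symmetric])
    also have "\<dots> \<le> (X + 2 * R + Y) * (X ^ q + 2 * real q * X ^ (q-1) * R + Y * (C * (1 + X ^ (q-1))))"
      using IH[OF y, of x] sq[symmetric] unfolding X_def[symmetric] Y_def[symmetric] R_def[symmetric]
      by (intro mult_left_mono) (simp_all add: power_mult X_def Y_def R_def)
    also have "\<dots> = X ^ Suc q + 2 * real (Suc q) * X ^ q * R + Y * X ^ q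
        + 2 * real q * X ^ (q-1) * ((2 * R + Y) * R) + (X + 2 * R + Y) * (Y * (C * (1 + X ^ (q-1))))"
      by (simp add: algebra_simps XX[symmetric])
    also have "\<dots> \<le> X ^ Suc q + 2 * real (Suc q) * X ^ q * R + Y * X ^ q
        + 2 * real q * X ^ (q-1) * (Y * (3 * X + 1)) + (2 * X + 2) * (Y * (C * (1 + X ^ (q-1))))"
    proof -
      have "2 * real q * X ^ (q-1) * ((2 * R + Y) * R) \<le> 2 * real q * X ^ (q-1) * (Y * (3 * X + 1))"
        using X0 by (intro mult_left_mono tR) auto
      moreover have "(X + 2 * R + Y) * (Y * (C * (1 + X ^ (q-1)))) \<le> (2 * X + 2) * (Y * (C * (1 + X ^ (q-1))))"
        using X0 C by (intro mult_right_mono S) auto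
      ultimately show ?thesis by linarith
    qed
    also have "\<dots> = X ^ Suc q + 2 * real (Suc q) * X ^ q * R + Y * (X ^ q
        + 2 * real q * (3 * X ^ q + X ^ (q-1)) + C * (2 * X + 2 + 2 * X ^ q + 2 * X ^ (q-1)))"
      by (simp add: algebra_simps XX[symmetric])
    also have "\<dots> \<le> X ^ Suc q + 2 * real (Suc q) * X ^ q * R + Y * ((1 + X ^ q)
        + 2 * real q * (4 * (1 + X ^ q)) + C * (8 * (1 + X ^ q)))"
    proof -
      have X1: "X \<le> 1 + X ^ q"
      proof (cases "X \<le> 1")
        case True then show ?thesis using X0 by (simp add: add_increasing2)
      next
        case False then have "X ^ 1 \<le> X ^ q" using step(1) by (intro power_increasing) auto
        then show ?thesis by simp
      qed
      have "3 * X ^ q + X ^ (q-1) \<le> 4 * (1 + X ^ q)"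
        "2 * X + 2 + 2 * X ^ q + 2 * X ^ (q-1) \<le> 8 * (1 + X ^ q)"
        using Xq X1 X0 by (auto simp: algebra_simps) 
      then show ?thesis using X0 C by (intro add_mono mult_left_mono) auto
    qed
    finally have *: "norm (x + y) ^ (2 * Suc q) \<le> X ^ Suc q + 2 * real (Suc q) * X ^ q * R + Y * ((1 + X ^ q)
        + 2 * real q * (4 * (1 + X ^ q)) + C * (8 * (1 + X ^ q)))" .
    have e: "norm x ^ (2 * Suc q) = X ^ Suc q" "norm x ^ (2 * (Suc q - 1)) = X ^ q"
      unfolding X_def power_mult by simp_all
    show "norm (x + y) ^ (2 * Suc q) \<le> norm x ^ (2 * Suc q)
       + 2 * real (Suc q) * norm x ^ (2 * (Suc q - 1)) * Re (x * cnj y)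
       + (norm y)\<^sup>2 * ((1 + 8 * real q + 8 * C) * (1 + norm x ^ (2 * (Suc q - 1))))"
    proof -
      have "Y * ((1 + X ^ q) + 2 * real q * (4 * (1 + X ^ q)) + C * (8 * (1 + X ^ q)))
          = Y * ((1 + 8 * real q + 8 * C) * (1 + X ^ q))" by (simp add: algebra_simps)
      then show ?thesis using * unfolding e Y_def[symmetric] R_def[symmetric] by (simp only:)
    qed
  qed
qed

lemma measurable_cnj [measurable (raw)]:
  "f \<in> borel_measurable M \<Longrightarrow> (\<lambda>x. cnj (f x)) \<in> borel_measurable M"
  by (rule borel_measurable_continuous_on[OF continuous_on_cnj[OF continuous_on_id]])

lemma integrable_norm_bound:
  fixes f :: "'a \<Rightarrow> 'b::{banach, second_countable_topology}"
  assumes "finite_measure M" "f \<in> borel_measurable M" "\<And>x. x \<in> space M \<Longrightarrow> norm (f x) \<le> B"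
  shows "integrable M f"
  using finite_measure.integrable_const_bound[OF assms(1), of f B] assms by auto

lemma integral_lin3:
  fixes f g h :: "'a \<Rightarrow> real"
  assumes "finite_measure M" "integrable M f" "integrable M g" "integrable M h"
  shows "(\<integral>x. f x + c * g x + d * (1 + h x) \<partial>M)
    = integral\<^sup>L M f + c * integral\<^sup>L M g + d * (measure M (space M) + integral\<^sup>L M h)"
proof -
  have 1: "integrable M (\<lambda>x. 1::real)" using finite_measure.integrable_const[OF assms(1)] .
  have "(\<integral>x. f x + c * g x + d * (1 + h x) \<partial>M)
     = (\<integral>x. f x + c * g x \<partial>M) + (\<integral>x. d * (1 + h x) \<partial>M)"
    using assms 1 by (intro Bochner_Integration.integral_add) auto
  also have "(\<integral>x. f x + c * g x \<partial>M) = integral\<^sup>L M f + (\<integral>x. c * g x \<partial>M)"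
    using assms by (intro Bochner_Integration.integral_add) auto
  also have "(\<integral>x. d * (1 + h x) \<partial>M) = d * ((\<integral>x. 1 \<partial>M) + integral\<^sup>L M h)"
    using assms 1 by (simp add: Bochner_Integration.integral_add)
  finally show ?thesis by simp
qed

lemma norm_lacunary_le:
  fixes V :: complex
  assumes "norm V \<le> 1"
  shows "norm (\<Sum>k<K. a k * V ^ n k) \<le> (\<Sum>k<K. norm (a k))"
  by (rule order_trans[OF norm_sum])
     (intro sum_mono, simp add: norm_mult norm_power assms mult_left_le power_le_one)

text \<open>Expanding a factor \<open>P x\<close> raises the exponent of \<open>V x\<close> by some
  \<open>n k\<close>. Expanding a factor \<open>cnj (P x)\<close> lowers it by at most
  \<open>D\<close>, because \<open>cnj (V x)\<close> is the inverse of \<open>V x\<close>. The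
  reserve \<open>t * D\<close> in \<open>m\<close> keeps the exponent at least \<open>l\<close> to
  the end, and each expansion costs one factor \<open>\<Sum>k<K. norm (a k)\<close>.\<close>

lemma cross_integral_le:
  fixes V :: "'a \<Rightarrow> complex" and a :: "nat \<Rightarrow> complex"
  assumes M: "finite_measure M" and V: "V \<in> borel_measurable M" "\<And>x. x \<in> space M \<Longrightarrow> norm (V x) = 1"
    and e: "\<And>m. l \<le> m \<Longrightarrow> norm (\<integral>x. V x ^ m \<partial>M) \<le> e" and D: "\<And>k. k < K \<Longrightarrow> n k \<le> D"
    and m: "l + t * D \<le> m"
  defines "P \<equiv> \<lambda>x. \<Sum>k<K. a k * V x ^ n k"
  shows "norm (\<integral>x. P x ^ s * cnj (P x) ^ t * V x ^ m \<partial>M) \<le> (\<Sum>k<K. norm (a k)) ^ (s+t) * e"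
proof -
  have PB: "norm (P x) \<le> (\<Sum>k<K. norm (a k))" if "x \<in> space M" for x
    unfolding P_def by (rule norm_lacunary_le) (simp add: V(2)[OF that])
  have Pm: "P \<in> borel_measurable M" unfolding P_def using V(1) by measurable
  have int: "integrable M (\<lambda>x. P x ^ s * cnj (P x) ^ t * V x ^ m)" for s t m
  proof (rule integrable_norm_bound[OF M, where B = "(\<Sum>k<K. norm (a k)) ^ (s + t)"])
    show "(\<lambda>x. P x ^ s * cnj (P x) ^ t * V x ^ m) \<in> borel_measurable M"
      using Pm V(1) by (intro borel_measurable_times borel_measurable_power measurable_cnj borel_measurable_const)
    show "norm (P x ^ s * cnj (P x) ^ t * V x ^ m) \<le> (\<Sum>k<K. norm (a k)) ^ (s + t)" if "x \<in> space M" for x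
      using PB[OF that] V(2)[OF that]
      by (simp add: norm_mult norm_power power_add[symmetric] power_mono)
  qed
  show ?thesis using m
  proof (induction t arbitrary: m)
    case 0
    then show ?case
    proof (induction s arbitrary: m)
      case 0
      then show ?case using e[of m] by simp
    next
      case (Suc s)
      have eq: "P x ^ Suc s * cnj (P x) ^ 0 * V x ^ m = (\<Sum>k<K. a k * (P x ^ s * cnj (P x) ^ 0 * V x ^ (m + n k)))" for x
        by (simp add: P_def sum_distrib_left sum_distrib_right power_add mult_ac)
      have "norm (\<integral>x. P x ^ Suc s * cnj (P x) ^ 0 * V x ^ m \<partial>M)
          = norm (\<Sum>k<K. a k * (\<integral>x. P x ^ s * cnj (P x) ^ 0 * V x ^ (m + n k) \<partial>M))"
        unfolding eq
        by (subst Bochner_Integration.integral_sum) (use int[of s 0] in auto)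
      also have "\<dots> \<le> (\<Sum>k<K. norm (a k) * ((\<Sum>k<K. norm (a k)) ^ (s + 0) * e))"
        using Suc.prems Suc.IH[unfolded power_0]
        by (intro order_trans[OF norm_sum] sum_mono) (auto simp: norm_mult intro!: mult_left_mono)
      finally show ?case unfolding sum_distrib_right[symmetric] by (simp add: mult.assoc)
    qed
  next
    case (Suc t)
    \<comment> \<open>With one conjugate factor still to be expanded the reserve is at least
      \<open>D\<close>, so the natural subtraction \<open>m - n k\<close> below does not
      truncate.\<close>
    have mk: "n k \<le> m" if "k < K" for k using D[OF that] Suc.prems by auto
    have eq: "P x ^ s * cnj (P x) ^ Suc t * V x ^ m
       = (\<Sum>k<K. cnj (a k) * (P x ^ s * cnj (P x) ^ t * V x ^ (m - n k)))" if x: "x \<in> space M" for x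
    proof -
      have vv: "cnj (V x) * V x = 1" using V(2)[OF x] by (simp add: complex_norm_square[symmetric] mult.commute)
      have "cnj (P x) * V x ^ m = (\<Sum>k<K. cnj (a k) * V x ^ (m - n k))"
      proof -
        have "cnj (V x) ^ n k * V x ^ m = V x ^ (m - n k)" if "k < K" for k
        proof -
          have "cnj (V x) ^ n k * V x ^ m = (cnj (V x) * V x) ^ n k * V x ^ (m - n k)"
            using mk[OF that] by (simp add: power_mult_distrib power_add[symmetric])
          then show ?thesis by (simp add: vv)
        qed
        then show ?thesis by (simp add: P_def sum_distrib_right mult.assoc)
      qed
      then have "P x ^ s * cnj (P x) ^ Suc t * V x ^ m
          = P x ^ s * cnj (P x) ^ t * (\<Sum>k<K. cnj (a k) * V x ^ (m - n k))" by simp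
      then show ?thesis by (simp add: sum_distrib_left mult_ac)
    qed
    have "norm (\<integral>x. P x ^ s * cnj (P x) ^ Suc t * V x ^ m \<partial>M)
          = norm (\<integral>x. (\<Sum>k<K. cnj (a k) * (P x ^ s * cnj (P x) ^ t * V x ^ (m - n k))) \<partial>M)"
      using eq by (subst Bochner_Integration.integral_cong[OF refl]) auto
    also have "\<dots> = norm (\<Sum>k<K. cnj (a k) * (\<integral>x. P x ^ s * cnj (P x) ^ t * V x ^ (m - n k) \<partial>M))"
      by (subst Bochner_Integration.integral_sum) (auto intro!: integrable_mult_right int)
    also have "\<dots> \<le> (\<Sum>k<K. norm (a k) * ((\<Sum>k<K. norm (a k)) ^ (s + t) * e))"
    proof (intro order_trans[OF norm_sum] sum_mono)
      fix k assume k: "k \<in> {..<K}"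
      have "l + t * D \<le> m - n k" using D[of k] k Suc.prems by auto
      from Suc.IH[OF this] show "norm (cnj (a k) * (\<integral>x. P x ^ s * cnj (P x) ^ t * V x ^ (m - n k) \<partial>M))
         \<le> norm (a k) * ((\<Sum>k<K. norm (a k)) ^ (s + t) * e)"
        by (auto simp: norm_mult intro!: mult_left_mono)
    qed
    finally show ?case unfolding sum_distrib_right[symmetric] by (simp add: mult.assoc)
  qed
qed


text \<open>The factor \<open>(K + 1)\<^bsup>2N\<^esup>\<close> outweighs the number of terms in a product of at most \<open>2N\<close> partial sums
  of length \<open>K\<close>, and \<open>2\<^sup>K\<close> makes the cross terms summable over \<open>K\<close>.\<close>
definition sparse :: "'a measure \<Rightarrow> ('a \<Rightarrow> complex) \<Rightarrow> nat \<Rightarrow> real \<Rightarrow> (nat \<Rightarrow> nat) \<Rightarrow> bool" where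
  "sparse M V N \<kappa> n \<longleftrightarrow> (\<forall>K. \<forall>j<K. 2 * N * n j \<le> n K) \<and>
     (\<forall>K m. n K \<le> 2 * m \<longrightarrow> norm (\<integral>x. V x ^ m \<partial>M) \<le> \<kappa> / (2 ^ K * (real K + 1) ^ (2*N)))"

text \<open>By the first clause of \<open>sparse\<close> the earlier exponents are at most
  \<open>n K div (2*N)\<close>, so \<open>q \<le> N\<close> conjugate factors use up at most half of
  \<open>n K\<close>. The second clause controls every power from half of \<open>n K\<close> on, and
  its denominator cancels the size of the coefficient sums.\<close>

lemma sparse_cross_le:
  fixes V :: "'a \<Rightarrow> complex" and a :: "nat \<Rightarrow> complex"
  assumes M: "finite_measure M" and V: "V \<in> borel_measurable M" "\<And>x. x \<in> space M \<Longrightarrow> norm (V x) = 1"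
    and n: "sparse M V N \<kappa> n" and q: "1 \<le> q" "q \<le> N" and \<kappa>: "\<kappa> \<ge> 0"
    and a: "\<And>k. k \<le> K \<Longrightarrow> norm (a k) \<le> 1"
  defines "P \<equiv> \<lambda>x. \<Sum>k<K. a k * V x ^ n k"
  shows "norm (a K * (\<integral>x. P x ^ (q-1) * cnj (P x) ^ q * V x ^ n K \<partial>M)) \<le> \<kappa> / 2 ^ K"
proof -
  define e where "e = \<kappa> / (2 ^ K * (real K + 1) ^ (2*N))"
  have e0: "e \<ge> 0" using \<kappa> by (simp add: e_def)
  have N: "N \<ge> 1" using q by simp
  have "norm (\<integral>x. P x ^ (q-1) * cnj (P x) ^ q * V x ^ n K \<partial>M) \<le> (\<Sum>k<K. norm (a k)) ^ (q-1+q) * e"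
    unfolding P_def
  proof (rule cross_integral_le[OF M V])
    \<comment> \<open>The threshold is half of \<open>n K\<close> rounded up; together with
      \<open>n K div 2\<close> for the conjugate factors it makes exactly
      \<open>n K\<close>.\<close>
    show "norm (\<integral>x. V x ^ m \<partial>M) \<le> e" if "(n K + 1) div 2 \<le> m" for m
      using n that unfolding sparse_def e_def by auto
    show "n k \<le> n K div (2*N)" if "k < K" for k
    proof -
      have "2 * N * n k \<le> n K" using n that unfolding sparse_def by auto
      then show ?thesis using N by (simp add: less_eq_div_iff_mult_less_eq mult.commute)
    qed
    have "q * (n K div (2*N)) \<le> N * (n K div 2 div N)" 
      using q by (simp add: div_mult2_eq)
    also have "\<dots> \<le> n K div 2" by simp
    finally show "(n K + 1) div 2 + q * (n K div (2 * N)) \<le> n K" by linarith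
  qed
  also have "\<dots> \<le> (real K + 1) ^ (2*N) * e"
  proof (intro mult_right_mono e0)
    have "(\<Sum>k<K. norm (a k)) \<le> (\<Sum>k<K. 1)" using a by (intro sum_mono) auto
    then have "(\<Sum>k<K. norm (a k)) \<le> real K + 1" by simp
    then have "(\<Sum>k<K. norm (a k)) ^ (q-1+q) \<le> (real K + 1) ^ (q-1+q)"
      by (intro power_mono) (auto intro: sum_nonneg)
    also have "\<dots> \<le> (real K + 1) ^ (2*N)" using q by (intro power_increasing) auto
    finally show "(\<Sum>k<K. norm (a k)) ^ (q-1+q) \<le> (real K + 1) ^ (2*N)" .
  qed
  also have "\<dots> = \<kappa> / 2 ^ K" by (simp add: e_def)
  finally have "norm (\<integral>x. P x ^ (q-1) * cnj (P x) ^ q * V x ^ n K \<partial>M) \<le> \<kappa> / 2 ^ K" .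
  then have "norm (a K) * norm (\<integral>x. P x ^ (q-1) * cnj (P x) ^ q * V x ^ n K \<partial>M) \<le> 1 * (\<kappa> / 2 ^ K)"
    using a[of K] by (intro mult_mono) auto
  then show ?thesis by (simp add: norm_mult)
qed

lemma norm_le_1_of_sum_squares:
  fixes a :: "nat \<Rightarrow> complex"
  assumes "(\<Sum>k<K. (norm (a k))\<^sup>2) \<le> 1" "k < K"
  shows "norm (a k) \<le> 1"
proof -
  have "(norm (a k))\<^sup>2 \<le> (\<Sum>k<K. (norm (a k))\<^sup>2)"
    using assms(2) by (intro member_le_sum) auto
  then have "(norm (a k))\<^sup>2 \<le> 1" using assms(1) by simp
  then show ?thesis by (simp add: power_le_one_iff abs_square_le_1)
qed

lemma sum_half_powers_le: "c \<ge> 0 \<Longrightarrow> (\<Sum>k<K. c / 2 ^ k) \<le> 2 * (c::real)"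
proof -
  assume c: "c \<ge> 0"
  have "(\<Sum>k<K. c / 2 ^ k) = 2 * c - 2 * c / 2 ^ K"
    by (induction K) (auto simp: field_simps)
  then show ?thesis using c by simp
qed

text \<open>Brings the linear term of \<open>power_norm_add_le\<close> into the form treated by
  \<open>sparse_cross_le\<close>. Conjugation does not change the real part and moves the bar from
  the new term to \<open>x\<close>, whence one more conjugate factor than plain ones.\<close>

lemma Re_cross_term:
  fixes x a v :: complex
  assumes "q \<ge> 1"
  shows "norm x ^ (2*(q-1)) * Re (x * cnj (a * v)) = Re (a * (x ^ (q-1) * cnj x ^ q * v))"
proof -
  have "complex_of_real (norm x ^ (2*(q-1))) = x ^ (q-1) * cnj x ^ (q-1)"
    unfolding power_mult of_real_power[of "(norm x)\<^sup>2"] complex_norm_square power_mult_distrib ..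
  moreover have "cnj x ^ q = cnj x * cnj x ^ (q-1)" using assms by (metis power_eq_if not_one_le_zero)
  ultimately have *: "a * (x ^ (q-1) * cnj x ^ q * v) = complex_of_real (norm x ^ (2*(q-1))) * (cnj x * (a * v))"
    by (simp add: mult_ac)
  have "Re (x * cnj (a * v)) = Re (cnj (x * cnj (a * v)))" by (simp only: cnj.sel)
  also have "\<dots> = Re (cnj x * (a * v))" by simp
  finally show ?thesis unfolding * by simp
qed

text \<open>Induction on the order and, inside it, on the number of terms. Adding term
  \<open>K\<close> costs a cross term of size \<open>\<kappa> / 2 ^ K\<close> and a remainder
  proportional to \<open>(norm (a K))^2\<close>, whose factor is the bound already found for order
  \<open>2*(q-1)\<close>. Both are summable over \<open>K\<close>, so the bound is independent of
  \<open>n\<close>, \<open>a\<close> and \<open>K\<close>.\<close>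

lemma sparse_moment_le:
  fixes V :: "'a \<Rightarrow> complex"
  assumes M: "finite_measure M" and V: "V \<in> borel_measurable M" "\<And>x. x \<in> space M \<Longrightarrow> norm (V x) = 1"
    and q: "q \<le> N" and \<kappa>: "\<kappa> \<ge> 0"
  shows "\<exists>B\<ge>0. \<forall>n a K. sparse M V N \<kappa> n \<longrightarrow> (\<Sum>k<K. (norm (a k))\<^sup>2) \<le> 1 \<longrightarrow>
           (\<integral>x. norm (\<Sum>k<K. a k * V x ^ n k) ^ (2*q) \<partial>M) \<le> B"
  using q
proof (induction q)
  case 0
  then show ?case by (intro exI[of _ "measure M (space M)"]) auto
next
  case (Suc q')
  define q where "q = Suc q'"
  define \<mu> where "\<mu> = measure M (space M)"
  have q: "1 \<le> q" "q \<le> N" "q' = q - 1" using Suc.prems by (auto simp: q_def)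
  from Suc obtain B where B: "B \<ge> 0" "\<And>n a K. sparse M V N \<kappa> n \<Longrightarrow> (\<Sum>k<K. (norm (a k))\<^sup>2) \<le> 1 \<Longrightarrow>
           (\<integral>x. norm (\<Sum>k<K. a k * V x ^ n k) ^ (2*(q-1)) \<partial>M) \<le> B" unfolding q(3) by auto
  obtain C where C: "C \<ge> 0" "\<And>x y :: complex. norm y \<le> 1 \<Longrightarrow>
    norm (x + y) ^ (2*q) \<le> norm x ^ (2*q) + 2 * real q * norm x ^ (2*(q-1)) * Re (x * cnj y)
       + (norm y)\<^sup>2 * (C * (1 + norm x ^ (2*(q-1))))" using power_norm_add_le[OF q(1)] by blast
  define D where "D = C * (\<mu> + B)"
  have D: "D \<ge> 0" using C B by (simp add: D_def \<mu>_def)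
  show ?case unfolding q_def[symmetric]
  proof (intro exI[of _ "2 * real q * (2 * \<kappa>) + D"] conjI allI impI)
    show "0 \<le> 2 * real q * (2 * \<kappa>) + D" using \<kappa> D by simp
    fix n and a :: "nat \<Rightarrow> complex" and K assume n: "sparse M V N \<kappa> n"
    assume aK: "(\<Sum>k<K. (norm (a k))\<^sup>2) \<le> 1"
    \<comment> \<open>The induction on \<open>K\<close> has to carry both partial sums; a bound
      independent of \<open>K\<close> would not reproduce itself when a term is added.\<close>
    have "(\<integral>x. norm (\<Sum>k<K. a k * V x ^ n k) ^ (2*q) \<partial>M)
        \<le> 2 * real q * (\<Sum>k<K. \<kappa> / 2 ^ k) + D * (\<Sum>k<K. (norm (a k))\<^sup>2)" using aK
    proof (induction K)
      case 0
      have "2 * q \<noteq> 0" using q by simp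
      then show ?case by (simp only: lessThan_0 sum.empty norm_zero zero_power) simp
    next
      case (Suc K)
      define P where "P = (\<lambda>x. \<Sum>k<K. a k * V x ^ n k)"
      have aK: "(\<Sum>k<K. (norm (a k))\<^sup>2) \<le> 1" 
        using Suc.prems by simp (smt (verit) zero_le_power2)
      have a1: "norm (a k) \<le> 1" if "k \<le> K" for k
        using norm_le_1_of_sum_squares[OF Suc.prems, of k] that by simp
      have PB: "norm (P x) \<le> (\<Sum>k<K. norm (a k))" if "x \<in> space M" for x
        unfolding P_def by (rule norm_lacunary_le) (simp add: V(2)[OF that])
      have Pm: "P \<in> borel_measurable M" unfolding P_def using V(1) by measurable
      have intP: "integrable M (\<lambda>x. norm (P x) ^ j)" for j
        using PB Pm by (intro integrable_norm_bound[OF M, where B = "(\<Sum>k<K. norm (a k)) ^ j"])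
          (auto simp: power_mono)
      have intc: "integrable M (\<lambda>x. a K * (P x ^ (q-1) * cnj (P x) ^ q * V x ^ n K))"
      proof (rule integrable_norm_bound[OF M, where B = "norm (a K) * (\<Sum>k<K. norm (a k)) ^ (q - 1 + q)"])
        show "(\<lambda>x. a K * (P x ^ (q-1) * cnj (P x) ^ q * V x ^ n K)) \<in> borel_measurable M"
          using Pm V(1) by (intro borel_measurable_times borel_measurable_power measurable_cnj borel_measurable_const)
        show "norm (a K * (P x ^ (q-1) * cnj (P x) ^ q * V x ^ n K)) \<le> norm (a K) * (\<Sum>k<K. norm (a k)) ^ (q - 1 + q)"
          if "x \<in> space M" for x
          using PB[OF that] V(2)[OF that]
          by (simp add: norm_mult norm_power power_add[symmetric] power_mono mult_left_mono)
      qed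
      have intPS: "integrable M (\<lambda>x. norm (\<Sum>k<Suc K. a k * V x ^ n k) ^ (2*q))"
        using V norm_lacunary_le[of "V x" a n "Suc K" for x] 
        by (intro integrable_norm_bound[OF M, where B = "(\<Sum>k<Suc K. norm (a k)) ^ (2*q)"])
          (auto simp del: sum.lessThan_Suc intro!: power_mono)
      have "(\<integral>x. norm (\<Sum>k<Suc K. a k * V x ^ n k) ^ (2*q) \<partial>M)
         \<le> (\<integral>x. norm (P x) ^ (2*q) + 2 * real q * Re (a K * (P x ^ (q-1) * cnj (P x) ^ q * V x ^ n K))
              + (norm (a K))\<^sup>2 * C * (1 + norm (P x) ^ (2*(q-1))) \<partial>M)"
      proof (rule integral_mono[OF intPS])
        show "integrable M (\<lambda>x. norm (P x) ^ (2*q) + 2 * real q * Re (a K * (P x ^ (q-1) * cnj (P x) ^ q * V x ^ n K))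
              + (norm (a K))\<^sup>2 * C * (1 + norm (P x) ^ (2*(q-1))))"
          using intP finite_measure.integrable_const[OF M]
          by (intro Bochner_Integration.integrable_add integrable_mult_right[OF integrable_Re[OF intc]]
              integrable_mult_right) auto
        fix x assume x: "x \<in> space M"
        have "norm (a K * V x ^ n K) = norm (a K)" using V(2)[OF x] by (simp add: norm_mult norm_power)
        then show "norm (\<Sum>k<Suc K. a k * V x ^ n k) ^ (2*q) \<le> norm (P x) ^ (2*q)
            + 2 * real q * Re (a K * (P x ^ (q-1) * cnj (P x) ^ q * V x ^ n K))
            + (norm (a K))\<^sup>2 * C * (1 + norm (P x) ^ (2*(q-1)))"
          using C(2)[of "a K * V x ^ n K" "P x"] a1[of K] Re_cross_term[OF q(1), of "P x" "a K" "V x ^ n K"]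
          by (simp add: P_def mult.assoc)
      qed
      also have "\<dots> = (\<integral>x. norm (P x) ^ (2*q) \<partial>M)
            + 2 * real q * Re (a K * (\<integral>x. P x ^ (q-1) * cnj (P x) ^ q * V x ^ n K \<partial>M))
            + (norm (a K))\<^sup>2 * C * (\<mu> + (\<integral>x. norm (P x) ^ (2*(q-1)) \<partial>M))"
      proof -
        have "(\<integral>x. Re (a K * (P x ^ (q-1) * cnj (P x) ^ q * V x ^ n K)) \<partial>M)
          = Re (a K * (\<integral>x. P x ^ (q-1) * cnj (P x) ^ q * V x ^ n K \<partial>M))"
          using intc by (subst integral_Re) auto
        then show ?thesis
          using integral_lin3[OF M intP integrable_Re[OF intc] intP] by (simp add: \<mu>_def)
      qed
      also have "\<dots> \<le> (2 * real q * (\<Sum>k<K. \<kappa> / 2 ^ k) + D * (\<Sum>k<K. (norm (a k))\<^sup>2))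
            + 2 * real q * (\<kappa> / 2 ^ K) + (norm (a K))\<^sup>2 * C * (\<mu> + B)"
      proof -
        have "(\<integral>x. norm (P x) ^ (2*q) \<partial>M) \<le> 2 * real q * (\<Sum>k<K. \<kappa> / 2 ^ k) + D * (\<Sum>k<K. (norm (a k))\<^sup>2)"
          using Suc.IH[OF aK] by (simp add: P_def)
        moreover have "2 * real q * Re (a K * (\<integral>x. P x ^ (q-1) * cnj (P x) ^ q * V x ^ n K \<partial>M))
            \<le> 2 * real q * (\<kappa> / 2 ^ K)"
        proof (rule mult_left_mono)
          show "Re (a K * (\<integral>x. P x ^ (q-1) * cnj (P x) ^ q * V x ^ n K \<partial>M)) \<le> \<kappa> / 2 ^ K"
            unfolding P_def
            by (rule order_trans[OF complex_Re_le_cmod sparse_cross_le[OF M V n q(1,2) \<kappa> a1]])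
        qed simp
        moreover have "(\<integral>x. norm (P x) ^ (2*(q-1)) \<partial>M) \<le> B"
          using B(2)[OF n aK] by (simp add: P_def)
        then have "(norm (a K))\<^sup>2 * C * (\<mu> + (\<integral>x. norm (P x) ^ (2*(q-1)) \<partial>M)) \<le> (norm (a K))\<^sup>2 * C * (\<mu> + B)"
          using C by (intro mult_left_mono) auto
        ultimately show ?thesis by (intro add_mono)
      qed
      also have "\<dots> = 2 * real q * (\<Sum>k<Suc K. \<kappa> / 2 ^ k) + D * (\<Sum>k<Suc K. (norm (a k))\<^sup>2)"
      proof -
        have *: "(norm (a K))\<^sup>2 * C * (\<mu> + B) = D * (norm (a K))\<^sup>2" by (simp add: D_def mult_ac)
        show ?thesis unfolding * unfolding sum.lessThan_Suc distrib_left by linarith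
      qed
      finally show ?case .
    qed
    also have "\<dots> \<le> 2 * real q * (2 * \<kappa>) + D * 1"
      using aK sum_half_powers_le[OF \<kappa>] D by (intro add_mono mult_left_mono) auto
    finally show "(\<integral>x. norm (\<Sum>k<K. a k * V x ^ n k) ^ (2*q) \<partial>M) \<le> 2 * real q * (2 * \<kappa>) + D" by simp
  qed
qed

text \<open>For the square the expansion is an identity, so each new term contributes its full mass
  \<open>(norm (a K))^2 * \<mu>\<close> and a cross term now estimated from below. The cross terms
  lose \<open>2 * (\<Sum>k<K. \<kappa> / 2 ^ k)\<close>, which is at most
  \<open>4 * \<kappa>\<close>.\<close>

lemma sparse_square_ge:
  fixes V :: "'a \<Rightarrow> complex"
  assumes M: "finite_measure M" and V: "V \<in> borel_measurable M" "\<And>x. x \<in> space M \<Longrightarrow> norm (V x) = 1"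
    and N: "1 \<le> N" and \<kappa>: "\<kappa> \<ge> 0" and n: "sparse M V N \<kappa> n"
    and aK: "(\<Sum>k<K. (norm (a k))\<^sup>2) \<le> 1"
  shows "measure M (space M) * (\<Sum>k<K. (norm (a k))\<^sup>2) - 4 * \<kappa>
    \<le> (\<integral>x. norm (\<Sum>k<K. a k * V x ^ n k) ^ 2 \<partial>M)"
proof -
  define \<mu> where "\<mu> = measure M (space M)"
  have "\<mu> * (\<Sum>k<K. (norm (a k))\<^sup>2) - 2 * (\<Sum>k<K. \<kappa> / 2 ^ k)
    \<le> (\<integral>x. norm (\<Sum>k<K. a k * V x ^ n k) ^ 2 \<partial>M)" using aK
  proof (induction K)
    case 0
    then show ?case by simp
  next
    case (Suc K)
    define P where "P = (\<lambda>x. \<Sum>k<K. a k * V x ^ n k)"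
    have aK: "(\<Sum>k<K. (norm (a k))\<^sup>2) \<le> 1" 
      using Suc.prems by simp (smt (verit) zero_le_power2)
    have a1: "norm (a k) \<le> 1" if "k \<le> K" for k
      using norm_le_1_of_sum_squares[OF Suc.prems, of k] that by simp
    have PB: "norm (P x) \<le> (\<Sum>k<K. norm (a k))" if "x \<in> space M" for x
      unfolding P_def by (rule norm_lacunary_le) (simp add: V(2)[OF that])
    have Pm: "P \<in> borel_measurable M" unfolding P_def using V(1) by measurable
    have intP: "integrable M (\<lambda>x. norm (P x) ^ j)" for j
      using PB Pm by (intro integrable_norm_bound[OF M, where B = "(\<Sum>k<K. norm (a k)) ^ j"])
        (auto simp: power_mono)
    have intc: "integrable M (\<lambda>x. a K * (cnj (P x) * V x ^ n K))"
    proof (rule integrable_norm_bound[OF M, where B = "norm (a K) * (\<Sum>k<K. norm (a k))"])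
      show "(\<lambda>x. a K * (cnj (P x) * V x ^ n K)) \<in> borel_measurable M"
        using Pm V(1) by (intro borel_measurable_times borel_measurable_power measurable_cnj borel_measurable_const)
      show "norm (a K * (cnj (P x) * V x ^ n K)) \<le> norm (a K) * (\<Sum>k<K. norm (a k))"
        if "x \<in> space M" for x
        using PB[OF that] V(2)[OF that]
        by (simp add: norm_mult norm_power mult_left_mono)
    qed
    have "norm (\<Sum>k<Suc K. a k * V x ^ n k) ^ 2 = norm (P x) ^ 2 + (norm (a K))\<^sup>2
       + 2 * Re (a K * (cnj (P x) * V x ^ n K))" if x: "x \<in> space M" for x
    proof -
      have *: "norm (u + y) ^ 2 = norm u ^ 2 + (norm y)\<^sup>2 + 2 * Re (y * cnj u)" for u y :: complex
        unfolding cmod_power2 by (simp add: algebra_simps power2_eq_square)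
      have "norm (a K * V x ^ n K) = norm (a K)" using V(2)[OF x] by (simp add: norm_mult norm_power)
      then show ?thesis using *[of "P x" "a K * V x ^ n K"] by (simp add: P_def mult_ac)
    qed
    then have "(\<integral>x. norm (\<Sum>k<Suc K. a k * V x ^ n k) ^ 2 \<partial>M)
      = (\<integral>x. norm (P x) ^ 2 + (norm (a K))\<^sup>2 + 2 * Re (a K * (cnj (P x) * V x ^ n K)) \<partial>M)"
      by (rule Bochner_Integration.integral_cong[OF refl])
    also have "\<dots> = (\<integral>x. norm (P x) ^ 2 \<partial>M) + (norm (a K))\<^sup>2 * \<mu>
       + 2 * Re (a K * (\<integral>x. cnj (P x) * V x ^ n K \<partial>M))"
    proof -
      have "(\<integral>x. Re (a K * (cnj (P x) * V x ^ n K)) \<partial>M)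
          = Re (a K * (\<integral>x. cnj (P x) * V x ^ n K \<partial>M))"
        using intc by (subst integral_Re) auto
      then show ?thesis
        using integral_lin3[OF M intP[of 2] integrable_Re[OF intc], of "\<lambda>_. 0" 2 "(norm (a K))\<^sup>2"]
        by (simp add: \<mu>_def add_ac)
    qed
    finally have eq: "(\<integral>x. norm (\<Sum>k<Suc K. a k * V x ^ n k) ^ 2 \<partial>M) = \<dots>" .
    have "norm (a K * (\<integral>x. cnj (P x) * V x ^ n K \<partial>M)) \<le> \<kappa> / 2 ^ K"
      using sparse_cross_le[OF M V n order_refl N \<kappa> a1] unfolding P_def by simp
    then have "Re (a K * (\<integral>x. cnj (P x) * V x ^ n K \<partial>M)) \<ge> - (\<kappa> / 2 ^ K)"
      using abs_Re_le_cmod[of "a K * (\<integral>x. cnj (P x) * V x ^ n K \<partial>M)"] by linarith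
    moreover have "\<mu> * (\<Sum>k<K. (norm (a k))\<^sup>2) - 2 * (\<Sum>k<K. \<kappa> / 2 ^ k) \<le> (\<integral>x. norm (P x) ^ 2 \<partial>M)"
      using Suc.IH[OF aK] by (simp add: P_def)
    moreover have "(norm (a K))\<^sup>2 * \<mu> = \<mu> * (norm (a K))\<^sup>2" by simp
    ultimately show ?case
      by (subst eq, unfold sum.lessThan_Suc distrib_left) linarith
  qed
  then show ?thesis using sum_half_powers_le[OF \<kappa>, of K] by (simp add: \<mu>_def)
qed

section \<open>Powers of the boundary function\<close>

abbreviation circle_angles :: "real measure" where
  "circle_angles \<equiv> lebesgue_on {0..2*pi}"

section \<open>Integrals of powers of a self-map over arcs and Borel sets of angles\<close>

text \<open>\<open>U\<close> is a primitive of \<open>(u z - u 0) / z\<close> with the singularity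
  at 0 removed. The velocity of \<open>r * cis t\<close> is \<open>\<i>\<close> times the point
  itself, which cancels the denominator: along the circle \<open>U\<close> has derivative
  \<open>\<i> * (u - u 0)\<close>. Arc integrals at different radii can thus be compared through
  increments of one function \<open>U\<close>.\<close>

lemma arc_integral_primitive:
  fixes u :: "complex \<Rightarrow> complex"
  assumes u: "u holomorphic_on ball 0 R"
  shows "\<exists>U. (\<forall>z\<in>ball 0 R. (U has_field_derivative (if z = 0 then deriv u 0 else (u z - u 0) / z)) (at z)) \<and>
    (\<forall>r b. 0 < r \<longrightarrow> r < R \<longrightarrow> 0 \<le> b \<longrightarrow> ((\<lambda>t. u (of_real r * cis t)) has_integral
        (of_real b * u 0 + (U (of_real r * cis b) - U (of_real r)) / \<i>)) {0..b})"
proof -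
  define d where "d = (\<lambda>z. if z = 0 then deriv u 0 else (u z - u 0) / z)"
  have "d holomorphic_on ball 0 R"
    using pole_lemma_open[OF u open_ball, of 0] by (simp add: d_def cong: if_cong)
  then obtain U where U: "\<And>z. z \<in> ball 0 R \<Longrightarrow> (U has_field_derivative d z) (at z within ball 0 R)"
    using holomorphic_convex_primitive'[OF convex_ball open_ball] by blast
  have U': "(U has_field_derivative d z) (at z)" if "z \<in> ball 0 R" for z
    using U[OF that] that at_within_open[OF that open_ball] by simp
  show ?thesis
  proof (intro exI[of _ U] conjI ballI allI impI)
    show "(U has_field_derivative (if z = 0 then deriv u 0 else (u z - u 0) / z)) (at z)"
      if "z \<in> ball 0 R" for z using U'[OF that] by (simp add: d_def)
    fix r b :: real assume r: "0 < r" "r < R" and b: "0 \<le> b"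
    have "((\<lambda>t. u (of_real r * cis t)) has_integral
       ((of_real b * u 0 + U (of_real r * cis b) / \<i>) - (of_real 0 * u 0 + U (of_real r * cis 0) / \<i>))) {0..b}"
    proof (rule fundamental_theorem_of_calculus[OF b])
      fix t :: real
      have z: "of_real r * cis t \<in> ball 0 R" using r by (simp add: norm_mult)
      have nz: "of_real r * cis t \<noteq> 0" using r by simp
      have 1: "((\<lambda>t. of_real r * cis t) has_vector_derivative (\<i> * (of_real r * cis t))) (at t within {0..b})"
      proof -
        have "((\<lambda>z. of_real r * exp (\<i> * z)) has_field_derivative of_real r * (\<i> * exp (\<i> * of_real t))) (at (of_real t))"
          by (auto intro!: derivative_eq_intros)
        from has_vector_derivative_real_field[OF this, of "{0..b}"] show ?thesis
          by (simp add: cis_conv_exp mult_ac)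
      qed
      have "((U \<circ> (\<lambda>t. of_real r * cis t)) has_vector_derivative (\<i> * (of_real r * cis t)) * d (of_real r * cis t)) (at t within {0..b})"
        by (rule field_vector_diff_chain_within[OF 1])
           (rule has_field_derivative_at_within[OF U'[OF z]])
      then have 2: "((\<lambda>t. U (of_real r * cis t)) has_vector_derivative \<i> * (u (of_real r * cis t) - u 0)) (at t within {0..b})"
        using nz by (simp add: o_def d_def)
      have "((\<lambda>t. of_real t * u 0 + U (of_real r * cis t) / \<i>) has_vector_derivative
        (of_real 1 * u 0 + \<i> * (u (of_real r * cis t) - u 0) / \<i>)) (at t within {0..b})"
        by (intro has_vector_derivative_add has_vector_derivative_mult_left has_vector_derivative_divide 2
            has_vector_derivative_of_real DERIV_ident)
      then show "((\<lambda>t. of_real t * u 0 + U (of_real r * cis t) / \<i>) has_vector_derivative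
         u (of_real r * cis t)) (at t within {0..b})" by simp
    qed
    then show "((\<lambda>t. u (of_real r * cis t)) has_integral (of_real b * u 0 + (U (of_real r * cis b) - U (of_real r)) / \<i>)) {0..b}"
      by (simp add: algebra_simps)
  qed
qed

lemma circle_mean_value:
  fixes u :: "complex \<Rightarrow> complex"
  assumes "u holomorphic_on ball 0 R" "0 < r" "r < R"
  shows "((\<lambda>t. u (of_real r * cis t)) has_integral (2 * pi * u 0)) {0..2*pi}"
proof -
  obtain U where "\<And>z. z \<in> ball 0 R \<Longrightarrow> (U has_field_derivative (if z = 0 then deriv u 0 else (u z - u 0) / z)) (at z)"
    and U: "\<And>r b. 0 < r \<Longrightarrow> r < R \<Longrightarrow> 0 \<le> b \<Longrightarrow>
      ((\<lambda>t. u (of_real r * cis t)) has_integral (of_real b * u 0 + (U (of_real r * cis b) - U (of_real r)) / \<i>)) {0..b}"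
    using arc_integral_primitive[OF assms(1)] by blast
  from U[of r "2*pi"] show ?thesis using assms by simp
qed

lemma continuous_on_circle:
  assumes "continuous_on unit_disk f" "r \<in> {0..<1}"
  shows "continuous_on A (\<lambda>t. f (of_real r * cis t))"
  by (rule continuous_on_compose2[OF assms(1)]) (use assms(2) in \<open>auto intro!: continuous_intros simp: norm_mult\<close>)

lemma finite_circle_angles: "finite_measure circle_angles"
  by (rule finite_measure_lebesgue_on) auto

lemma circle_integral_eq:
  fixes f :: "real \<Rightarrow> 'a::euclidean_space"
  assumes "continuous_on {0..2*pi} f"
  shows "integral\<^sup>L circle_angles f = integral {0..2*pi} f"
  by (rule lebesgue_integral_eq_integral[OF continuous_imp_integrable_real[OF assms]]) auto

text \<open>The point is uniformity in \<open>r\<close> up to 1. On radii up to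
  \<open>\<rho>\<close> the modulus of \<open>v\<close> stays below some \<open>s < 1\<close>, so
  high powers are small. Beyond \<open>\<rho>\<close> the arc integral differs from the one at
  \<open>\<rho>\<close> by increments of the primitive along two short radial segments; these are
  bounded independently of \<open>n\<close>, because all powers of \<open>v\<close> are bounded by
  1.\<close>

lemma arc_integral_small:
  fixes v :: "complex \<Rightarrow> complex"
  assumes v: "v holomorphic_on unit_disk" "v ` unit_disk \<subseteq> unit_disk" and e: "e > 0"
  shows "\<exists>N. \<forall>n\<ge>N. \<forall>r\<in>{0..<1}. \<forall>b\<in>{0..2*pi}.
     norm (integral {0..b} (\<lambda>t. v (of_real r * cis t) ^ n)) \<le> e"
proof -
  \<comment> \<open>The two radial increments are at most \<open>4 * (1 - \<rho>)\<close> each, so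
    together at most \<open>e / 2\<close>. Keeping \<open>\<rho>\<close> at least 1/2 keeps the
    radial segments away from the denominator \<open>z\<close>.\<close>
  define \<rho> where "\<rho> = max (1/2) (1 - e / 16)"
  have \<rho>: "1/2 \<le> \<rho>" "\<rho> < 1" "8 * (1 - \<rho>) \<le> e / 2"
    using e unfolding \<rho>_def by (auto simp: max_def)
  have "continuous_on (cball 0 \<rho>) (\<lambda>z. norm (v z))"
    using \<rho> by (intro continuous_on_norm holomorphic_on_imp_continuous_on holomorphic_on_subset[OF v(1)]) auto
  from continuous_attains_sup[OF _ _ this] obtain s0
    where s0: "s0 \<in> cball 0 \<rho>" "\<And>z. z \<in> cball 0 \<rho> \<Longrightarrow> norm (v z) \<le> norm (v s0)"
    using \<rho> by auto
  define s where "s = norm (v s0)"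
  have "v s0 \<in> unit_disk" by (rule subsetD[OF v(2)], rule imageI) (use s0(1) \<rho> in auto)
  then have s: "0 \<le> s" "s < 1" by (auto simp: s_def)
  have "(\<lambda>n. 2 * pi * s ^ n) \<longlonglongrightarrow> 2 * pi * 0"
    using s by (intro tendsto_mult tendsto_const LIMSEQ_realpow_zero)
  then have "\<forall>\<^sub>F n in sequentially. 2 * pi * s ^ n < e / 2"
    by (rule order_tendstoD(2)) (use e in auto)
  then obtain N where N: "\<And>n. n \<ge> N \<Longrightarrow> 2 * pi * s ^ n < e / 2" by (auto simp: eventually_sequentially)
  have small: "norm (integral {0..b} (\<lambda>t. v (of_real r * cis t) ^ n)) \<le> e / 2"
    if "n \<ge> N" "0 \<le> r" "r \<le> \<rho>" "b \<in> {0..2*pi}" for n and r b :: real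
  proof -
    have 1: "norm (v (of_real r * cis t) ^ n) \<le> s ^ n" for t
      using s0(2)[of "of_real r * cis t"] that by (simp add: norm_power s_def power_mono norm_mult)
    have "continuous_on {0..b} (\<lambda>t. v (of_real r * cis t) ^ n)"
      using that \<rho> by (intro continuous_on_power continuous_on_circle holomorphic_on_imp_continuous_on v) auto
    then have "norm (integral {0..b} (\<lambda>t. v (of_real r * cis t) ^ n)) \<le> s ^ n * (b - 0)"
      using that 1 by (intro integral_bound) auto
    also have "\<dots> \<le> s ^ n * (2 * pi)" using that s by (intro mult_left_mono) auto
    also have "\<dots> \<le> e / 2" using N[OF that(1)] by (simp add: mult.commute)
    finally show ?thesis .
  qed
  show ?thesis
  proof (intro exI allI impI ballI)
    fix n and r b :: real assume n: "N \<le> n" and r: "r \<in> {0..<1}" and b: "b \<in> {0..2*pi}"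
    show "norm (integral {0..b} (\<lambda>t. v (of_real r * cis t) ^ n)) \<le> e"
    proof (cases "r \<le> \<rho>")
      case True
      then show ?thesis using small[OF n _ _ b, of r] r e by auto
    next
      case False
      define u where "u = (\<lambda>z. v z ^ n)"
      have u: "u holomorphic_on ball 0 1" unfolding u_def by (intro holomorphic_on_power v)
      have u1: "norm (u z) \<le> 1" if "z \<in> ball 0 1" for z
        using v(2) that unfolding u_def by (force simp: norm_power intro!: power_le_one)
      obtain U where U: "\<And>z. z \<in> ball 0 1 \<Longrightarrow> (U has_field_derivative (if z = 0 then deriv u 0 else (u z - u 0) / z)) (at z)"
        "\<And>r b. 0 < r \<Longrightarrow> r < 1 \<Longrightarrow> 0 \<le> b \<Longrightarrow>
          ((\<lambda>t. u (of_real r * cis t)) has_integral (of_real b * u 0 + (U (of_real r * cis b) - U (of_real r)) / \<i>)) {0..b}"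
        using arc_integral_primitive[OF u] by blast
      \<comment> \<open>On the radial segment the derivative of \<open>U\<close> is at most
        \<open>2 / (1/2)\<close>, as \<open>norm (u z - u 0) \<le> 2\<close> and
        \<open>norm z \<ge> 1/2\<close>.\<close>
      have rad: "norm (U (of_real r * cis t) - U (of_real \<rho> * cis t)) \<le> 4 * (1 - \<rho>)" for t
      proof -
        define S where "S = closed_segment (of_real r * cis t) (of_real \<rho> * cis t)"
        have S: "z \<noteq> 0 \<and> norm z \<ge> 1/2 \<and> norm z < 1" if "z \<in> S" for z
        proof -
          from that[unfolded S_def in_segment(1)] obtain \<theta> where
            \<theta>: "0 \<le> \<theta>" "\<theta> \<le> 1" "z = (1 - \<theta>) *\<^sub>R (of_real r * cis t) + \<theta> *\<^sub>R (of_real \<rho> * cis t)"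
            by (elim exE conjE)
          have z: "z = of_real ((1 - \<theta>) * r + \<theta> * \<rho>) * cis t"
            by (simp add: \<theta>(3) scaleR_conv_of_real algebra_simps)
          have "(1 - \<theta>) * r + \<theta> * \<rho> \<ge> (1 - \<theta>) * \<rho> + \<theta> * \<rho>"
            using False \<theta> by (intro add_mono mult_left_mono) auto
          then have 1: "(1 - \<theta>) * r + \<theta> * \<rho> \<ge> \<rho>" by (simp add: algebra_simps)
          have "(1 - \<theta>) * r + \<theta> * \<rho> \<le> (1 - \<theta>) * r + \<theta> * r"
            using False \<theta> by (intro add_mono mult_left_mono) auto
          then have 2: "(1 - \<theta>) * r + \<theta> * \<rho> \<le> r" by (simp add: algebra_simps)
          have "0 \<le> (1 - \<theta>) * r + \<theta> * \<rho>" using 1 \<rho>(1) by linarith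
          then have nz: "norm z = (1 - \<theta>) * r + \<theta> * \<rho>"
            unfolding z norm_mult norm_cis norm_of_real by (simp only: abs_of_nonneg mult_1_right)
          have "r < 1" using r by simp
          with nz 1 2 \<rho>(1) have "1/2 \<le> norm z" "norm z < 1" by linarith+
          then show ?thesis by auto
        qed
        have "norm (U (of_real r * cis t) - U (of_real \<rho> * cis t)) \<le> 4 * norm (of_real r * cis t - of_real \<rho> * cis t)"
        proof (rule field_differentiable_bound[of S])
          show "convex S" by (simp add: S_def)
          show "of_real r * cis t \<in> S" "of_real \<rho> * cis t \<in> S" by (auto simp: S_def)
          fix z assume z: "z \<in> S"
          show "(U has_field_derivative (u z - u 0) / z) (at z within S)"
            using U(1)[of z] S[OF z] by (auto intro: has_field_derivative_at_within)
          have "norm (u z - u 0) \<le> 2"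
            using u1[of z] u1[of 0] S[OF z] norm_triangle_ineq4[of "u z" "u 0"] by auto
          then have "norm (u z - u 0) / norm z \<le> 2 / (1/2)"
            using S[OF z] by (intro frac_le) auto
          then show "norm ((u z - u 0) / z) \<le> 4" by (simp add: norm_divide)
        qed
        also have "norm (of_real r * cis t - of_real \<rho> * cis t) = r - \<rho>"
          unfolding left_diff_distrib[symmetric] of_real_diff[symmetric] norm_mult norm_cis norm_of_real
          using False by simp
        finally show ?thesis using r by auto
      qed
      have "0 < r" using False \<rho>(1) by linarith
      moreover have "r < 1" "0 \<le> b" using r b by simp_all
      moreover have "0 < \<rho>" using \<rho>(1) by linarith
      ultimately have "0 < r" "r < 1" "0 \<le> b" "0 < \<rho>" by blast+
      note I = integral_unique[OF U(2)[OF this(1-3)]] integral_unique[OF U(2)[OF this(4) \<rho>(2) this(3)]]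
      have eq: "integral {0..b} (\<lambda>t. u (of_real r * cis t)) = integral {0..b} (\<lambda>t. u (of_real \<rho> * cis t))
        + ((U (of_real r * cis b) - U (of_real \<rho> * cis b)) - (U (of_real r * cis 0) - U (of_real \<rho> * cis 0))) / \<i>"
      proof -
        have "c + (A - B) / \<i> = (c + (C - D) / \<i>) + ((A - C) - (B - D)) / \<i>" for A B C D c
          by (simp only: diff_divide_distrib) simp
        then show ?thesis unfolding I cis_zero mult_1_right .
      qed
      have "norm (integral {0..b} (\<lambda>t. u (of_real r * cis t))) \<le> e / 2 + (4 * (1 - \<rho>) + 4 * (1 - \<rho>))"
        unfolding eq
      proof (rule norm_triangle_mono)
        show "norm (integral {0..b} (\<lambda>t. u (of_real \<rho> * cis t))) \<le> e / 2"
          using small[OF n _ order_refl b] \<rho>(1) by (simp add: u_def)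
        show "norm (((U (of_real r * cis b) - U (of_real \<rho> * cis b)) - (U (of_real r * cis 0) - U (of_real \<rho> * cis 0))) / \<i>)
          \<le> 4 * (1 - \<rho>) + 4 * (1 - \<rho>)"
          unfolding norm_divide norm_ii div_by_1
          by (rule order_trans[OF norm_triangle_ineq4 add_mono[OF rad[of b] rad[of 0]]])
      qed
      also have "\<dots> \<le> e" using \<rho>(3) by linarith
      finally show ?thesis by (simp only: u_def)
    qed
  qed
qed

text \<open>Dynkin's pi-lambda argument: half-lines are stable under intersection and generate the
  Borel sets, they meet the range of angles in arcs starting at 0, and the property \<open>Q\<close>
  passes to complements and countable disjoint unions. Uniformity in \<open>r\<close> survives
  because the powers of \<open>v\<close> are bounded by 1, so a set of small measure contributes
  little at every radius.\<close>

lemma indicator_integral_small: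
  fixes v :: "complex \<Rightarrow> complex"
  assumes v: "v holomorphic_on unit_disk" "v ` unit_disk \<subseteq> unit_disk" and A: "A \<in> sets borel" and e: "e > 0"
  shows "\<exists>N. \<forall>n\<ge>N. \<forall>r\<in>{0..<1}. norm (\<integral>t. indicator A t *\<^sub>R v (of_real r * cis t) ^ n \<partial>circle_angles) \<le> e"
proof -
  let ?C = circle_angles
  define u where "u = (\<lambda>n r t. v (of_real r * cis t) ^ n)"
  have ucont: "continuous_on S (u n r)" if "r \<in> {0..<1}" for n r S
    unfolding u_def using that by (intro continuous_on_power continuous_on_circle holomorphic_on_imp_continuous_on v)
  have um: "u n r \<in> borel_measurable ?C" if "r \<in> {0..<1}" for n r
    by (rule continuous_imp_measurable_on_sets_lebesgue[OF ucont[OF that]]) auto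
  have u1: "norm (u n r t) \<le> 1" if "r \<in> {0..<1}" for n r t
  proof -
    have "v (of_real r * cis t) \<in> unit_disk"
      by (rule subsetD[OF v(2)], rule imageI) (use that in \<open>auto simp: norm_mult\<close>)
    then show ?thesis by (auto simp: u_def norm_power intro!: power_le_one)
  qed
  have bm: "A \<inter> {0..2*pi} \<in> sets ?C" "indicator A \<in> borel_measurable ?C" if "A \<in> sets borel" for A :: "real set"
  proof -
    show "A \<inter> {0..2*pi} \<in> sets ?C" using that by (auto simp: sets_restrict_space_iff)
    show "indicator A \<in> borel_measurable ?C"
      by (rule measurable_restrict_space1, rule borel_measurable_indicator) (use that in auto)
  qed
  have int: "integrable ?C (\<lambda>t. indicator A t *\<^sub>R u n r t)" if "A \<in> sets borel" "r \<in> {0..<1}" for A n r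
  proof (rule integrable_norm_bound[OF finite_circle_angles, of _ 1])
    show "(\<lambda>t. indicator A t *\<^sub>R u n r t) \<in> borel_measurable ?C"
      by (rule borel_measurable_scaleR[OF bm(2)[OF that(1)] um[OF that(2)]])
    show "norm (indicator A t *\<^sub>R u n r t) \<le> 1" for t
      using u1[OF that(2)] by (simp add: indicator_def)
  qed
  have intu: "integrable ?C (u n r)" if "r \<in> {0..<1}" for n r
    by (rule integrable_norm_bound[OF finite_circle_angles um[OF that] u1[OF that]])
  define Q where "Q = (\<lambda>A. \<forall>e>0. \<exists>N. \<forall>n\<ge>N. \<forall>r\<in>{0..<1}. norm (\<integral>t. indicator A t *\<^sub>R u n r t \<partial>?C) \<le> e)"
  have QI: "Q {..b}" for b :: real
  proof (cases "b < 0")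
    case True
    have "(\<integral>t. indicator {..b} t *\<^sub>R u n r t \<partial>?C) = (\<integral>t. 0 \<partial>?C)" for n r
      using True by (intro Bochner_Integration.integral_cong) (auto simp: indicator_def)
    then show ?thesis unfolding Q_def by auto
  next
    case False
    have "(\<integral>t. indicator {..b} t *\<^sub>R u n r t \<partial>?C) = integral {0..min b (2*pi)} (u n r)" if "r \<in> {0..<1}" for n r
    proof -
      have "(\<integral>t. indicator {..b} t *\<^sub>R u n r t \<partial>?C)
        = (\<integral>t. indicator {0..2*pi} t *\<^sub>R indicator {..b} t *\<^sub>R u n r t \<partial>lebesgue)"
        by (subst integral_restrict_space) auto
      also have "\<dots> = (\<integral>t. indicator {0..min b (2*pi)} t *\<^sub>R u n r t \<partial>lebesgue)"
        by (intro Bochner_Integration.integral_cong) (auto simp: indicator_def)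
      also have "\<dots> = integral\<^sup>L (lebesgue_on {0..min b (2*pi)}) (u n r)"
        by (subst integral_restrict_space) auto
      also have "\<dots> = integral {0..min b (2*pi)} (u n r)"
        by (rule lebesgue_integral_eq_integral[OF continuous_imp_integrable_real[OF ucont[OF that]]]) auto
      finally show ?thesis .
    qed
    note eq = this
    have mb: "min b (2*pi) \<in> {0..2*pi}" using False by auto
    show ?thesis unfolding Q_def
    proof (intro allI impI)
      fix e :: real assume "e > 0"
      from arc_integral_small[OF v this] obtain N where
        "\<And>n r b. n \<ge> N \<Longrightarrow> r \<in> {0..<1} \<Longrightarrow> b \<in> {0..2*pi} \<Longrightarrow> norm (integral {0..b} (u n r)) \<le> e"
        unfolding u_def by blast
      then show "\<exists>N. \<forall>n\<ge>N. \<forall>r\<in>{0..<1}. norm (\<integral>t. indicator {..b} t *\<^sub>R u n r t \<partial>?C) \<le> e"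
        using mb by (intro exI[of _ N]) (simp add: eq)
    qed
  qed
  have sb: "sets borel = sigma_sets UNIV (range (\<lambda>a::real. {..a}))"
    by (subst borel_eq_atMost) (simp add: sets_measure_of)
  have "Int_stable (range (\<lambda>a::real. {..a}))"
    unfolding Int_stable_def by (auto simp: Int_atMost)
  moreover have "range (\<lambda>a::real. {..a}) \<subseteq> Pow UNIV" by simp
  moreover have "A \<in> sigma_sets UNIV (range (\<lambda>a::real. {..a}))" using A unfolding sb .
  ultimately have "Q A"
  proof (induction rule: sigma_sets_induct_disjoint)
    case (basic A)
    then show ?case using QI by auto
  next
    case empty
    then show ?case unfolding Q_def by auto
  next
    case (compl A)
    have A: "A \<in> sets borel" using compl(1) unfolding sb .
    show ?case unfolding Q_def
    proof (intro allI impI)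
      fix e :: real assume "e > 0"
      obtain N1 where N1: "\<And>n r. n \<ge> N1 \<Longrightarrow> r \<in> {0..<1} \<Longrightarrow> norm (\<integral>t. indicator A t *\<^sub>R u n r t \<partial>?C) \<le> e / 2"
        using compl(2) \<open>e > 0\<close> unfolding Q_def by (meson half_gt_zero)
      obtain N2 where N2: "\<And>n r. n \<ge> N2 \<Longrightarrow> r \<in> {0..<1} \<Longrightarrow> norm (\<integral>t. indicator {..2*pi} t *\<^sub>R u n r t \<partial>?C) \<le> e / 2"
        using QI[of "2*pi"] \<open>e > 0\<close> unfolding Q_def by (meson half_gt_zero)
      have "norm (\<integral>t. indicator (UNIV - A) t *\<^sub>R u n r t \<partial>?C) \<le> e" if n: "n \<ge> max N1 N2" and r: "r \<in> {0..<1}" for n r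
      proof -
        have "(\<integral>t. indicator (UNIV - A) t *\<^sub>R u n r t \<partial>?C)
          = (\<integral>t. indicator {..2*pi} t *\<^sub>R u n r t - indicator A t *\<^sub>R u n r t \<partial>?C)"
          by (intro Bochner_Integration.integral_cong) (auto simp: indicator_def)
        also have "\<dots> = (\<integral>t. indicator {..2*pi} t *\<^sub>R u n r t \<partial>?C) - (\<integral>t. indicator A t *\<^sub>R u n r t \<partial>?C)"
          using A r by (intro Bochner_Integration.integral_diff int) auto
        finally show ?thesis
          using N1[OF _ r, of n] N2[OF _ r, of n] n norm_triangle_ineq4[of "\<integral>t. indicator {..2*pi} t *\<^sub>R u n r t \<partial>?C" "\<integral>t. indicator A t *\<^sub>R u n r t \<partial>?C"]
          by simp
      qed
      then show "\<exists>N. \<forall>n\<ge>N. \<forall>r\<in>{0..<1}. norm (\<integral>t. indicator (UNIV - A) t *\<^sub>R u n r t \<partial>?C) \<le> e" by blast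
    qed
  next
    case (union A)
    have A: "A i \<in> sets borel" for i using union(2) unfolding sb by auto
    define A' where "A' = (\<lambda>i. A i \<inter> {0..2*pi})"
    have A's: "A' i \<in> sets ?C" for i unfolding A'_def by (rule bm(1)[OF A])
    have A'd: "disjoint_family A'" using union(1) unfolding A'_def disjoint_family_on_def by blast
    interpret finite_measure ?C by (rule finite_circle_angles)
    have sums: "(\<lambda>i. measure ?C (A' i)) sums measure ?C (\<Union>i. A' i)"
      by (rule finite_measure_UNION) (use A's A'd in auto)
    show ?case unfolding Q_def
    proof (intro allI impI)
      fix e :: real assume e: "e > 0"
      have "\<forall>\<^sub>F m in sequentially. measure ?C (\<Union>i. A' i) - e / 2 < (\<Sum>i<m. measure ?C (A' i))"
        using sums e unfolding sums_def by (intro order_tendstoD(1)) auto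
      then obtain m where m: "measure ?C (\<Union>i. A' i) - e / 2 < (\<Sum>i<m. measure ?C (A' i))"
        by (auto simp: eventually_sequentially)
      \<comment> \<open>The tail \<open>R\<close> is disposed of by its measure alone, at cost
        \<open>e / 2\<close>. Each of the first \<open>m\<close> pieces gets the share
        \<open>e / (2 * (real m + 1))\<close>, where the summand 1 covers
        \<open>m = 0\<close>.\<close>
      define R where "R = (\<Union>i. A i) - (\<Union>i<m. A i)"
      have Rb: "R \<in> sets borel" unfolding R_def using A by auto
      have "measure ?C (R \<inter> {0..2*pi}) = measure ?C ((\<Union>i. A' i) - (\<Union>i<m. A' i))"
        by (rule arg_cong[where f = "measure ?C"]) (auto simp: R_def A'_def)
      also have "\<dots> = measure ?C (\<Union>i. A' i) - measure ?C (\<Union>i<m. A' i)"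
        by (rule finite_measure_Diff) (use A's in auto)
      also have "measure ?C (\<Union>i<m. A' i) = (\<Sum>i<m. measure ?C (A' i))"
        by (rule finite_measure_finite_Union) (use A's A'd in \<open>auto simp: disjoint_family_on_def\<close>)
      finally have Rsmall: "measure ?C (R \<inter> {0..2*pi}) \<le> e / 2" using m by simp
      have "\<exists>N. \<forall>n\<ge>N. \<forall>r\<in>{0..<1}. norm (\<integral>t. indicator (A i) t *\<^sub>R u n r t \<partial>?C) \<le> e / (2 * (real m + 1))" for i
        using union(3)[of i] e unfolding Q_def by simp
      then obtain Nf where Nf: "\<And>i n r. n \<ge> Nf i \<Longrightarrow> r \<in> {0..<1} \<Longrightarrow>
          norm (\<integral>t. indicator (A i) t *\<^sub>R u n r t \<partial>?C) \<le> e / (2 * (real m + 1))" by metis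
      have "norm (\<integral>t. indicator (\<Union>i. A i) t *\<^sub>R u n r t \<partial>?C) \<le> e"
        if n: "n \<ge> (\<Sum>i<m. Nf i)" and r: "r \<in> {0..<1}" for n r
      proof -
        have ind: "indicator (\<Union>i. A i) t = indicator R t + (\<Sum>i<m. indicator (A i) t :: real)" for t
        proof -
          have "(\<Sum>i<m. indicator (A i) t :: real) = indicator (\<Union>i<m. A i) t"
            by (rule indicator_UN_disjoint[symmetric]) (use union(1) in \<open>auto simp: disjoint_family_on_def\<close>)
          then show ?thesis unfolding R_def by (auto simp: indicator_def)
        qed
        have "(\<integral>t. indicator (\<Union>i. A i) t *\<^sub>R u n r t \<partial>?C)
          = (\<integral>t. indicator R t *\<^sub>R u n r t + (\<Sum>i<m. indicator (A i) t *\<^sub>R u n r t) \<partial>?C)"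
          by (simp add: ind scaleR_add_left scaleR_sum_left)
        also have "\<dots> = (\<integral>t. indicator R t *\<^sub>R u n r t \<partial>?C) + (\<Sum>i<m. \<integral>t. indicator (A i) t *\<^sub>R u n r t \<partial>?C)"
        proof (subst Bochner_Integration.integral_add)
          show "integrable ?C (\<lambda>t. \<Sum>i<m. indicator (A i) t *\<^sub>R u n r t)"
            by (intro Bochner_Integration.integrable_sum int[OF A r])
          have "(\<integral>t. (\<Sum>i<m. indicator (A i) t *\<^sub>R u n r t) \<partial>?C) = (\<Sum>i<m. \<integral>t. indicator (A i) t *\<^sub>R u n r t \<partial>?C)"
            by (intro Bochner_Integration.integral_sum int[OF A r])
          then show "(\<integral>t. indicator R t *\<^sub>R u n r t \<partial>?C) + (\<integral>t. (\<Sum>i<m. indicator (A i) t *\<^sub>R u n r t) \<partial>?C)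
            = (\<integral>t. indicator R t *\<^sub>R u n r t \<partial>?C) + (\<Sum>i<m. \<integral>t. indicator (A i) t *\<^sub>R u n r t \<partial>?C)" by simp
        qed (rule int[OF Rb r])
        also have "norm \<dots> \<le> e / 2 + (\<Sum>i<m. e / (2 * (real m + 1)))"
        proof (intro norm_triangle_mono order_trans[OF norm_sum] sum_mono)
          have "norm (\<integral>t. indicator R t *\<^sub>R u n r t \<partial>?C) \<le> (\<integral>t. norm (indicator R t *\<^sub>R u n r t) \<partial>?C)"
            by (rule integral_norm_bound)
          also have "\<dots> \<le> (\<integral>t. indicator (R \<inter> {0..2*pi}) t \<partial>?C)"
          proof (rule integral_mono)
            show "integrable ?C (\<lambda>t. norm (indicator R t *\<^sub>R u n r t))"
              by (rule integrable_norm[OF int[OF Rb r]])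
            show "integrable ?C (indicator (R \<inter> {0..2*pi}) :: real \<Rightarrow> real)"
              using bm(1)[OF Rb] by (rule integrable_real_indicator) (simp add: emeasure_eq_measure)
            show "norm (indicator R t *\<^sub>R u n r t) \<le> indicator (R \<inter> {0..2*pi}) t" if "t \<in> space ?C" for t
              using u1[OF r, of n t] that by (simp add: indicator_def)
          qed
          also have "\<dots> = measure ?C (R \<inter> {0..2*pi})" using bm(1)[OF Rb] by simp
          finally show "norm (\<integral>t. indicator R t *\<^sub>R u n r t \<partial>?C) \<le> e / 2" using Rsmall by simp
          fix i assume i: "i \<in> {..<m}"
          have "Nf i \<le> (\<Sum>i<m. Nf i)" using i by (intro member_le_sum) auto
          then show "norm (\<integral>t. indicator (A i) t *\<^sub>R u n r t \<partial>?C) \<le> e / (2 * (real m + 1))" using Nf n r by auto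
        qed
        also have "(\<Sum>i<m. e / (2 * (real m + 1))) \<le> e / 2" using e by (simp add: field_simps)
        finally show ?thesis by simp
      qed
      then show "\<exists>N. \<forall>n\<ge>N. \<forall>r\<in>{0..<1}. norm (\<integral>t. indicator (\<Union>i. A i) t *\<^sub>R u n r t \<partial>?C) \<le> e" by blast
    qed
  qed
  then show ?thesis using e unfolding Q_def u_def by blast
qed

section \<open>Radial limits on the boundary and the choice of the exponents\<close>

lemma bounded_convergence:
  fixes f :: "'a \<Rightarrow> 'b::{banach, second_countable_topology}"
  assumes M: "finite_measure M" and s: "\<And>i. s i \<in> borel_measurable M"
    and B: "\<And>i x. x \<in> space M \<Longrightarrow> norm (s i x) \<le> B"
    and lim: "\<And>x. x \<in> space M \<Longrightarrow> (\<lambda>i. s i x) \<longlonglongrightarrow> f x"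
  shows "(\<lambda>i. integral\<^sup>L M (s i)) \<longlonglongrightarrow> integral\<^sup>L M f"
proof (rule integral_dominated_convergence[where w = "\<lambda>_. B"])
  show "f \<in> borel_measurable M" by (rule borel_measurable_LIMSEQ_metric[OF s lim])
  show "integrable M (\<lambda>_. B)" by (rule finite_measure.integrable_const[OF M])
qed (use s B lim in auto)

lemma restrict_integral_eq:
  fixes f :: "real \<Rightarrow> 'b::{banach, second_countable_topology}"
  assumes "E \<in> sets lebesgue" "E \<subseteq> {0..2*pi}"
  shows "integral\<^sup>L (lebesgue_on E) f = (\<integral>t. indicator E t *\<^sub>R f t \<partial>circle_angles)"
proof -
  have "(\<integral>t. indicator E t *\<^sub>R f t \<partial>circle_angles) = (\<integral>t. indicator {0..2*pi} t *\<^sub>R indicator E t *\<^sub>R f t \<partial>lebesgue)"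
    by (rule integral_restrict_space) auto
  also have "\<dots> = (\<integral>t. indicator E t *\<^sub>R f t \<partial>lebesgue)"
    by (rule Bochner_Integration.integral_cong[OF refl]) (use assms(2) in \<open>auto simp: indicator_def\<close>)
  also have "\<dots> = integral\<^sup>L (lebesgue_on E) f"
    by (rule integral_restrict_space[symmetric]) (use assms(1) in auto)
  finally show ?thesis ..
qed

lemma fsigma_borel: "fsigma S \<Longrightarrow> S \<in> sets borel"
  by (induction rule: fsigma.induct) (auto intro!: borel_closed)

lemma self_map_circle_bound:
  assumes "v ` unit_disk \<subseteq> unit_disk" "r \<in> {0..<1}"
  shows "norm (v (of_real r * cis t)) < 1"
proof -
  have "v (of_real r * cis t) \<in> unit_disk"
    by (rule subsetD[OF assms(1)], rule imageI) (use assms(2) in \<open>auto simp: norm_mult\<close>)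
  then show ?thesis by simp
qed

lemma circle_measurable:
  fixes f :: "complex \<Rightarrow> 'b::{second_countable_topology, t2_space}"
  assumes "continuous_on unit_disk f" "r \<in> {0..<1}" 
  shows "(\<lambda>t. f (of_real r * cis t)) \<in> borel_measurable (lebesgue_on E)"
proof -
  have "continuous_on UNIV (\<lambda>t. f (of_real r * cis t))"
    by (rule continuous_on_compose2[OF assms(1)]) (use assms(2) in \<open>auto intro!: continuous_intros simp: norm_mult\<close>)
  then have "(\<lambda>t. f (of_real r * cis t)) \<in> borel_measurable lborel"
    by (simp add: borel_measurable_continuous_onI)
  then have "(\<lambda>t. f (of_real r * cis t)) \<in> borel_measurable lebesgue"
    by (rule measurable_completion)
  then show ?thesis by (rule measurable_restrict_space1)
qed

lemma radial_limit_sequence: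
  assumes "((\<lambda>r. f (of_real r * cis t)) \<longlongrightarrow> l) (at_left (1::real))" "filterlim R (at_left 1) sequentially"
  shows "(\<lambda>j. f (of_real (R j) * cis t)) \<longlonglongrightarrow> l"
  using filterlim_compose[OF assms] .

lemma ex_radii: "\<exists>R::nat \<Rightarrow> real. (\<forall>j. R j \<in> {0..<1}) \<and> filterlim R (at_left 1) sequentially"
proof (intro exI conjI allI)
  show "1 - 1 / (real j + 1) \<in> {0..<1}" for j by (auto simp: field_simps)
  show "filterlim (\<lambda>j. 1 - 1 / (real j + 1)) (at_left 1) sequentially"
    unfolding filterlim_at
  proof
    show "\<forall>\<^sub>F j in sequentially. 1 - 1 / (real j + 1) \<in> {..<1} \<and> 1 - 1 / (real j + 1) \<noteq> (1::real)" by simp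
    show "(\<lambda>j. 1 - 1 / (real j + 1)) \<longlonglongrightarrow> (1::real)"
      using tendsto_diff[OF tendsto_const LIMSEQ_inverse_real_of_nat, of 1] by (simp add: inverse_eq_divide add.commute)
  qed
qed

lemma radial_limit_measurable:
  fixes v :: "complex \<Rightarrow> complex"
  assumes v: "continuous_on unit_disk v"
    and V: "\<And>t. t \<in> E \<Longrightarrow> ((\<lambda>r. v (of_real r * cis t)) \<longlongrightarrow> V t) (at_left (1::real))"
  shows "V \<in> borel_measurable (lebesgue_on E)"
proof -
  obtain R :: "nat \<Rightarrow> real" where R: "\<And>j. R j \<in> {0..<1}" "filterlim R (at_left 1) sequentially"
    using ex_radii by blast
  show ?thesis
  proof (rule borel_measurable_LIMSEQ_metric)
    show "(\<lambda>t. v (of_real (R j) * cis t)) \<in> borel_measurable (lebesgue_on E)" for j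
      by (rule circle_measurable[OF v R(1)])
    show "(\<lambda>j. v (of_real (R j) * cis t)) \<longlonglongrightarrow> V t" if "t \<in> space (lebesgue_on E)" for t
      using that by (intro radial_limit_sequence[OF V R(2)]) simp
  qed
qed

text \<open>A bound that is uniform in the radius survives the passage to the radial limit by
  bounded convergence. As \<open>indicator_integral_small\<close> speaks of Borel sets, the Lebesgue
  set \<open>E\<close> is first replaced by an F-sigma subset \<open>S\<close> of full
  measure.\<close>

lemma boundary_power_mean_small:
  fixes v :: "complex \<Rightarrow> complex"
  assumes v: "v holomorphic_on unit_disk" "v ` unit_disk \<subseteq> unit_disk"
    and E: "E \<in> sets lebesgue" "E \<subseteq> {0..2*pi}"
    and V: "\<And>t. t \<in> E \<Longrightarrow> ((\<lambda>r. v (of_real r * cis t)) \<longlongrightarrow> V t) (at_left (1::real))" and e: "e > 0"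
  shows "\<exists>N. \<forall>n\<ge>N. norm (\<integral>t. V t ^ n \<partial>lebesgue_on E) \<le> e"
proof -
  obtain S T where ST: "fsigma S" "T \<in> null_sets lebesgue" "S \<union> T = E" "disjnt S T"
    using lebesgue_set_almost_fsigma[OF E(1)] .
  have S: "S \<in> sets borel" by (rule fsigma_borel[OF ST(1)])
  have Em: "E \<in> lmeasurable"
    using E by (meson bounded_set_imp_lmeasurable bounded_closed_interval bounded_subset)
  have cv: "continuous_on unit_disk (\<lambda>z. v z ^ n)" for n
    by (intro continuous_on_power holomorphic_on_imp_continuous_on v)
  have eq: "(\<integral>t. v (of_real r * cis t) ^ n \<partial>lebesgue_on E)
    = (\<integral>t. indicator S t *\<^sub>R v (of_real r * cis t) ^ n \<partial>circle_angles)" if r: "r \<in> {0..<1}" for r n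
  proof -
    have "(\<integral>t. indicator E t *\<^sub>R v (of_real r * cis t) ^ n \<partial>circle_angles)
       = (\<integral>t. indicator S t *\<^sub>R v (of_real r * cis t) ^ n \<partial>circle_angles)"
    proof (rule integral_cong_AE)
      have "indicat_real E \<in> borel_measurable circle_angles" "indicat_real S \<in> borel_measurable circle_angles"
        by (rule measurable_restrict_space1, rule borel_measurable_indicator, use E S in auto)+
      note this[THEN borel_measurable_scaleR[OF _ circle_measurable[OF cv r]]]
      then show "(\<lambda>t. indicator E t *\<^sub>R v (of_real r * cis t) ^ n) \<in> borel_measurable circle_angles"
        "(\<lambda>t. indicator S t *\<^sub>R v (of_real r * cis t) ^ n) \<in> borel_measurable circle_angles" .
      have "AE t in lebesgue. t \<notin> T" by (rule AE_not_in[OF ST(2)])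
      then have "AE t in circle_angles. t \<notin> T" by (subst AE_restrict_space_iff) auto
      then show "AE t in circle_angles. indicator E t *\<^sub>R v (of_real r * cis t) ^ n = indicator S t *\<^sub>R v (of_real r * cis t) ^ n"
        by eventually_elim (use ST(3) in \<open>auto simp: indicator_def\<close>)
    qed
    then show ?thesis by (simp only: restrict_integral_eq[OF E])
  qed
  from indicator_integral_small[OF v S e] obtain N where
    N: "\<And>n r. n \<ge> N \<Longrightarrow> r \<in> {0..<1} \<Longrightarrow> norm (\<integral>t. indicator S t *\<^sub>R v (of_real r * cis t) ^ n \<partial>circle_angles) \<le> e"
    by blast
  obtain R :: "nat \<Rightarrow> real" where R: "\<And>j. R j \<in> {0..<1}" "filterlim R (at_left 1) sequentially"
    using ex_radii by blast
  have "norm (\<integral>t. V t ^ n \<partial>lebesgue_on E) \<le> e" if n: "n \<ge> N" for n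
  proof (rule LIMSEQ_le_const2)
    show "(\<lambda>j. norm (\<integral>t. v (of_real (R j) * cis t) ^ n \<partial>lebesgue_on E)) \<longlonglongrightarrow> norm (\<integral>t. V t ^ n \<partial>lebesgue_on E)"
    proof (rule tendsto_norm, rule bounded_convergence[OF finite_measure_lebesgue_on[OF Em], where B = 1])
      show "(\<lambda>t. v (of_real (R j) * cis t) ^ n) \<in> borel_measurable (lebesgue_on E)" for j
        by (rule circle_measurable[OF cv R(1)])
      show "norm (v (of_real (R j) * cis t) ^ n) \<le> 1" for j t
        using self_map_circle_bound[OF v(2) R(1), of j t] by (simp add: norm_power power_le_one)
      show "(\<lambda>j. v (of_real (R j) * cis t) ^ n) \<longlonglongrightarrow> V t ^ n" if "t \<in> space (lebesgue_on E)" for t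
        using that by (intro tendsto_power radial_limit_sequence[OF V R(2)]) simp
    qed
    show "\<exists>N. \<forall>j\<ge>N. norm (\<integral>t. v (of_real (R j) * cis t) ^ n \<partial>lebesgue_on E) \<le> e"
      unfolding eq[OF R(1)] using N[OF n R(1)] by blast
  qed
  then show ?thesis by blast
qed

lemma circle_power_integral:
  assumes "m \<ge> 1"
  shows "(\<integral>t. cis t ^ m \<partial>circle_angles) = 0"
proof -
  have "((\<lambda>t. (of_real 1 * cis t) ^ m) has_integral (2 * pi * (0::complex) ^ m)) {0..2*pi}"
    by (rule circle_mean_value[of "\<lambda>z. z ^ m" 2 1]) (auto intro!: holomorphic_intros)
  then have "integral {0..2*pi} (\<lambda>t. cis t ^ m) = 0"
    using assms by (simp add: integral_unique)
  then show ?thesis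
    by (subst circle_integral_eq) (auto intro!: continuous_intros)
qed

text \<open>A greedy recursion. \<open>n K\<close> exceeds the prescribed growth \<open>X K\<close>,
  \<open>2 * N\<close> times its predecessor, and twice the threshold \<open>L K\<close>, so that
  \<open>n K \<le> 2 * m\<close> forces \<open>m \<ge> L K\<close>. The same sequence serves the
  full circle: positive powers of \<open>cis\<close> have integral 0, and \<open>n K \<ge> 1\<close>
  excludes \<open>m = 0\<close>.\<close>

lemma ex_sparse:
  fixes X :: "nat \<Rightarrow> nat"
  assumes c: "\<And>e. e > 0 \<Longrightarrow> \<exists>N. \<forall>n\<ge>N. norm (\<integral>x. V x ^ n \<partial>M) \<le> e" and \<kappa>: "\<kappa> > 0" and N: "N \<ge> 1"
  shows "\<exists>n. strict_mono n \<and> (\<forall>K. X K \<le> n K) \<and> sparse M V N \<kappa> n \<and> sparse circle_angles cis N \<kappa> n"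
proof -
  have "\<exists>L. \<forall>m\<ge>L. norm (\<integral>x. V x ^ m \<partial>M) \<le> \<kappa> / (2 ^ K * (real K + 1) ^ (2*N))" for K
    using \<kappa> by (intro c) simp
  then obtain L where L: "\<And>K m. m \<ge> L K \<Longrightarrow> norm (\<integral>x. V x ^ m \<partial>M) \<le> \<kappa> / (2 ^ K * (real K + 1) ^ (2*N))"
    by metis
  define n where "n = rec_nat (X 0 + 2 * L 0 + 1) (\<lambda>K y. X (Suc K) + 2 * L (Suc K) + 2 * N * y + 1)"
  have n0: "n 0 = X 0 + 2 * L 0 + 1" and nS: "n (Suc K) = X (Suc K) + 2 * L (Suc K) + 2 * N * n K + 1" for K
    by (simp_all add: n_def)
  have nX: "X K \<le> n K" "2 * L K \<le> n K" "1 \<le> n K" for K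
    by (cases K; simp add: n0 nS)+
  have step: "2 * N * n K \<le> n (Suc K)" for K by (simp add: nS)
  have "n K < n (Suc K)" for K
  proof -
    have "1 * n K \<le> 2 * N * n K" using N by (intro mult_right_mono) auto
    then show ?thesis unfolding nS by linarith
  qed
  then have mono: "strict_mono n" by (rule strict_mono_Suc_iff[THEN iffD2, rule_format])
  have lac: "2 * N * n j \<le> n K" if "j < K" for j K
  proof -
    obtain K' where K: "K = Suc K'" "j \<le> K'" using \<open>j < K\<close> by (metis less_Suc_eq_le not0_implies_Suc not_less0)
    have "n j \<le> n K'" using K mono by (simp add: strict_mono_less_eq)
    then have "2 * N * n j \<le> 2 * N * n K'" by (rule mult_le_mono2)
    also have "\<dots> \<le> n K" unfolding K(1) by (rule step)
    finally show ?thesis .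
  qed
  have "sparse M V N \<kappa> n" unfolding sparse_def
  proof (intro conjI allI impI)
    show "norm (\<integral>x. V x ^ m \<partial>M) \<le> \<kappa> / (2 ^ K * (real K + 1) ^ (2*N))" if "n K \<le> 2 * m" for K m
      using that nX(2)[of K] by (intro L) simp
  qed (rule lac)
  moreover have "sparse circle_angles cis N \<kappa> n" unfolding sparse_def
  proof (intro conjI allI impI)
    show "norm (\<integral>x. cis x ^ m \<partial>circle_angles) \<le> \<kappa> / (2 ^ K * (real K + 1) ^ (2*N))" if "n K \<le> 2 * m" for K m
    proof -
      have "m \<ge> 1" using that nX(3)[of K] by simp
      then show ?thesis using \<kappa> circle_power_integral by simp
    qed
  qed (rule lac)
  ultimately show ?thesis using mono nX by blast
qed

section \<open>Jensen's inequality and small values\<close>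

text \<open>The local factor \<open>zor_poly f z\<close> agrees with
  \<open>f w / (w - z) ^ n\<close> off \<open>z\<close>, so the two glue to one function on all of
  \<open>S\<close>. The order \<open>n\<close> may be 0.\<close>

lemma holomorphic_factor_zero:
  assumes f: "f holomorphic_on S" and S: "open S" "connected S" "z \<in> S" and nz: "\<exists>w\<in>S. f w \<noteq> 0"
  shows "\<exists>n G. G holomorphic_on S \<and> G z \<noteq> 0 \<and> (\<forall>w\<in>S. f w = (w - z) ^ n * G w)"
proof -
  define n where "n = nat (zorder f z)"
  define g where "g = zor_poly f z"
  obtain r where r: "r > 0" "cball z r \<subseteq> S" "g holomorphic_on cball z r"
    "\<And>w. w \<in> cball z r \<Longrightarrow> f w = g w * (w - z) ^ n \<and> g w \<noteq> 0"
    using zorder_exist_zero[OF f S nz] unfolding n_def g_def by blast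
  define G where "G = (\<lambda>w. if w \<in> ball z r then g w else f w / (w - z) ^ n)"
  have 1: "G holomorphic_on ball z r"
    by (rule holomorphic_transform[OF holomorphic_on_subset[OF r(3)]]) (auto simp: G_def)
  have G2: "G w = f w / (w - z) ^ n" if "w \<noteq> z" for w
    using r(4)[of w] that by (auto simp: G_def)
  have "(\<lambda>w. f w / (w - z) ^ n) holomorphic_on (S - {z})"
    by (intro holomorphic_intros holomorphic_on_subset[OF f]) auto
  then have 2: "G holomorphic_on (S - {z})"
    by (rule holomorphic_transform) (simp add: G2)
  have "S = ball z r \<union> (S - {z})" using r(1,2) S(3) by auto
  moreover have "G holomorphic_on (ball z r \<union> (S - {z}))"
    by (rule holomorphic_on_Un[OF 1 2]) (use S in auto)
  ultimately have "G holomorphic_on S" by simp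
  moreover have "G z \<noteq> 0" using r(4)[of z] r(1) by (simp add: G_def)
  moreover have "f w = (w - z) ^ n * G w" if "w \<in> S" for w
  proof (cases "w = z")
    case True
    then show ?thesis using r(4)[of z] r(1) by (simp add: G_def mult.commute)
  qed (simp add: G2)
  ultimately show ?thesis by blast
qed

text \<open>A zero \<open>a\<close> is traded for one outside the disk: \<open>(z - a)\<close> and \<open>(r\<^sup>2 - cnj a * z) / r\<close>
  have the same modulus on \<open>\<bar>z\<bar> = r\<close>, and the second is the larger one at the origin.\<close>
lemma reflect_zeros:
  fixes h :: "complex \<Rightarrow> complex"
  assumes "finite Z" and r: "0 < r" "r < R"
  shows "h holomorphic_on ball 0 R \<Longrightarrow> (\<And>z. norm z = r \<Longrightarrow> h z \<noteq> 0) \<Longrightarrow> h 0 \<noteq> 0 \<Longrightarrow>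
    {z \<in> cball 0 r. h z = 0} = Z \<Longrightarrow>
    \<exists>k. k holomorphic_on ball 0 R \<and> (\<forall>z\<in>cball 0 r. k z \<noteq> 0) \<and>
       (\<forall>z. norm z = r \<longrightarrow> norm (k z) = norm (h z)) \<and> norm (h 0) \<le> norm (k 0)"
  using assms(1)
proof (induction Z arbitrary: h rule: finite_induct)
  case empty
  then show ?case by (intro exI[of _ h]) auto
next
  case (insert a Z)
  have a: "norm a < r" "h a = 0" "a \<noteq> 0"
  proof -
    have "a \<in> {z \<in> cball 0 r. h z = 0}" using insert.prems(4) by simp
    then show "norm a < r" "h a = 0" "a \<noteq> 0"
      using insert.prems(2,3) by (auto simp: order_le_less)
  qed
  have aR: "a \<in> ball 0 R" using a r by simp
  obtain n G where G: "G holomorphic_on ball 0 R" "G a \<noteq> 0" "\<And>w. w \<in> ball 0 R \<Longrightarrow> h w = (w - a) ^ n * G w"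
    using holomorphic_factor_zero[OF insert.prems(1) open_ball connected_ball aR] insert.prems(3) r
    by (metis centre_in_ball order_less_trans)
  have hR: "h w = (w - a) ^ n * G w" if "norm w \<le> r" for w using G(3)[of w] that r by simp
  define b where "b = (\<lambda>z. (of_real (r\<^sup>2) - cnj a * z) / of_real r)"
  define h1 where "h1 = (\<lambda>z. b z ^ n * G z)"
  have b0: "b z \<noteq> 0" if "norm z \<le> r" for z
  proof
    assume "b z = 0"
    then have "of_real (r\<^sup>2) = cnj a * z" using r by (simp add: b_def)
    then have "norm (of_real (r\<^sup>2) :: complex) = norm (cnj a * z)" by (simp only:)
    then have "r\<^sup>2 = norm a * norm z" unfolding norm_of_real norm_mult by simp
    also have "\<dots> \<le> norm a * r" using that by (intro mult_left_mono) auto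
    also have "\<dots> < r * r" using a r by (intro mult_strict_right_mono) auto
    finally show False by (simp add: power2_eq_square)
  qed
  have bn: "norm (b z) = norm (z - a)" if z: "norm z = r" for z
  proof -
    have "of_real (r\<^sup>2) = z * cnj z" using z complex_norm_square[of z] by (simp del: of_real_power)
    then have "of_real (r\<^sup>2) - cnj a * z = z * cnj (z - a)" by (simp add: algebra_simps)
    then have "norm (of_real (r\<^sup>2) - cnj a * z) = norm z * norm (z - a)"
      by (metis complex_mod_cnj norm_mult)
    then show ?thesis using r z by (simp add: b_def norm_divide del: of_real_power)
  qed
  have bb: "norm (b 0) = r" using r by (simp add: b_def norm_divide norm_power power2_eq_square)
  have "\<exists>k. k holomorphic_on ball 0 R \<and> (\<forall>z\<in>cball 0 r. k z \<noteq> 0) \<and>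
       (\<forall>z. norm z = r \<longrightarrow> norm (k z) = norm (h1 z)) \<and> norm (h1 0) \<le> norm (k 0)"
  proof (rule insert.IH)
    show "h1 holomorphic_on ball 0 R"
      unfolding h1_def b_def using r by (intro holomorphic_intros G(1)) auto
    show "h1 z \<noteq> 0" if "norm z = r" for z
      using insert.prems(2)[OF that] hR[of z] b0[of z] that by (auto simp: h1_def)
    show "h1 0 \<noteq> 0" using insert.prems(3) hR[of 0] b0[of 0] r by (auto simp: h1_def)
    \<comment> \<open>The full multiplicity of \<open>a\<close> has been divided out and
      \<open>b\<close> has no zero in the closed disk, so exactly one point leaves the zero
      set.\<close>
    show "{z \<in> cball 0 r. h1 z = 0} = Z"
    proof -
      have "{z \<in> cball 0 r. h1 z = 0} = {z \<in> cball 0 r. G z = 0}"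
        using b0 by (auto simp: h1_def)
      also have "\<dots> = {z \<in> cball 0 r. h z = 0} - {a}"
        using hR G(2) a by (auto simp: dist_norm)
      also have "\<dots> = Z" using insert.prems(4) insert.hyps(2) by auto
      finally show ?thesis .
    qed
  qed
  then obtain k where k: "k holomorphic_on ball 0 R" "\<forall>z\<in>cball 0 r. k z \<noteq> 0"
       "\<forall>z. norm z = r \<longrightarrow> norm (k z) = norm (h1 z)" "norm (h1 0) \<le> norm (k 0)" by blast
  have "norm (h1 z) = norm (h z)" if "norm z = r" for z
    using bn[OF that] hR[of z] that by (simp add: h1_def norm_mult norm_power)
  moreover have "norm (h 0) \<le> norm (h1 0)"
  proof -
    have "norm (h 0) = norm a ^ n * norm (G 0)" using hR[of 0] r by (simp add: norm_mult norm_power)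
    also have "\<dots> \<le> r ^ n * norm (G 0)" using a by (intro mult_right_mono power_mono) auto
    finally show ?thesis using bb by (simp add: h1_def norm_mult norm_power)
  qed
  ultimately show ?case using k by (intro exI[of _ k]) auto
qed

text \<open>After all zeros are reflected, \<open>ln (norm (k z))\<close> is the real part of a
  holomorphic logarithm and has the mean value property. Since \<open>k\<close> has the modulus of
  \<open>h\<close> on the circle and at least the modulus of \<open>h\<close> at the origin,
  Jensen's inequality follows.\<close>

lemma ln_norm_mean_ge:
  fixes h :: "complex \<Rightarrow> complex"
  assumes h: "h holomorphic_on ball 0 R" and r: "0 < r" "r < R"
    and nz: "\<And>z. norm z = r \<Longrightarrow> h z \<noteq> 0" and h0: "h 0 \<noteq> 0"
  shows "2 * pi * ln (norm (h 0)) \<le> integral {0..2*pi} (\<lambda>t. ln (norm (h (of_real r * cis t))))"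
proof -
  have "\<not> h constant_on ball 0 R \<or> {z \<in> cball 0 r. h z = 0} = {}"
    using h0 r unfolding constant_on_def by auto
  then have "finite {z \<in> cball 0 r. h z = 0}"
  proof (rule disjE)
    assume "\<not> h constant_on ball 0 R"
    then show ?thesis
      by (intro holomorphic_compact_finite_zeros[OF h open_ball connected_ball compact_cball]) (use r in auto)
  next
    assume "{z \<in> cball 0 r. h z = 0} = {}"
    then show ?thesis by (simp only: finite.emptyI)
  qed
  from reflect_zeros[OF this r h nz h0 refl] obtain k where
    k: "k holomorphic_on ball 0 R" "\<forall>z\<in>cball 0 r. k z \<noteq> 0"
       "\<forall>z. norm z = r \<longrightarrow> norm (k z) = norm (h z)" "norm (h 0) \<le> norm (k 0)" by blast
  \<comment> \<open>The logarithm and the mean value property need an open ball around the closed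
    disk on which \<open>k\<close> has no zero; compactness supplies the margin
    \<open>\<epsilon>\<close>.\<close>
  have "open {z \<in> ball 0 R. k z \<noteq> 0}"
    using continuous_open_preimage[OF holomorphic_on_imp_continuous_on[OF k(1)] open_ball, of "- {0}"]
    by (simp add: vimage_def Int_def open_Compl)
  moreover have "cball 0 r \<subseteq> {z \<in> ball 0 R. k z \<noteq> 0}" using k(2) r by auto
  ultimately obtain \<epsilon> where \<epsilon>: "\<epsilon> > 0" "{x. infdist x (cball 0 r) \<le> \<epsilon>} \<subseteq> {z \<in> ball 0 R. k z \<noteq> 0}"
  proof -
    have "cball (0::complex) r \<noteq> {}" using r by simp
    from compact_in_open_separated[OF this compact_cball \<open>open _\<close> \<open>cball 0 r \<subseteq> _\<close>] show ?thesis
      using that by blast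
  qed
  have knz: "z \<in> ball 0 R \<and> k z \<noteq> 0" if z: "z \<in> ball 0 (r + \<epsilon>)" for z
  proof -
    have "infdist z (cball 0 r) \<le> \<epsilon>"
    proof (cases "norm z \<le> r")
      case True then show ?thesis using \<epsilon> by simp
    next
      case False
      \<comment> \<open>The radial projection of \<open>z\<close> to the circle of radius
        \<open>r\<close> bounds the distance of \<open>z\<close> from the closed disk.\<close>
      define y where "y = (of_real (r / norm z)) * z"
      have "y \<in> cball 0 r" using r False by (auto simp: y_def norm_mult norm_divide)
      have "z - y = of_real (1 - r / norm z) * z" by (simp add: y_def algebra_simps)
      then have "dist z y = \<bar>1 - r / norm z\<bar> * norm z" by (simp add: dist_norm norm_mult del: of_real_diff)
      also have "\<dots> = norm z - r"
      proof -
        have "z \<noteq> 0" using False r by auto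
        then show ?thesis using False r by (simp add: field_simps abs_if)
      qed
      finally have "dist z y \<le> \<epsilon>" using z by simp
      then show ?thesis using infdist_le[OF \<open>y \<in> cball 0 r\<close>, of z] by simp
    qed
    then show ?thesis using \<epsilon>(2) by auto
  qed
  have hk: "k holomorphic_on ball 0 (r + \<epsilon>)" by (rule holomorphic_on_subset[OF k(1)]) (use knz in auto)
  obtain g where g: "g holomorphic_on ball 0 (r + \<epsilon>)" "\<And>z. z \<in> ball 0 (r + \<epsilon>) \<Longrightarrow> k z = exp (g z)"
    by (rule contractible_imp_holomorphic_log[OF hk convex_imp_contractible[OF convex_ball]]) (use knz in auto)
  have lng: "ln (norm (k z)) = Re (g z)" if "z \<in> ball 0 (r + \<epsilon>)" for z
    using g(2)[OF that] by simp
  have "((\<lambda>t. g (of_real r * cis t)) has_integral (2 * pi * g 0)) {0..2*pi}"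
    by (rule circle_mean_value[OF g(1)]) (use r \<epsilon> in auto)
  then have "((\<lambda>t. Re (g (of_real r * cis t))) has_integral Re (2 * pi * g 0)) {0..2*pi}"
    by (rule has_integral_Re)
  moreover have "Re (g (of_real r * cis t)) = ln (norm (h (of_real r * cis t)))" for t
    using lng[of "of_real r * cis t"] k(3) r \<epsilon> by (simp add: norm_mult)
  ultimately have "integral {0..2*pi} (\<lambda>t. ln (norm (h (of_real r * cis t)))) = 2 * pi * Re (g 0)"
    by (simp add: integral_unique)
  also have "Re (g 0) = ln (norm (k 0))" using lng[of 0] r \<epsilon> by simp
  finally have "integral {0..2*pi} (\<lambda>t. ln (norm (h (of_real r * cis t)))) = 2 * pi * ln (norm (k 0))" .
  moreover have "ln (norm (h 0)) \<le> ln (norm (k 0))" using k(4) h0 by (intro ln_mono) auto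
  ultimately show ?thesis by simp
qed

lemma ln_le_powr: fixes x :: real shows "1 \<le> p \<Longrightarrow> 0 < x \<Longrightarrow> ln x \<le> x powr p"
proof -
  assume p: "1 \<le> p" and x: "0 < x"
  show ?thesis
  proof (cases "x \<le> 1")
    case True
    then have "ln x \<le> 0" using x by simp
    then show ?thesis by (meson order_trans powr_ge_zero)
  next
    case False
    have "ln x \<le> x" using ln_le_minus_one[OF x] by simp
    also have "x = x powr 1" using x by simp
    also have "\<dots> \<le> x powr p" using False p by (intro powr_mono) auto
    finally show ?thesis .
  qed
qed

text \<open>For the countability of the zeros of a nonconstant holomorphic function in the
  disk.\<close>

lemma fsigma_unit_disk: "fsigma unit_disk"
proof -
  have "\<exists>n. norm z \<le> 1 - 1 / (real n + 1)" if z: "norm z < 1" for z :: complex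
  proof -
    obtain n where "inverse (real (Suc n)) < 1 - norm z" using reals_Archimedean[of "1 - norm z"] z
      unfolding diff_gt_0_iff_gt by blast
    then show ?thesis by (intro exI[of _ n]) (simp add: inverse_eq_divide add.commute)
  qed
  moreover have "norm z < 1" if "norm z \<le> 1 - 1 / (real n + 1)" for z :: complex and n
    by (rule le_less_trans[OF that]) simp
  ultimately have "unit_disk = (\<Union>n. cball 0 (1 - 1 / (real n + 1)))" by (auto simp: set_eq_iff)
  then show ?thesis by (metis fsigma.intros closed_cball)
qed

text \<open>Jensen bounds the mean of \<open>ln (norm h)\<close> from below uniformly for radii in
  \<open>{1/2..<1}\<close>, while the p-th mean bounds its positive part from above. A set where
  \<open>norm h < exp (- A)\<close> pulls the mean down by \<open>A\<close> times its measure, which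
  must therefore be of order \<open>1 / A\<close>.\<close>

lemma small_values_small_measure:
  fixes h :: "complex \<Rightarrow> complex"
  assumes h: "h holomorphic_on unit_disk" and nz: "\<exists>z\<in>unit_disk. h z \<noteq> 0" and p: "1 \<le> p"
    and b: "\<And>r. r \<in> {0..<1} \<Longrightarrow> integral {0..2*pi} (\<lambda>t. norm (h (of_real r * cis t)) powr p) \<le> B"
    and \<eta>: "\<eta> > 0"
  shows "\<exists>\<delta>>0. \<exists>R::nat \<Rightarrow> real. (\<forall>j. R j \<in> {0..<1}) \<and> filterlim R (at_left 1) sequentially \<and>
     (\<forall>j. measure circle_angles {t \<in> {0..2*pi}. norm (h (of_real (R j) * cis t)) < \<delta>} \<le> \<eta>)"
proof -
  have "(0::complex) \<in> unit_disk" by simp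
  from holomorphic_factor_zero[OF h open_ball connected_ball this nz]
  obtain m G where G: "G holomorphic_on unit_disk" "G 0 \<noteq> 0" "\<And>w. w \<in> unit_disk \<Longrightarrow> h w = (w - 0) ^ m * G w"
    by blast
  have B0: "B \<ge> 0"
  proof -
    have "0 \<le> 2 * pi * norm (h 0) powr p" by simp
    also have "\<dots> \<le> B" using b[of 0] by simp
    finally show ?thesis .
  qed
  \<comment> \<open>\<open>W\<close> bounds \<open>B\<close> minus Jensen's lower bound on all
    circles of radius at least 1/2. Jensen is applied to \<open>G\<close>, which does not vanish at
    the origin; the zero of order \<open>m\<close> there costs \<open>m * ln r\<close>, which is at
    least \<open>- m * ln 2\<close>. The summand 1 in \<open>A\<close> keeps \<open>A\<close>
    positive when \<open>W = 0\<close>.\<close>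
  define W where "W = B + 2 * pi * real m * ln 2 + 2 * pi * \<bar>ln (norm (G 0))\<bar>"
  have W: "W \<ge> 0" unfolding W_def using B0 by (intro add_nonneg_nonneg mult_nonneg_nonneg) auto
  define A where "A = W / \<eta> + 1"
  have A: "A > 0" "W / A \<le> \<eta>"
  proof -
    show "A > 0" using W \<eta> by (simp add: A_def add_nonneg_pos)
    have "W \<le> A * \<eta>" using \<eta> by (simp add: A_def algebra_simps)
    then show "W / A \<le> \<eta>" using \<open>A > 0\<close> by (simp add: divide_le_eq mult.commute)
  qed
  have key: "measure circle_angles {t \<in> {0..2*pi}. norm (h (of_real r * cis t)) < exp (- A)} \<le> \<eta>"
    if r: "1/2 \<le> r" "r < 1" and hr: "\<And>z. norm z = r \<Longrightarrow> h z \<noteq> 0" for r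
  proof -
    let ?C = circle_angles
    define X where "X = {t \<in> {0..2*pi}. norm (h (of_real r * cis t)) < exp (- A)}"
    have r01: "r \<in> {0..<1}" using r by simp
    have cont: "continuous_on S (\<lambda>t. h (of_real r * cis t))" for S
      by (rule continuous_on_circle[OF holomorphic_on_imp_continuous_on[OF h] r01])
    have hnz: "h (of_real r * cis t) \<noteq> 0" for t using hr r by (simp add: norm_mult)
    have cln: "continuous_on {0..2*pi} (\<lambda>t. ln (norm (h (of_real r * cis t))))"
      by (intro continuous_on_ln continuous_on_norm cont) (use hnz in auto)
    have cp: "continuous_on {0..2*pi} (\<lambda>t. norm (h (of_real r * cis t)) powr p)"
      by (intro continuous_on_powr' continuous_on_norm cont continuous_on_const) (use hnz p in auto)
    have Xs: "X \<in> sets ?C"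
    proof -
      have "(\<lambda>t. norm (h (of_real r * cis t))) \<in> borel_measurable ?C"
        by (rule measurable_compose[OF circle_measurable[OF holomorphic_on_imp_continuous_on[OF h] r01] borel_measurable_norm])
      then have "{t \<in> space ?C. norm (h (of_real r * cis t)) < exp (- A)} \<in> sets ?C"
        by (intro borel_measurable_less borel_measurable_const) 
      then show ?thesis by (simp add: X_def)
    qed
    have intX: "integrable ?C (indicator X :: real \<Rightarrow> real)"
      using Xs by (rule integrable_real_indicator)
        (use finite_measure.emeasure_finite[OF finite_circle_angles] in \<open>simp add: less_top[symmetric]\<close>)
    have "2 * pi * (real m * ln r + ln (norm (G 0))) \<le> integral {0..2*pi} (\<lambda>t. ln (norm (h (of_real r * cis t))))"
    proof -
      have Gnz: "G z \<noteq> 0" if "norm z = r" for z using hr[OF that] G(3)[of z] that r by auto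
      have "2 * pi * ln (norm (G 0)) \<le> integral {0..2*pi} (\<lambda>t. ln (norm (G (of_real r * cis t))))"
        by (rule ln_norm_mean_ge[OF G(1) _ _ Gnz G(2)]) (use r in auto)
      moreover have "ln (norm (h (of_real r * cis t))) = real m * ln r + ln (norm (G (of_real r * cis t)))" for t
      proof -
        have "norm (h (of_real r * cis t)) = r ^ m * norm (G (of_real r * cis t))"
          using G(3)[of "of_real r * cis t"] r by (simp add: norm_mult norm_power)
        moreover have "norm (G (of_real r * cis t)) > 0" using Gnz r by (simp add: norm_mult)
        ultimately show ?thesis using r by (simp add: ln_mult ln_realpow)
      qed
      moreover have "continuous_on {0..2*pi} (\<lambda>t. ln (norm (G (of_real r * cis t))))"
        by (intro continuous_on_ln continuous_on_norm continuous_on_circle holomorphic_on_imp_continuous_on G r01)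
           (use Gnz r in \<open>auto simp: norm_mult\<close>)
      ultimately show ?thesis
        by (simp add: integral_add integrable_continuous_real distrib_left)
    qed
    also have "integral {0..2*pi} (\<lambda>t. ln (norm (h (of_real r * cis t)))) = (\<integral>t. ln (norm (h (of_real r * cis t))) \<partial>?C)"
      by (rule circle_integral_eq[OF cln, symmetric])
    \<comment> \<open>The p-th power dominates the logarithm everywhere and is kept as a nonnegative
      surplus on \<open>X\<close>, where the logarithm is below \<open>- A\<close>.\<close>
    also have "\<dots> \<le> (\<integral>t. (- A) * indicator X t + norm (h (of_real r * cis t)) powr p \<partial>?C)"
    proof (rule integral_mono)
      show "integrable ?C (\<lambda>t. ln (norm (h (of_real r * cis t))))"
        by (rule continuous_imp_integrable_real[OF cln])
      show "integrable ?C (\<lambda>t. (- A) * indicator X t + norm (h (of_real r * cis t)) powr p)"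
        by (intro Bochner_Integration.integrable_add integrable_mult_right intX continuous_imp_integrable_real[OF cp])
      fix t assume "t \<in> space ?C"
      then have t: "t \<in> {0..2*pi}" by simp
      have pos: "0 < norm (h (of_real r * cis t))" using hnz by simp
      show "ln (norm (h (of_real r * cis t))) \<le> (- A) * indicator X t + norm (h (of_real r * cis t)) powr p"
      proof (cases "t \<in> X")
        case True
        then have "ln (norm (h (of_real r * cis t))) < ln (exp (- A))"
          using pos unfolding X_def by (subst ln_less_cancel_iff) auto
        then have "ln (norm (h (of_real r * cis t))) < - A" by (simp only: ln_exp)
        moreover have "norm (h (of_real r * cis t)) powr p \<ge> 0" by simp
        ultimately have "ln (norm (h (of_real r * cis t))) \<le> - A + norm (h (of_real r * cis t)) powr p" by linarith
        then show ?thesis using True by simp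
      next
        case False
        then show ?thesis using ln_le_powr[OF p pos] by simp
      qed
    qed
    also have "\<dots> = (\<integral>t. (- A) * indicator X t \<partial>?C) + (\<integral>t. norm (h (of_real r * cis t)) powr p \<partial>?C)"
      by (intro Bochner_Integration.integral_add integrable_mult_right intX continuous_imp_integrable_real[OF cp])
    also have "(\<integral>t. (- A) * indicator X t \<partial>?C) = - A * measure ?C X"
    proof -
      have "X \<inter> {0..2*pi} = X" by (auto simp: X_def)
      then show ?thesis using Xs by simp
    qed
    also have "(\<integral>t. norm (h (of_real r * cis t)) powr p \<partial>?C) \<le> B"
      unfolding circle_integral_eq[OF cp] by (rule b[OF r01])
    finally have 1: "A * measure ?C X \<le> B - 2 * pi * (real m * ln r) - 2 * pi * ln (norm (G 0))"
      by (simp add: algebra_simps)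
    have "- ln r \<le> ln 2"
    proof -
      have "ln (1/2) \<le> ln r" using r by (subst ln_le_cancel_iff) auto
      then show ?thesis by (simp add: ln_div)
    qed
    then have "2 * pi * real m * (- ln r) \<le> 2 * pi * real m * ln 2" by (intro mult_left_mono) auto
    moreover have "2 * pi * (- ln (norm (G 0))) \<le> 2 * pi * \<bar>ln (norm (G 0))\<bar>" by (intro mult_left_mono) auto
    ultimately have "A * measure ?C X \<le> W" using 1 unfolding W_def by (simp add: mult.assoc)
    then have "measure ?C X \<le> W / A" using A(1) by (simp add: le_divide_eq mult.commute)
    then show ?thesis using A(2) by (simp add: X_def)
  qed
  \<comment> \<open>The moduli of the zeros of \<open>h\<close> are countable, so every interval of
    radii contains one whose circle carries no zero; on such a circle \<open>ln (norm h)\<close> is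
    continuous.\<close>
  have "\<exists>r. max (1/2) (1 - 1 / (real j + 1)) < r \<and> r < 1 \<and> (\<forall>z. norm z = r \<longrightarrow> h z \<noteq> 0)" for j
  proof -
    have Z: "countable (norm ` {z \<in> unit_disk. h z = 0})"
    proof (intro countable_image)
      show "countable {z \<in> unit_disk. h z = 0}"
      proof (cases "h constant_on unit_disk")
        case True
        then have "{z \<in> unit_disk. h z = 0} = {}" using nz unfolding constant_on_def by auto
        then show ?thesis by (simp only: countable_empty)
      next
        case False
        then show ?thesis
          by (intro holomorphic_countable_zeros[OF h open_ball connected_ball fsigma_unit_disk])
      qed
    qed
    have "uncountable {max (1/2) (1 - 1 / (real j + 1))<..<(1::real)}"
      unfolding uncountable_open_interval by auto
    then have "\<not> {max (1/2) (1 - 1 / (real j + 1))<..<(1::real)} \<subseteq> norm ` {z \<in> unit_disk. h z = 0}"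
      using countable_subset[OF _ Z] by blast
    then obtain r where r: "r \<in> {max (1/2) (1 - 1 / (real j + 1))<..<1}" "r \<notin> norm ` {z \<in> unit_disk. h z = 0}"
      by blast
    have "h z \<noteq> 0" if z: "norm z = r" for z
    proof
      assume "h z = 0"
      then have "z \<in> {z \<in> unit_disk. h z = 0}" using r(1) z by simp
      then have "norm z \<in> norm ` {z \<in> unit_disk. h z = 0}" by (rule imageI)
      then show False using r(2) z by simp
    qed
    then show ?thesis using r(1) by (intro exI[of _ r]) auto
  qed
  then obtain R where R: "\<And>j. max (1/2) (1 - 1 / (real j + 1)) < R j" "\<And>j. R j < 1"
    "\<And>j z. norm z = R j \<Longrightarrow> h z \<noteq> 0" by metis
  have lim: "filterlim R (at_left 1) sequentially" unfolding filterlim_at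
  proof
    show "\<forall>\<^sub>F j in sequentially. R j \<in> {..<1} \<and> R j \<noteq> 1" using R(2) by (auto simp: less_imp_neq)
    show "R \<longlonglongrightarrow> 1"
    proof (rule real_tendsto_sandwich)
      show "(\<lambda>j. 1 - 1 / (real j + 1)) \<longlonglongrightarrow> (1::real)"
        using tendsto_diff[OF tendsto_const LIMSEQ_inverse_real_of_nat, of 1] by (simp add: inverse_eq_divide add.commute)
      have "1 - 1 / (real j + 1) \<le> R j" for j using R(1)[of j] by simp
      then show "\<forall>\<^sub>F j in sequentially. 1 - 1 / (real j + 1) \<le> R j" by (intro always_eventually allI)
      show "\<forall>\<^sub>F j in sequentially. R j \<le> 1" by (intro always_eventually allI less_imp_le R(2))
    qed simp
  qed
  have R2: "1/2 \<le> R j" for j using R(1)[of j] by simp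
  show ?thesis
  proof (intro exI[of _ "exp (- A)"] exI[of _ R] conjI allI lim)
    show "R j \<in> {0..<1}" for j using R2[of j] R(2)[of j] by simp
    show "measure circle_angles {t \<in> {0..2*pi}. norm (h (of_real (R j) * cis t)) < exp (- A)} \<le> \<eta>" for j
      by (rule key[OF R2 R(2,3)])
  qed simp
qed

section \<open>Hardy and derivative Hardy spaces\<close>

lemma continuous_on_circle_powr:
  fixes f :: "complex \<Rightarrow> complex"
  assumes "continuous_on unit_disk f" "r \<in> {0..<1}" "p \<ge> 1"
  shows "continuous_on A (\<lambda>t. norm (f (of_real r * cis t)) powr p)"
  by (intro continuous_on_powr' continuous_on_norm continuous_on_circle assms continuous_on_const) (use assms in auto)

lemma int_mean_eq:
  assumes "continuous_on unit_disk f" "r \<in> {0..<1}" "p \<ge> 1"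
  shows "int_mean p f r = (\<integral>t. norm (f (of_real r * cis t)) powr p \<partial>circle_angles) / (2*pi)"
  unfolding int_mean_def by (subst circle_integral_eq) (rule continuous_on_circle_powr[OF assms], rule refl)

lemma integrable_circle_powr:
  fixes f :: "complex \<Rightarrow> complex"
  assumes "continuous_on unit_disk f" "r \<in> {0..<1}" "p \<ge> 1"
  shows "integrable circle_angles (\<lambda>t. norm (f (of_real r * cis t)) powr p)"
  by (rule continuous_imp_integrable_real[OF continuous_on_circle_powr[OF assms]])

lemma int_mean_nonneg:
  assumes "continuous_on unit_disk f" "r \<in> {0..<1}" "p \<ge> 1"
  shows "0 \<le> int_mean p f r"
  unfolding int_mean_eq[OF assms] by (intro divide_nonneg_pos integral_nonneg_AE) auto

lemma int_mean_mono:
  assumes "continuous_on unit_disk f" "continuous_on unit_disk g" "r \<in> {0..<1}" "p \<ge> 1"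
    and "\<And>z. z \<in> unit_disk \<Longrightarrow> norm (f z) \<le> norm (g z)"
  shows "int_mean p f r \<le> int_mean p g r"
  unfolding int_mean_eq[OF assms(1,3,4)] int_mean_eq[OF assms(2-4)]
  using assms by (intro divide_right_mono integral_mono integrable_circle_powr powr_mono2) (auto simp: norm_mult)

lemma int_mean_scale:
  assumes "continuous_on unit_disk f" "r \<in> {0..<1}" "p \<ge> 1"
  shows "int_mean p (\<lambda>z. c * f z) r = norm c powr p * int_mean p f r"
  unfolding int_mean_eq[OF assms] int_mean_eq[OF continuous_on_mult_left[OF assms(1)] assms(2,3)]
  by (simp add: norm_mult powr_mult)

lemma int_mean_cong:
  assumes "r \<in> {0..<1}" "\<And>z. z \<in> unit_disk \<Longrightarrow> f z = g z"
  shows "int_mean p f r = int_mean p g r"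
  unfolding int_mean_def
  by (intro arg_cong2[where f = "(/)"] integral_cong) (use assms in \<open>auto simp: norm_mult\<close>)

lemma powr_add_le:
  fixes x y :: real
  assumes "0 \<le> x" "0 \<le> y" "1 \<le> p"
  shows "(x + y) powr p \<le> 2 powr p * (x powr p + y powr p)"
proof -
  have "(x + y) powr p \<le> (2 * max x y) powr p" using assms by (intro powr_mono2) auto
  also have "\<dots> = 2 powr p * max x y powr p" using assms by (simp add: powr_mult)
  also have "max x y powr p \<le> x powr p + y powr p" by (auto simp: max_def)
  finally show ?thesis by simp
qed

lemma int_mean_add_le:
  assumes "continuous_on unit_disk f" "continuous_on unit_disk g" "r \<in> {0..<1}" "p \<ge> 1"
  shows "int_mean p (\<lambda>z. f z + g z) r \<le> 2 powr p * (int_mean p f r + int_mean p g r)"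
proof -
  have "(\<integral>t. norm (f (of_real r * cis t) + g (of_real r * cis t)) powr p \<partial>circle_angles)
    \<le> (\<integral>t. 2 powr p * (norm (f (of_real r * cis t)) powr p + norm (g (of_real r * cis t)) powr p) \<partial>circle_angles)"
  proof (rule integral_mono)
    show "integrable circle_angles (\<lambda>t. norm (f (of_real r * cis t) + g (of_real r * cis t)) powr p)"
      by (rule integrable_circle_powr[OF continuous_on_add[OF assms(1,2)] assms(3,4)])
    show "integrable circle_angles (\<lambda>t. 2 powr p * (norm (f (of_real r * cis t)) powr p + norm (g (of_real r * cis t)) powr p))"
      by (intro integrable_mult_right Bochner_Integration.integrable_add integrable_circle_powr assms)
    fix t
    have "norm (f (of_real r * cis t) + g (of_real r * cis t)) powr p
      \<le> (norm (f (of_real r * cis t)) + norm (g (of_real r * cis t))) powr p"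
      using assms by (intro powr_mono2 norm_triangle_ineq) auto
    also have "\<dots> \<le> 2 powr p * (norm (f (of_real r * cis t)) powr p + norm (g (of_real r * cis t)) powr p)"
      using assms by (intro powr_add_le) auto
    finally show "norm (f (of_real r * cis t) + g (of_real r * cis t)) powr p
      \<le> 2 powr p * (norm (f (of_real r * cis t)) powr p + norm (g (of_real r * cis t)) powr p)" .
  qed
  also have "\<dots> = 2 powr p * ((\<integral>t. norm (f (of_real r * cis t)) powr p \<partial>circle_angles)
     + (\<integral>t. norm (g (of_real r * cis t)) powr p \<partial>circle_angles))"
    using integrable_circle_powr[OF assms(1,3,4)] integrable_circle_powr[OF assms(2-4)]
    by (simp add: Bochner_Integration.integral_add)
  finally show ?thesis
    unfolding int_mean_eq[OF assms(1,3,4)] int_mean_eq[OF assms(2-4)]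
      int_mean_eq[OF continuous_on_add[OF assms(1,2)] assms(3,4)]
    by (simp add: field_simps)
qed

lemma hardy_holomorphic: "f \<in> hardy p \<Longrightarrow> f holomorphic_on unit_disk"
  by (simp add: hardy_def)

lemma hardy_continuous: "f \<in> hardy p \<Longrightarrow> continuous_on unit_disk f"
  by (simp add: hardy_def holomorphic_on_imp_continuous_on)

lemma int_mean_le_hardy_norm:
  assumes f: "f \<in> hardy p" and p: "p \<ge> 1" and r: "r \<in> {0..<1}"
  shows "int_mean p f r \<le> hardy_norm p f powr p"
proof -
  have b: "bdd_above (int_mean p f ` {0..<1})" using f by (simp add: hardy_def)
  \<comment> \<open>The supremum has to be known nonnegative before the exponent \<open>1/p\<close>
    in \<open>hardy_norm\<close> can be undone by \<open>powr p\<close>.\<close>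
  have "0 \<le> int_mean p f r" by (rule int_mean_nonneg[OF hardy_continuous[OF f] r p])
  also have "int_mean p f r \<le> (SUP r\<in>{0..<1}. int_mean p f r)" by (rule cSUP_upper[OF r b])
  finally have "(SUP r\<in>{0..<1}. int_mean p f r) \<ge> 0" .
  then have "hardy_norm p f powr p = (SUP r\<in>{0..<1}. int_mean p f r)"
    using p by (simp add: hardy_norm_def powr_powr)
  then show ?thesis using cSUP_upper[OF r b] by simp
qed

lemma hardy_norm_nonneg: "0 \<le> hardy_norm p f"
  by (simp add: hardy_norm_def)

lemma hardyI:
  assumes f: "f holomorphic_on unit_disk" and p: "p \<ge> 1" and K: "K \<ge> 0"
    and b: "\<And>r. r \<in> {0..<1} \<Longrightarrow> int_mean p f r \<le> K powr p"
  shows "f \<in> hardy p" "hardy_norm p f \<le> K"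
proof -
  have bd: "bdd_above (int_mean p f ` {0..<1})" by (rule bdd_aboveI2[OF b])
  then show "f \<in> hardy p" using f unfolding hardy_def by simp
  have "0 \<le> int_mean p f 0" by (rule int_mean_nonneg[OF holomorphic_on_imp_continuous_on[OF f] _ p]) simp
  also have "\<dots> \<le> (SUP r\<in>{0..<1}. int_mean p f r)"
    by (rule cSUP_upper) (use bd in auto)
  finally have 0: "0 \<le> (SUP r\<in>{0..<1}. int_mean p f r)" .
  have "(SUP r\<in>{0..<1}. int_mean p f r) \<le> K powr p" by (rule cSUP_least) (use b in auto)
  then have "(SUP r\<in>{0..<1}. int_mean p f r) powr (1/p) \<le> (K powr p) powr (1/p)"
    using p 0 by (intro powr_mono2) auto
  also have "\<dots> = K" using p K by (simp add: powr_powr)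
  finally show "hardy_norm p f \<le> K" by (simp add: hardy_norm_def)
qed

lemma hardy_cong:
  assumes "\<And>z. z \<in> unit_disk \<Longrightarrow> f z = g z"
  shows "f \<in> hardy p \<longleftrightarrow> g \<in> hardy p" "hardy_norm p f = hardy_norm p g"
proof -
  have "f holomorphic_on unit_disk \<longleftrightarrow> g holomorphic_on unit_disk"
    by (rule holomorphic_cong) (use assms in auto)
  moreover have "int_mean p f ` {0..<1} = int_mean p g ` {0..<1}"
    by (rule image_cong[OF refl int_mean_cong]) (use assms in auto)
  ultimately show "f \<in> hardy p \<longleftrightarrow> g \<in> hardy p" "hardy_norm p f = hardy_norm p g"
    unfolding hardy_def hardy_norm_def by simp_all
qed

text \<open>The constant 4 is what the crude bound \<open>(x + y)\<^sup>p \<le> 2\<^sup>p (x\<^sup>p + y\<^sup>p)\<close> gives; a quasi-norm is enough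
  below, so Minkowski's inequality is not needed.\<close>
lemma hardy_add:
  assumes f: "f \<in> hardy p" and g: "g \<in> hardy p" and p: "p \<ge> 1"
  shows "(\<lambda>z. f z + g z) \<in> hardy p"
    "hardy_norm p (\<lambda>z. f z + g z) \<le> 4 * (hardy_norm p f + hardy_norm p g)"
proof -
  let ?F = "hardy_norm p f" and ?G = "hardy_norm p g"
  note nn = hardy_norm_nonneg[of p f] hardy_norm_nonneg[of p g]
  have "int_mean p (\<lambda>z. f z + g z) r \<le> (4 * (?F + ?G)) powr p" if r: "r \<in> {0..<1}" for r
  proof -
    have "int_mean p (\<lambda>z. f z + g z) r \<le> 2 powr p * (int_mean p f r + int_mean p g r)"
      by (rule int_mean_add_le[OF hardy_continuous[OF f] hardy_continuous[OF g] r p])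
    also have "\<dots> \<le> 2 powr p * ((?F + ?G) powr p + (?F + ?G) powr p)"
    proof (intro mult_left_mono add_mono)
      show "int_mean p f r \<le> (?F + ?G) powr p"
        by (rule order_trans[OF int_mean_le_hardy_norm[OF f p r]]) (use nn p in \<open>auto intro!: powr_mono2\<close>)
      show "int_mean p g r \<le> (?F + ?G) powr p"
        by (rule order_trans[OF int_mean_le_hardy_norm[OF g p r]]) (use nn p in \<open>auto intro!: powr_mono2\<close>)
    qed simp
    also have "\<dots> = (2 powr p * 2 powr 1) * (?F + ?G) powr p" by simp
    also have "\<dots> \<le> (2 powr p * 2 powr p) * (?F + ?G) powr p"
      using p by (intro mult_right_mono mult_left_mono powr_mono) auto
    also have "\<dots> = (4 * (?F + ?G)) powr p"
      using nn by (simp add: powr_mult[symmetric])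
    finally show ?thesis .
  qed
  moreover have "(\<lambda>z. f z + g z) holomorphic_on unit_disk"
    by (intro holomorphic_intros hardy_holomorphic[OF f] hardy_holomorphic[OF g])
  ultimately show "(\<lambda>z. f z + g z) \<in> hardy p"
    "hardy_norm p (\<lambda>z. f z + g z) \<le> 4 * (hardy_norm p f + hardy_norm p g)"
    using hardyI[of "\<lambda>z. f z + g z" p "4 * (?F + ?G)"] p nn by auto
qed

lemma hardy_mult_bounded:
  assumes f: "f \<in> hardy p" and g: "g holomorphic_on unit_disk" and p: "p \<ge> 1"
    and b: "\<And>z. z \<in> unit_disk \<Longrightarrow> norm (g z) \<le> K" and K: "K \<ge> 0"
  shows "(\<lambda>z. f z * g z) \<in> hardy p" "hardy_norm p (\<lambda>z. f z * g z) \<le> K * hardy_norm p f"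
proof -
  have h: "(\<lambda>z. f z * g z) holomorphic_on unit_disk"
    by (intro holomorphic_intros hardy_holomorphic[OF f] g)
  have "int_mean p (\<lambda>z. f z * g z) r \<le> (K * hardy_norm p f) powr p" if r: "r \<in> {0..<1}" for r
  proof -
    have "int_mean p (\<lambda>z. f z * g z) r \<le> int_mean p (\<lambda>z. of_real K * f z) r"
    proof (rule int_mean_mono[OF _ _ r p])
      show "norm (f z * g z) \<le> norm (of_real K * f z)" if "z \<in> unit_disk" for z
        using mult_left_mono[OF b[OF that], of "norm (f z)"] K by (simp add: norm_mult mult.commute)
    qed (intro holomorphic_on_imp_continuous_on h holomorphic_intros hardy_holomorphic[OF f])+
    also have "\<dots> = K powr p * int_mean p f r"
      using int_mean_scale[OF hardy_continuous[OF f] r p, of "of_real K"] K by simp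
    also have "\<dots> \<le> K powr p * hardy_norm p f powr p"
      by (intro mult_left_mono int_mean_le_hardy_norm f p r) auto
    finally show ?thesis using K hardy_norm_nonneg[of p f] by (simp add: powr_mult)
  qed
  then show "(\<lambda>z. f z * g z) \<in> hardy p" "hardy_norm p (\<lambda>z. f z * g z) \<le> K * hardy_norm p f"
    using hardyI[OF h p, of "K * hardy_norm p f"] K hardy_norm_nonneg[of p f] by auto
qed

text \<open>One inequality is multiplication by a bounded function; the reverse one is the same
  inequality applied to \<open>c * f\<close> and \<open>inverse c\<close>.\<close>

lemma hardy_scale:
  assumes f: "f \<in> hardy p" and p: "p \<ge> 1"
  shows "(\<lambda>z. c * f z) \<in> hardy p" "hardy_norm p (\<lambda>z. c * f z) = norm c * hardy_norm p f"
proof -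
  have le: "(\<lambda>z. c * f z) \<in> hardy p \<and> hardy_norm p (\<lambda>z. c * f z) \<le> norm c * hardy_norm p f"
    if "f \<in> hardy p" for c f
    using hardy_mult_bounded[OF that holomorphic_on_const p, of c "norm c"] by (simp add: mult.commute)
  show "(\<lambda>z. c * f z) \<in> hardy p" using le f by blast
  show "hardy_norm p (\<lambda>z. c * f z) = norm c * hardy_norm p f"
  proof (cases "c = 0")
    case True
    then show ?thesis using le[OF f, of 0] hardy_norm_nonneg[of p "\<lambda>z. 0"] by simp
  next
    case False
    have "hardy_norm p (\<lambda>z. inverse c * (c * f z)) \<le> norm (inverse c) * hardy_norm p (\<lambda>z. c * f z)"
      using le[of "\<lambda>z. c * f z" "inverse c"] le[OF f, of c] by blast
    moreover have "(\<lambda>z. inverse c * (c * f z)) = f" using False by (simp add: fun_eq_iff)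
    ultimately have "norm c * hardy_norm p f \<le> hardy_norm p (\<lambda>z. c * f z)"
      using False by (simp add: norm_inverse norm_divide field_simps)
    then show ?thesis using le[OF f, of c] by simp
  qed
qed

text \<open>On the circle through \<open>z\<close> a continuous nonnegative function has integral 0,
  so it vanishes at every angle.\<close>

lemma hardy_norm_eq_0:
  assumes f: "f \<in> hardy p" and p: "p \<ge> 1" and 0: "hardy_norm p f = 0" and z: "z \<in> unit_disk"
  shows "f z = 0"
proof -
  define r where "r = norm z"
  have r: "r \<in> {0..<1}" using z by (simp add: r_def)
  have c: "continuous_on {0..2*pi} (\<lambda>t. norm (f (of_real r * cis t)) powr p)"
    by (rule continuous_on_circle_powr[OF hardy_continuous[OF f] r p])
  have "int_mean p f r \<le> 0" using int_mean_le_hardy_norm[OF f p r] 0 p by simp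
  then have "integral {0..2*pi} (\<lambda>t. norm (f (of_real r * cis t)) powr p) = 0"
    using int_mean_nonneg[OF hardy_continuous[OF f] r p] by (simp add: int_mean_def field_simps)
  then have "((\<lambda>t. norm (f (of_real r * cis t)) powr p) has_integral 0) (cbox 0 (2*pi))"
    using integrable_continuous_real[OF c] by (metis box_real(2) integrable_integral)
  then have zero: "norm (f (of_real r * cis t)) powr p = 0" if "t \<in> {0..2*pi}" for t
    using has_integral_0_cbox_imp_0[of 0 "2*pi" "\<lambda>t. norm (f (of_real r * cis t)) powr p" t] c that pi_gt_zero by (simp add: box_eq_empty)
  obtain t where "t \<in> {0..2*pi}" "z = of_real r * cis t"
  proof -
    have "z = rcis (norm z) (Arg2pi z)" using Arg2pi_eq[of z] by (simp add: rcis_def cis_conv_exp mult.commute)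
    then show ?thesis using that[of "Arg2pi z"] Arg2pi[of z] by (simp add: rcis_def r_def less_imp_le)
  qed
  then show ?thesis using zero[of t] by simp
qed

section \<open>The space \<open>Sp p\<close> and the symbols of a bounded weighted composition
  operator\<close>

lemma deriv_cong_disk:
  assumes "\<And>z. z \<in> unit_disk \<Longrightarrow> f z = g z" "z \<in> unit_disk"
  shows "deriv f z = deriv g z"
proof (rule deriv_cong_ev)
  show "\<forall>\<^sub>F x in nhds z. f x = g x"
    using eventually_nhds_in_open[OF open_ball assms(2)] by eventually_elim (rule assms(1))
qed simp

lemma Sp_holomorphic: "f \<in> Sp p \<Longrightarrow> f holomorphic_on unit_disk"
  by (simp add: Sp_def)

lemma Sp_differentiable: "f \<in> Sp p \<Longrightarrow> z \<in> unit_disk \<Longrightarrow> f field_differentiable at z"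
  using holomorphic_on_imp_differentiable_at[OF Sp_holomorphic open_ball] by blast

lemma Sp_add:
  assumes f: "f \<in> Sp p" and g: "g \<in> Sp p" and p: "p \<ge> 1"
  shows "(\<lambda>z. f z + g z) \<in> Sp p" "Sp_norm p (\<lambda>z. f z + g z) \<le> 4 * (Sp_norm p f + Sp_norm p g)"
proof -
  have d: "deriv (\<lambda>z. f z + g z) z = deriv f z + deriv g z" if "z \<in> unit_disk" for z
    by (rule deriv_add[OF Sp_differentiable[OF f that] Sp_differentiable[OF g that]])
  have fg: "deriv f \<in> hardy p" "deriv g \<in> hardy p" using f g by (auto simp: Sp_def)
  show "(\<lambda>z. f z + g z) \<in> Sp p"
    using f g hardy_add(1)[OF fg p] hardy_cong(1)[OF d] by (auto simp: Sp_def intro!: holomorphic_intros)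
  have "hardy_norm p (deriv (\<lambda>z. f z + g z)) \<le> 4 * (hardy_norm p (deriv f) + hardy_norm p (deriv g))"
    using hardy_add(2)[OF fg p] hardy_cong(2)[OF d] by simp
  moreover have "norm (f 0 + g 0) \<le> norm (f 0) + norm (g 0)" by (rule norm_triangle_ineq)
  ultimately show "Sp_norm p (\<lambda>z. f z + g z) \<le> 4 * (Sp_norm p f + Sp_norm p g)"
    using norm_ge_zero[of "f 0"] norm_ge_zero[of "g 0"] unfolding Sp_norm_def by argo
qed

lemma Sp_scale:
  assumes f: "f \<in> Sp p" and p: "p \<ge> 1"
  shows "(\<lambda>z. c * f z) \<in> Sp p" "Sp_norm p (\<lambda>z. c * f z) = norm c * Sp_norm p f"
proof -
  have d: "deriv (\<lambda>z. c * f z) z = c * deriv f z" if "z \<in> unit_disk" for z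
    by (rule deriv_cmult[OF Sp_differentiable[OF f that]])
  have f': "deriv f \<in> hardy p" using f by (auto simp: Sp_def)
  show "(\<lambda>z. c * f z) \<in> Sp p"
    using f hardy_scale(1)[OF f' p] hardy_cong(1)[OF d] by (auto simp: Sp_def intro!: holomorphic_intros)
  show "Sp_norm p (\<lambda>z. c * f z) = norm c * Sp_norm p f"
    using hardy_scale(2)[OF f' p] hardy_cong(2)[OF d] by (simp add: Sp_norm_def norm_mult distrib_left)
qed

lemma Sp_diff:
  assumes f: "f \<in> Sp p" and g: "g \<in> Sp p" and p: "p \<ge> 1"
  shows "(\<lambda>z. f z - g z) \<in> Sp p" "Sp_norm p (\<lambda>z. f z - g z) \<le> 4 * (Sp_norm p f + Sp_norm p g)"
  using Sp_add[OF f Sp_scale(1)[OF g p, of "-1"] p] Sp_scale(2)[OF g p, of "-1"] by simp_all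

lemma Sp_norm_nonneg: "0 \<le> Sp_norm p f"
  by (simp add: Sp_norm_def hardy_norm_nonneg)

text \<open>The derivative vanishes on the disk and so does the value at 0. Equality on the whole
  plane comes from the convention that elements of \<open>Sp p\<close> are 0 off the disk.\<close>

lemma Sp_norm_eq_0:
  assumes f: "f \<in> Sp p" and p: "p \<ge> 1" and 0: "Sp_norm p f = 0"
  shows "f = (\<lambda>_. 0)"
proof
  fix z
  have f': "deriv f \<in> hardy p" using f by (auto simp: Sp_def)
  have *: "f 0 = 0" "hardy_norm p (deriv f) = 0"
    using 0 hardy_norm_nonneg[of p "deriv f"] norm_ge_zero[of "f 0"] unfolding Sp_norm_def by (auto simp: add_nonneg_eq_0_iff)
  show "f z = 0"
  proof (cases "z \<in> unit_disk")
    case True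
    have "\<exists>c. \<forall>z\<in>unit_disk. f z = c"
    proof (rule has_field_derivative_zero_constant[OF convex_ball])
      fix z :: complex assume z: "z \<in> unit_disk"
      have "(f has_field_derivative deriv f z) (at z)"
        using Sp_differentiable[OF f z] by (simp add: DERIV_deriv_iff_field_differentiable)
      then show "(f has_field_derivative 0) (at z within unit_disk)"
        using hardy_norm_eq_0[OF f' p *(2) z] by (simp add: has_field_derivative_at_within)
    qed
    then show ?thesis using *(1) True by (metis centre_in_ball zero_less_one)
  next
    case False
    then show ?thesis using f by (simp add: Sp_def)
  qed
qed

lemma const_Sp:
  assumes p: "p \<ge> 1"
  shows "(\<lambda>z. if z \<in> unit_disk then 1 else 0) \<in> Sp p" "(\<lambda>z. if z \<in> unit_disk then z else 0) \<in> Sp p"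
proof -
  have h: "(\<lambda>z. c) \<in> hardy p" for c
  proof (rule hardyI(1)[OF holomorphic_on_const p, of "norm c"])
    show "int_mean p (\<lambda>z. c) r \<le> norm c powr p" for r by (simp add: int_mean_def)
  qed simp
  have 1: "deriv (\<lambda>z. if z \<in> unit_disk then 1 else 0) z = (0::complex)" if "z \<in> unit_disk" for z :: complex
    using deriv_cong_disk[OF _ that, of "\<lambda>z. if z \<in> unit_disk then 1 else 0" "\<lambda>_. 1"] by simp
  have 2: "deriv (\<lambda>z. if z \<in> unit_disk then z else 0) z = (1::complex)" if "z \<in> unit_disk" for z :: complex
    using deriv_cong_disk[OF _ that, of "\<lambda>z. if z \<in> unit_disk then z else 0" "\<lambda>z. z"] by simp
  show "(\<lambda>z. if z \<in> unit_disk then 1 else 0) \<in> Sp p"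
    using h[of 0] hardy_cong(1)[OF 1] unfolding Sp_def
    by (auto intro: holomorphic_transform[OF holomorphic_on_const])
  show "(\<lambda>z. if z \<in> unit_disk then z else 0) \<in> Sp p"
    using h[of 1] hardy_cong(1)[OF 2] unfolding Sp_def
    by (auto intro: holomorphic_transform[OF holomorphic_on_ident])
qed

text \<open>The operator is tested on the functions 1 and \<open>z\<close>. The first yields
  \<open>deriv w\<close>; the second yields the derivative of \<open>w * v\<close>, from which
  \<open>deriv w * v\<close> may be subtracted because \<open>v\<close> is bounded by 1.\<close>

lemma symbol_in_hardy:
  assumes p: "p \<ge> 1" and w: "w holomorphic_on unit_disk" and v: "v holomorphic_on unit_disk" "v ` unit_disk \<subseteq> unit_disk"
    and T: "\<And>f. f \<in> Sp p \<Longrightarrow> wcomp w v f \<in> Sp p"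
  shows "deriv w \<in> hardy p" "(\<lambda>z. w z * deriv v z) \<in> hardy p"
proof -
  have v1: "v z \<in> unit_disk" if "z \<in> unit_disk" for z using v(2) that by blast
  have d: "w field_differentiable at z" "v field_differentiable at z" if "z \<in> unit_disk" for z
    using holomorphic_on_imp_differentiable_at[OF _ open_ball that] w v by auto
  have 1: "deriv (wcomp w v (\<lambda>z. if z \<in> unit_disk then 1 else 0)) z = deriv w z" if "z \<in> unit_disk" for z
    by (rule deriv_cong_disk[OF _ that]) (use v1 in \<open>simp add: wcomp_def\<close>)
  have "deriv (wcomp w v (\<lambda>z. if z \<in> unit_disk then 1 else 0)) \<in> hardy p"
    using T[OF const_Sp(1)[OF p]] by (simp add: Sp_def)
  moreover have "deriv w \<in> hardy p \<longleftrightarrow> deriv (wcomp w v (\<lambda>z. if z \<in> unit_disk then 1 else 0)) \<in> hardy p"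
    by (rule hardy_cong(1)[OF 1[symmetric]])
  ultimately show w': "deriv w \<in> hardy p" by blast
  have 2: "deriv (wcomp w v (\<lambda>z. if z \<in> unit_disk then z else 0)) z = w z * deriv v z + deriv w z * v z"
    if "z \<in> unit_disk" for z
  proof -
    have "deriv (wcomp w v (\<lambda>z. if z \<in> unit_disk then z else 0)) z = deriv (\<lambda>z. w z * v z) z"
      by (rule deriv_cong_disk[OF _ that]) (use v1 in \<open>simp add: wcomp_def\<close>)
    also have "\<dots> = w z * deriv v z + deriv w z * v z" by (rule deriv_mult[OF d[OF that]])
    finally show ?thesis .
  qed
  have "deriv (wcomp w v (\<lambda>z. if z \<in> unit_disk then z else 0)) \<in> hardy p"
    using T[OF const_Sp(2)[OF p]] by (simp add: Sp_def)
  moreover have "(\<lambda>z. w z * deriv v z + deriv w z * v z) \<in> hardy p \<longleftrightarrow>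
      deriv (wcomp w v (\<lambda>z. if z \<in> unit_disk then z else 0)) \<in> hardy p"
    by (rule hardy_cong(1)[OF 2[symmetric]])
  ultimately have A: "(\<lambda>z. w z * deriv v z + deriv w z * v z) \<in> hardy p" by blast
  have "(\<lambda>z. deriv w z * v z) \<in> hardy p"
    by (rule hardy_mult_bounded(1)[OF w' v(1) p, of 1]) (use v1 in \<open>auto intro: less_imp_le\<close>)
  from hardy_add(1)[OF A hardy_scale(1)[OF this p, of "-1"] p]
  show "(\<lambda>z. w z * deriv v z) \<in> hardy p" by simp
qed

section \<open>Sparse power series\<close>

text \<open>The antiderivative of \<open>lac_deriv n a\<close> that vanishes at the origin, so that
  its norm in \<open>Sp p\<close> is the Hardy norm of \<open>lac_deriv n a\<close>. The value 0 off
  the disk follows the convention of \<open>Sp\<close>.\<close>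

definition lac_fun :: "(nat \<Rightarrow> nat) \<Rightarrow> (nat \<Rightarrow> complex) \<Rightarrow> complex \<Rightarrow> complex" where
  "lac_fun n a z = (if z \<in> unit_disk then \<Sum>k. a k * z ^ (n k + 1) / of_nat (n k + 1) else 0)"

definition lac_deriv :: "(nat \<Rightarrow> nat) \<Rightarrow> (nat \<Rightarrow> complex) \<Rightarrow> complex \<Rightarrow> complex" where
  "lac_deriv n a z = (\<Sum>k. a k * z ^ n k)"

text \<open>As \<open>k \<le> n k\<close> for strictly increasing \<open>n\<close>, the sparse
  series are dominated by geometric ones in \<open>k\<close>, uniformly on smaller disks.\<close>

lemma lac_term_le:
  fixes a :: "nat \<Rightarrow> complex" and z :: complex
  assumes n: "strict_mono n" and a: "norm (a k) \<le> A" and z: "norm z \<le> \<rho>" "\<rho> < 1"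
  shows "norm (a k * z ^ n k) \<le> A * \<rho> ^ k" "norm (a k * z ^ (n k + 1) / of_nat (n k + 1)) \<le> A * \<rho> ^ k"
proof -
  have \<rho>0: "0 \<le> \<rho>" using z(1) norm_ge_zero order_trans by blast
  have A0: "0 \<le> A" using a norm_ge_zero order_trans by blast
  have nk: "k \<le> n k" by (rule strict_mono_imp_increasing[OF n])
  have "norm z ^ n k \<le> \<rho> ^ n k" using z(1) by (intro power_mono) auto
  also have "\<dots> \<le> \<rho> ^ k" using \<rho>0 z(2) nk by (intro power_decreasing) auto
  finally have 1: "norm z ^ n k \<le> \<rho> ^ k" .
  have "norm (a k) * norm z ^ n k \<le> A * \<rho> ^ k" using a 1 A0 by (intro mult_mono) auto
  then show *: "norm (a k * z ^ n k) \<le> A * \<rho> ^ k" by (simp add: norm_mult norm_power)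
  have "norm (a k * z ^ (n k + 1) / of_nat (n k + 1)) = norm (a k * z ^ n k) * (norm z / real (n k + 1))"
    by (simp add: norm_mult norm_divide norm_power del: of_nat_Suc of_nat_add)
  also have "\<dots> \<le> norm (a k * z ^ n k) * 1"
    using z by (intro mult_left_mono) (auto simp: divide_le_eq)
  finally show "norm (a k * z ^ (n k + 1) / of_nat (n k + 1)) \<le> A * \<rho> ^ k" using * by simp
qed

lemma lac_summable:
  fixes a :: "nat \<Rightarrow> complex" and z :: complex
  assumes n: "strict_mono n" and a: "\<And>k. norm (a k) \<le> A" and z: "z \<in> unit_disk"
  shows "summable (\<lambda>k. a k * z ^ n k)" "summable (\<lambda>k. a k * z ^ (n k + 1) / of_nat (n k + 1))"
proof -
  have "summable (\<lambda>k. A * norm z ^ k)" using z by (intro summable_mult summable_geometric) simp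
  note c = summable_comparison_test'[OF this, of 0]
  have z1: "norm z < 1" using z by simp
  show "summable (\<lambda>k. a k * z ^ n k)" "summable (\<lambda>k. a k * z ^ (n k + 1) / of_nat (n k + 1))"
    by (rule c, rule lac_term_le[where a = a, OF n a order_refl z1])+
qed

lemma lac_fun_has_derivative:
  assumes n: "strict_mono n" and a: "\<And>k. norm (a k) \<le> A" and z: "z \<in> unit_disk"
  shows "(lac_fun n a has_field_derivative lac_deriv n a z) (at z)"
proof -
  define f where "f = (\<lambda>k z. a k * z ^ (n k + 1) / of_nat (n k + 1))"
  define f' where "f' = (\<lambda>k z. a k * z ^ n k)"
  have A0: "0 \<le> A" using a[of 0] norm_ge_zero order_trans by blast
  have "\<exists>g g'. \<forall>x\<in>unit_disk. ((\<lambda>k. f k x) sums g x) \<and> ((\<lambda>k. f' k x) sums g' x) \<and> (g has_field_derivative g' x) (at x)"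
  proof (rule series_and_derivative_comparison_complex[OF open_ball])
    show "(f k has_field_derivative f' k x) (at x)" for k x
    proof -
      have nz: "(of_nat (n k + 1) :: complex) \<noteq> 0" unfolding of_nat_eq_0_iff by simp
      have "((\<lambda>z. z ^ (n k + 1)) has_field_derivative of_nat (n k + 1) * x ^ n k) (at x)"
        using DERIV_power[OF DERIV_ident, where n = "n k + 1" and x = x and s = UNIV] by simp
      from DERIV_cdivide[OF DERIV_cmult[OF this, of "a k"], of "of_nat (n k + 1)"]
      show ?thesis unfolding f_def f'_def by (simp only: mult.left_commute[of "a k"] nonzero_mult_div_cancel_left[OF nz])
    qed
    fix x :: complex assume x: "x \<in> unit_disk"
    \<comment> \<open>Half the distance to the unit circle; \<open>\<rho>\<close> then bounds the
      modulus on \<open>ball x d\<close> and is below 1, which gives a geometric majorant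
      there.\<close>
    define d where "d = (1 - norm x) / 2"
    define \<rho> where "\<rho> = (1 + norm x) / 2"
    have d: "0 < d" and \<rho>: "0 \<le> \<rho>" "\<rho> < 1" using x by (auto simp: d_def \<rho>_def intro!: add_nonneg_nonneg)
    have **: "norm (f k y) \<le> norm (complex_of_real (A * \<rho> ^ k))" if "y \<in> ball x d" for k y
    proof -
      have "norm y \<le> norm x + norm (y - x)" by (rule norm_triangle_sub)
      then have "norm y \<le> \<rho>" using that by (simp add: dist_norm norm_minus_commute d_def \<rho>_def field_simps)
      from lac_term_le(2)[OF n a this \<rho>(2)] show ?thesis
        unfolding f_def norm_of_real using A0 \<rho> by (simp del: of_nat_Suc of_nat_add)
    qed
    have "summable (\<lambda>k. complex_of_real (A * \<rho> ^ k))"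
      using \<rho> by (intro summable_of_real summable_mult summable_geometric) simp
    moreover have "range (\<lambda>k. complex_of_real (A * \<rho> ^ k)) \<subseteq> \<real>\<^sub>\<ge>\<^sub>0"
      using A0 \<rho> by auto
    ultimately have "0 < d \<and> summable (\<lambda>k. complex_of_real (A * \<rho> ^ k)) \<and> range (\<lambda>k. complex_of_real (A * \<rho> ^ k)) \<subseteq> \<real>\<^sub>\<ge>\<^sub>0 \<and>
        (\<forall>\<^sub>F k in sequentially. \<forall>y\<in>ball x d \<inter> unit_disk. norm (f k y) \<le> norm (complex_of_real (A * \<rho> ^ k)))"
      using d by (intro conjI always_eventually allI ballI) (elim IntE | assumption | rule **)+
    then show "\<exists>d (h :: nat \<Rightarrow> complex). 0 < d \<and> summable h \<and> range h \<subseteq> \<real>\<^sub>\<ge>\<^sub>0 \<and>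
        (\<forall>\<^sub>F n in sequentially. \<forall>y\<in>ball x d \<inter> unit_disk. norm (f n y) \<le> norm (h n))"
      by (intro exI)
  qed
  then obtain g g' where g: "\<And>x. x \<in> unit_disk \<Longrightarrow> (\<lambda>k. f k x) sums g x"
    "\<And>x. x \<in> unit_disk \<Longrightarrow> (\<lambda>k. f' k x) sums g' x"
    "\<And>x. x \<in> unit_disk \<Longrightarrow> (g has_field_derivative g' x) (at x)" by blast
  have "g x = lac_fun n a x" if "x \<in> unit_disk" for x
    using sums_unique[OF g(1)[OF that]] that unfolding lac_fun_def f_def by simp
  moreover have "g' z = lac_deriv n a z" using sums_unique[OF g(2)[OF z]] by (simp add: lac_deriv_def f'_def)
  ultimately show ?thesis
    using has_field_derivative_transform_within_open[OF g(3)[OF z] open_ball z] by metis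
qed

lemma lac_fun_holomorphic:
  assumes n: "strict_mono n" and a: "\<And>k. norm (a k) \<le> A"
  shows "lac_fun n a holomorphic_on unit_disk" "lac_deriv n a holomorphic_on unit_disk"
    "\<And>z. z \<in> unit_disk \<Longrightarrow> deriv (lac_fun n a) z = lac_deriv n a z"
proof -
  note d = lac_fun_has_derivative[of n a A, OF n a]
  show 1: "lac_fun n a holomorphic_on unit_disk"
    unfolding holomorphic_on_open[OF open_ball] using d by blast
  show 2: "deriv (lac_fun n a) z = lac_deriv n a z" if "z \<in> unit_disk" for z
    by (rule DERIV_imp_deriv[OF d[OF that]])
  show "lac_deriv n a holomorphic_on unit_disk"
    by (rule holomorphic_transform[OF holomorphic_deriv[OF 1 open_ball]]) (simp add: 2)
qed

lemma lac_fun_0: "lac_fun n a 0 = 0"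
  by (simp add: lac_fun_def)

section \<open>The sequence space \<open>l2\<close>\<close>

lemma l2_summable: "a \<in> l2 \<Longrightarrow> summable (\<lambda>k. (norm (a k))\<^sup>2)"
  by (simp add: l2_def)

lemma l2_norm_nonneg: "a \<in> l2 \<Longrightarrow> 0 \<le> l2_norm a"
  by (simp add: l2_norm_def l2_def suminf_nonneg)

lemma l2_norm_sq: "a \<in> l2 \<Longrightarrow> (l2_norm a)\<^sup>2 = (\<Sum>k. (norm (a k))\<^sup>2)"
  by (simp add: l2_norm_def l2_def suminf_nonneg)

lemma l2_partial_le: "a \<in> l2 \<Longrightarrow> (\<Sum>k<K. (norm (a k))\<^sup>2) \<le> (l2_norm a)\<^sup>2"
  unfolding l2_norm_sq by (rule sum_le_suminf) (auto simp: l2_def)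

lemma l2I:
  assumes "\<And>K. (\<Sum>k<K. (norm (a k))\<^sup>2) \<le> C\<^sup>2" "C \<ge> 0"
  shows "a \<in> l2" "l2_norm a \<le> C"
proof -
  have s: "summable (\<lambda>k. (norm (a k))\<^sup>2)"
    by (rule bounded_imp_summable[of _ "C\<^sup>2"]) (use assms(1)[of "Suc _"] in \<open>auto simp: lessThan_Suc_atMost\<close>)
  then show a: "a \<in> l2" by (simp add: l2_def)
  have "(l2_norm a)\<^sup>2 \<le> C\<^sup>2" unfolding l2_norm_sq[OF a] using s assms(1) by (intro suminf_le_const)
  then show "l2_norm a \<le> C" using assms(2) by (rule power2_le_imp_le)
qed

lemma l2_coord_le: "a \<in> l2 \<Longrightarrow> norm (a k) \<le> l2_norm a"
proof -
  assume a: "a \<in> l2"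
  have "(norm (a k))\<^sup>2 \<le> (\<Sum>j<Suc k. (norm (a j))\<^sup>2)" by (rule member_le_sum) auto
  also have "\<dots> \<le> (l2_norm a)\<^sup>2" by (rule l2_partial_le[OF a])
  finally show ?thesis by (rule power2_le_imp_le[OF _ l2_norm_nonneg[OF a]])
qed

lemma l2_scale:
  assumes "a \<in> l2"
  shows "(\<lambda>k. c * a k) \<in> l2" "l2_norm (\<lambda>k. c * a k) = norm c * l2_norm a"
proof -
  have e: "(\<lambda>k. (norm (c * a k))\<^sup>2) = (\<lambda>k. (norm c)\<^sup>2 * (norm (a k))\<^sup>2)"
    by (simp add: norm_mult power_mult_distrib)
  show 1: "(\<lambda>k. c * a k) \<in> l2" using assms unfolding l2_def mem_Collect_eq e by (intro summable_mult)
  have "(\<Sum>k. (norm (c * a k))\<^sup>2) = (norm c)\<^sup>2 * (\<Sum>k. (norm (a k))\<^sup>2)"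
    unfolding e by (rule suminf_mult[OF l2_summable[OF assms]])
  then show "l2_norm (\<lambda>k. c * a k) = norm c * l2_norm a"
    by (simp add: l2_norm_def real_sqrt_mult)
qed

lemma norm_add_square_le: "(norm (x + y))\<^sup>2 \<le> 2 * (norm x)\<^sup>2 + 2 * (norm (y::complex))\<^sup>2"
proof -
  have "(norm (x + y))\<^sup>2 \<le> (norm x + norm y)\<^sup>2" by (intro power_mono norm_triangle_ineq) auto
  also have "\<dots> \<le> 2 * (norm x)\<^sup>2 + 2 * (norm y)\<^sup>2"
    using zero_le_power2[of "norm x - norm y"] by (simp add: power2_eq_square algebra_simps)
  finally show ?thesis .
qed

lemma l2_add:
  assumes "a \<in> l2" "b \<in> l2"
  shows "(\<lambda>k. a k + b k) \<in> l2"
proof -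
  have "summable (\<lambda>k. 2 * (norm (a k))\<^sup>2 + 2 * (norm (b k))\<^sup>2)"
    using assms by (intro summable_add summable_mult l2_summable)
  then have "summable (\<lambda>k. (norm (a k + b k))\<^sup>2)"
    by (rule summable_comparison_test'[where N = 0]) (simp add: norm_add_square_le)
  then show ?thesis by (simp add: l2_def)
qed

lemma l2_diff:
  assumes "a \<in> l2" "b \<in> l2"
  shows "(\<lambda>k. a k - b k) \<in> l2"
  using l2_add[OF assms(1) l2_scale(1)[OF assms(2), of "-1"]] by simp

lemma l2_norm_eq_0:
  assumes "a \<in> l2" "l2_norm a = 0"
  shows "a = (\<lambda>_. 0)"
  using l2_coord_le[OF assms(1)] assms(2) by (simp add: fun_eq_iff)

text \<open>Completeness in the form in which closedness of the subspace uses it: \<open>e i\<close>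
  plays the distance from \<open>a i\<close> to a common target, and the limit inherits this rate.
  Coordinates converge, and letting \<open>j\<close> tend to infinity in finite partial sums gives
  the bound for the limit.\<close>

lemma l2_complete:
  fixes a :: "nat \<Rightarrow> nat \<Rightarrow> complex"
  assumes a: "\<And>i. a i \<in> l2" and e: "e \<longlonglongrightarrow> 0"
    and c: "\<And>i j. l2_norm (\<lambda>k. a i k - a j k) \<le> e i + e j"
  shows "\<exists>b\<in>l2. \<forall>i. l2_norm (\<lambda>k. a i k - b k) \<le> e i \<and> 0 \<le> e i"
proof -
  note d = l2_diff[OF a a]
  have e0: "0 \<le> e i" for i using c[of i i] l2_norm_nonneg[OF d[of i i]] by simp
  have "Cauchy (\<lambda>i. a i k)" for k
  proof (rule metric_CauchyI)
    fix \<epsilon> :: real assume "\<epsilon> > 0"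
    then have "\<forall>\<^sub>F i in sequentially. e i < \<epsilon> / 2" by (intro order_tendstoD(2)[OF e]) simp
    then obtain M where M: "\<And>i. i \<ge> M \<Longrightarrow> e i < \<epsilon> / 2" by (auto simp: eventually_sequentially)
    show "\<exists>M. \<forall>i\<ge>M. \<forall>j\<ge>M. dist (a i k) (a j k) < \<epsilon>"
    proof (intro exI[of _ M] allI impI)
      fix i j assume ij: "i \<ge> M" "j \<ge> M"
      have "dist (a i k) (a j k) \<le> e i + e j"
        using l2_coord_le[OF d[of i j], of k] c[of i j] by (simp add: dist_norm)
      then show "dist (a i k) (a j k) < \<epsilon>" using M[OF ij(1)] M[OF ij(2)] by simp
    qed
  qed
  then have "\<exists>l. (\<lambda>i. a i k) \<longlonglongrightarrow> l" for k by (simp add: Cauchy_convergent_iff convergent_def)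
  then obtain b where b: "\<And>k. (\<lambda>i. a i k) \<longlonglongrightarrow> b k" by metis
  have ab: "(\<lambda>k. a i k - b k) \<in> l2 \<and> l2_norm (\<lambda>k. a i k - b k) \<le> e i" for i
  proof -
    have "(\<Sum>k<K. (norm (a i k - b k))\<^sup>2) \<le> (e i)\<^sup>2" for K
    proof (rule LIMSEQ_le)
      show "(\<lambda>j. \<Sum>k<K. (norm (a i k - a j k))\<^sup>2) \<longlonglongrightarrow> (\<Sum>k<K. (norm (a i k - b k))\<^sup>2)"
        by (intro tendsto_sum tendsto_power tendsto_norm tendsto_diff tendsto_const b)
      have "(\<lambda>j. (e i + e j)\<^sup>2) \<longlonglongrightarrow> (e i + 0)\<^sup>2" by (intro tendsto_power tendsto_add tendsto_const e)
      then show "(\<lambda>j. (e i + e j)\<^sup>2) \<longlonglongrightarrow> (e i)\<^sup>2" by simp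
      have "(\<Sum>k<K. (norm (a i k - a j k))\<^sup>2) \<le> (e i + e j)\<^sup>2" for j
      proof -
        have "(\<Sum>k<K. (norm (a i k - a j k))\<^sup>2) \<le> (l2_norm (\<lambda>k. a i k - a j k))\<^sup>2"
          by (rule l2_partial_le[OF d])
        also have "\<dots> \<le> (e i + e j)\<^sup>2" by (intro power_mono c l2_norm_nonneg d)
        finally show ?thesis .
      qed
      then show "\<exists>N. \<forall>j\<ge>N. (\<Sum>k<K. (norm (a i k - a j k))\<^sup>2) \<le> (e i + e j)\<^sup>2" by blast
    qed
    from l2I[OF this e0] show ?thesis by blast
  qed
  have "b \<in> l2" using l2_diff[OF a[of 0] conjunct1[OF ab[of 0]]] by simp
  then show ?thesis using ab e0 by blast
qed

lemma l2_truncate: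
  assumes a: "a \<in> l2"
  shows "(\<lambda>k. if k < K then a k else 0) \<in> l2"
    "l2_norm (\<lambda>k. if k < K then a k else 0) = sqrt (\<Sum>k<K. (norm (a k))\<^sup>2)"
    "(\<lambda>k. if k < K then 0 else a k) \<in> l2"
    "(\<lambda>K. l2_norm (\<lambda>k. if k < K then 0 else a k)) \<longlonglongrightarrow> 0"
    "(\<lambda>K. l2_norm (\<lambda>k. if k < K then a k else 0)) \<longlonglongrightarrow> l2_norm a"
proof -
  have s: "(\<lambda>k. (norm (if k < K then a k else 0))\<^sup>2) sums (\<Sum>k<K. (norm (a k))\<^sup>2)" for K
    using sums_If_finite_set[of "{..<K}" "\<lambda>k. (norm (a k))\<^sup>2"]
    by (simp add: if_distrib[where f = norm] if_distrib[where f = "\<lambda>x. x ^ 2"] cong: if_cong)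
  show "(\<lambda>k. if k < K then a k else 0) \<in> l2" using sums_summable[OF s] by (simp add: l2_def)
  show n: "l2_norm (\<lambda>k. if k < K then a k else 0) = sqrt (\<Sum>k<K. (norm (a k))\<^sup>2)" for K
    using sums_unique[OF s[of K]] by (simp add: l2_norm_def)
  have lim: "(\<lambda>K. \<Sum>k<K. (norm (a k))\<^sup>2) \<longlonglongrightarrow> (\<Sum>k. (norm (a k))\<^sup>2)"
    by (rule summable_LIMSEQ[OF l2_summable[OF a]])
  show "(\<lambda>K. l2_norm (\<lambda>k. if k < K then a k else 0)) \<longlonglongrightarrow> l2_norm a"
    unfolding n unfolding l2_norm_def by (rule tendsto_real_sqrt[OF lim])
  have s2: "(\<lambda>k. (norm (if k < K then 0 else a k))\<^sup>2) sums ((\<Sum>k. (norm (a k))\<^sup>2) - (\<Sum>k<K. (norm (a k))\<^sup>2))" for K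
  proof -
    have "(\<lambda>k. (norm (a k))\<^sup>2 - (norm (if k < K then a k else 0))\<^sup>2) sums ((\<Sum>k. (norm (a k))\<^sup>2) - (\<Sum>k<K. (norm (a k))\<^sup>2))"
      by (intro sums_diff s summable_sums l2_summable a)
    moreover have "(\<lambda>k. (norm (a k))\<^sup>2 - (norm (if k < K then a k else 0))\<^sup>2) = (\<lambda>k. (norm (if k < K then 0 else a k))\<^sup>2)"
      by auto
    ultimately show ?thesis by simp
  qed
  show "(\<lambda>k. if k < K then 0 else a k) \<in> l2" using sums_summable[OF s2] by (simp add: l2_def)
  have "(\<lambda>K. sqrt ((\<Sum>k. (norm (a k))\<^sup>2) - (\<Sum>k<K. (norm (a k))\<^sup>2))) \<longlonglongrightarrow> sqrt ((\<Sum>k. (norm (a k))\<^sup>2) - (\<Sum>k. (norm (a k))\<^sup>2))"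
    by (intro tendsto_real_sqrt tendsto_diff tendsto_const lim)
  then show "(\<lambda>K. l2_norm (\<lambda>k. if k < K then 0 else a k)) \<longlonglongrightarrow> 0"
    unfolding l2_norm_def using sums_unique[OF s2] by simp
qed

section \<open>The map from \<open>l2\<close> into \<open>Sp p\<close> and its upper bound\<close>

lemma lac_fun_add:
  assumes n: "strict_mono n" and a: "a \<in> l2" "b \<in> l2"
  shows "lac_fun n (\<lambda>k. a k + b k) z = lac_fun n a z + lac_fun n b z"
proof (cases "z \<in> unit_disk")
  case True
  show ?thesis
    using suminf_add[OF lac_summable(2)[OF n l2_coord_le[OF a(1)] True] lac_summable(2)[OF n l2_coord_le[OF a(2)] True]] True
    by (simp add: lac_fun_def distrib_right add_divide_distrib)
qed (simp add: lac_fun_def)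

lemma lac_fun_scale:
  assumes n: "strict_mono n" and a: "a \<in> l2"
  shows "lac_fun n (\<lambda>k. c * a k) z = c * lac_fun n a z"
proof (cases "z \<in> unit_disk")
  case True
  show ?thesis
    using suminf_mult[OF lac_summable(2)[OF n l2_coord_le[OF a] True], of c] True
    by (simp add: lac_fun_def mult.assoc)
qed (simp add: lac_fun_def)

lemma lac_fun_diff:
  assumes n: "strict_mono n" and a: "a \<in> l2" "b \<in> l2"
  shows "lac_fun n (\<lambda>k. a k - b k) z = lac_fun n a z - lac_fun n b z"
  using lac_fun_add[OF n a(1) l2_scale(1)[OF a(2), of "-1"]] lac_fun_scale[OF n a(2), of "-1"] by simp

lemma powr_le_one_plus_power:
  fixes x :: real
  assumes "0 \<le> x" "0 < p" "p \<le> real m"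
  shows "x powr p \<le> 1 + x ^ m"
proof (cases "x \<le> 1")
  case True
  then have "x powr p \<le> 1" using assms by (intro powr_le1) auto
  then show ?thesis using assms zero_le_power[of x m] by linarith
next
  case False
  then have "x powr p \<le> x powr real m" using assms by (intro powr_mono) auto
  also have "\<dots> = x ^ m" using False by (simp add: powr_realpow)
  finally show ?thesis by simp
qed

text \<open>On the circle of radius \<open>r\<close> the factors \<open>r ^ n k\<close> are absorbed
  into the coefficients without increasing their moduli, so the moment bound for the unit circle
  holds at every radius. Since \<open>2*N\<close> is at least \<open>p\<close>, the p-th power is at
  most 1 plus the power of order \<open>2*N\<close>.\<close>

lemma lac_upper_unit:
  assumes n: "strict_mono n" and p: "1 \<le> p" "p \<le> real (2*N)" and B: "B \<ge> 0"
    and mom: "\<And>a K. (\<Sum>k<K. (norm (a k))\<^sup>2) \<le> 1 \<Longrightarrow>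
       (\<integral>t. norm (\<Sum>k<K. a k * cis t ^ n k) ^ (2*N) \<partial>circle_angles) \<le> B"
    and a: "a \<in> l2" "l2_norm a \<le> 1" and r: "r \<in> {0..<1}"
  shows "int_mean p (lac_deriv n a) r \<le> (1 + B / (2*pi)) powr p"
proof -
  let ?C = circle_angles
  have a1: "norm (a k) \<le> 1" for k using l2_coord_le[OF a(1), of k] a(2) by simp
  have rn: "norm (of_real r * cis t) = r" for t using r by (simp add: norm_mult)
  define S where "S = (\<lambda>K t. \<Sum>k<K. a k * (of_real r * cis t) ^ n k)"
  have Sc: "continuous_on A (S K)" for A K unfolding S_def by (intro continuous_intros)
  have Sint: "integral\<^sup>L ?C (\<lambda>t. norm (S K t) powr p) \<le> 2 * pi + B" for K
  proof -
    have "integral\<^sup>L ?C (\<lambda>t. norm (S K t) powr p) \<le> integral\<^sup>L ?C (\<lambda>t. 1 + norm (S K t) ^ (2*N))"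
    proof (rule integral_mono)
      show "integrable ?C (\<lambda>t. norm (S K t) powr p)"
        by (intro continuous_imp_integrable_real continuous_on_powr' continuous_on_norm Sc continuous_on_const) (use p in auto)
      show "integrable ?C (\<lambda>t. 1 + norm (S K t) ^ (2*N))"
        by (intro continuous_imp_integrable_real continuous_intros Sc)
      show "norm (S K t) powr p \<le> 1 + norm (S K t) ^ (2*N)" for t
        using p by (intro powr_le_one_plus_power) auto
    qed
    also have "\<dots> = (\<integral>t. 1 \<partial>?C) + (\<integral>t. norm (S K t) ^ (2*N) \<partial>?C)"
      by (intro Bochner_Integration.integral_add continuous_imp_integrable_real continuous_intros Sc)
    also have "(\<integral>t. (1::real) \<partial>?C) = 2 * pi" by (simp add: measure_restrict_space)
    also have "(\<integral>t. norm (S K t) ^ (2*N) \<partial>?C) = (\<integral>t. norm (\<Sum>k<K. (a k * of_real r ^ n k) * cis t ^ n k) ^ (2*N) \<partial>?C)"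
      unfolding S_def by (simp add: power_mult_distrib mult.assoc)
    also have "\<dots> \<le> B"
    proof (rule mom)
      have "(\<Sum>k<K. (norm (a k * of_real r ^ n k))\<^sup>2) \<le> (\<Sum>k<K. (norm (a k))\<^sup>2)"
      proof (intro sum_mono power_mono)
        show "norm (a k * of_real r ^ n k) \<le> norm (a k)" for k
          using r by (simp add: norm_mult norm_power mult_left_le power_le_one)
      qed auto
      also have "\<dots> \<le> (l2_norm a)\<^sup>2" by (rule l2_partial_le[OF a(1)])
      also have "\<dots> \<le> 1" using a l2_norm_nonneg by (intro power_le_one) auto
      finally show "(\<Sum>k<K. (norm (a k * of_real r ^ n k))\<^sup>2) \<le> 1" .
    qed
    finally show ?thesis by simp
  qed
  \<comment> \<open>At fixed \<open>r < 1\<close> the partial sums have the geometric bound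
    \<open>1 / (1 - r)\<close>, which may blow up with \<open>r\<close> because it serves only the
    limit in \<open>K\<close>.\<close>
  have lim: "(\<lambda>K. integral\<^sup>L ?C (\<lambda>t. norm (S K t) powr p))
     \<longlonglongrightarrow> integral\<^sup>L ?C (\<lambda>t. norm (lac_deriv n a (of_real r * cis t)) powr p)"
  proof (rule bounded_convergence[OF finite_circle_angles, where B = "(1 / (1 - r)) powr p"])
    show "(\<lambda>t. norm (S K t) powr p) \<in> borel_measurable ?C" for K
      by (rule borel_measurable_integrable, intro continuous_imp_integrable_real continuous_on_powr' continuous_on_norm Sc continuous_on_const)
        (use p in auto)
    show "norm (norm (S K t) powr p) \<le> (1 / (1 - r)) powr p" for K t
    proof -
      have "norm (S K t) \<le> (\<Sum>k<K. 1 * r ^ k)"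
        unfolding S_def by (intro order_trans[OF norm_sum] sum_mono lac_term_le(1)[OF n a1]) (use r rn in auto)
      also have "\<dots> \<le> (\<Sum>k. r ^ k)"
        unfolding mult_1 using r by (intro sum_le_suminf summable_geometric) auto
      also have "\<dots> = 1 / (1 - r)" using r by (simp add: suminf_geometric)
      finally show ?thesis using p by (simp add: powr_mono2)
    qed
    fix t
    have "(\<lambda>K. S K t) \<longlonglongrightarrow> lac_deriv n a (of_real r * cis t)"
      unfolding S_def lac_deriv_def
      by (rule summable_LIMSEQ[OF lac_summable(1)[OF n a1]]) (use r rn in auto)
    then show "(\<lambda>K. norm (S K t) powr p) \<longlonglongrightarrow> norm (lac_deriv n a (of_real r * cis t)) powr p"
      using p by (intro tendsto_powr' tendsto_norm tendsto_const) auto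
  qed
  have "integral\<^sup>L ?C (\<lambda>t. norm (lac_deriv n a (of_real r * cis t)) powr p) \<le> 2 * pi + B"
    by (rule LIMSEQ_le_const2[OF lim]) (use Sint in blast)
  then have "int_mean p (lac_deriv n a) r \<le> 1 + B / (2*pi)"
    using holomorphic_on_imp_continuous_on[OF lac_fun_holomorphic(2)[OF n a1]] r p
    by (subst int_mean_eq) (auto simp: field_simps)
  \<comment> \<open>The base is at least 1, so raising it to the power \<open>p\<close> only
    increases it; \<open>hardyI\<close> then turns the bound into one on the norm.\<close>
  also have "\<dots> = (1 + B / (2*pi)) powr 1" using B by (simp add: add_pos_nonneg)
  also have "\<dots> \<le> (1 + B / (2*pi)) powr p" using B p by (intro powr_mono) auto
  finally show ?thesis .
qed

text \<open>Both sides are homogeneous in \<open>a\<close>, which reduces the claim to the unit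
  ball; norm 0 cannot be normalised and is treated apart.\<close>

lemma lac_upper:
  assumes n: "strict_mono n" and p: "1 \<le> p" "p \<le> real (2*N)" and B: "B \<ge> 0"
    and mom: "\<And>a K. (\<Sum>k<K. (norm (a k))\<^sup>2) \<le> 1 \<Longrightarrow>
       (\<integral>t. norm (\<Sum>k<K. a k * cis t ^ n k) ^ (2*N) \<partial>circle_angles) \<le> B"
    and a: "a \<in> l2"
  shows "lac_fun n a \<in> Sp p" "Sp_norm p (lac_fun n a) \<le> (1 + B / (2*pi)) * l2_norm a"
proof -
  have unit: "lac_fun n a \<in> Sp p \<and> Sp_norm p (lac_fun n a) \<le> 1 + B / (2*pi)"
    if a: "a \<in> l2" "l2_norm a \<le> 1" for a
  proof -
    note h = lac_fun_holomorphic[of n a "l2_norm a", OF n l2_coord_le[OF a(1)]]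
    have B1: "0 \<le> 1 + B / (2*pi)" using B by simp
    note H = hardyI[OF h(2) p(1) B1 lac_upper_unit[OF n p B mom a]]
    have "deriv (lac_fun n a) \<in> hardy p \<longleftrightarrow> lac_deriv n a \<in> hardy p"
      "hardy_norm p (deriv (lac_fun n a)) = hardy_norm p (lac_deriv n a)"
      by (rule hardy_cong[OF h(3)]; assumption)+
    then show ?thesis using H h(1) by (auto simp: Sp_def Sp_norm_def lac_fun_0 lac_fun_def)
  qed
  have "lac_fun n a \<in> Sp p \<and> Sp_norm p (lac_fun n a) \<le> (1 + B / (2*pi)) * l2_norm a"
  proof (cases "l2_norm a = 0")
    case True
    then have a0: "a = (\<lambda>_. 0)" by (rule l2_norm_eq_0[OF a])
    have z: "lac_fun n a = (\<lambda>z. 0 * lac_fun n a z)" by (simp add: a0 lac_fun_def fun_eq_iff)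
    have "lac_fun n a \<in> Sp p" using unit[OF a] True by simp
    then show ?thesis using Sp_scale(2)[of "lac_fun n a" p 0] p z True by simp
  next
    case False
    define s where "s = l2_norm a"
    have s: "s > 0" using False l2_norm_nonneg[OF a] by (simp add: s_def)
    define b where "b = (\<lambda>k. of_real (1 / s) * a k)"
    have b: "b \<in> l2" "l2_norm b \<le> 1"
      using l2_scale[OF a, of "of_real (1 / s)"] s by (simp_all add: b_def s_def norm_divide)
    have ab: "a = (\<lambda>k. of_real s * b k)" using s by (simp add: b_def)
    have eq: "lac_fun n a = (\<lambda>z. of_real s * lac_fun n b z)"
      using lac_fun_scale[OF n b(1), of "of_real s", folded ab] by (simp add: fun_eq_iff)
    show ?thesis
      using unit[OF b] Sp_scale[of "lac_fun n b" p "of_real s"] p s unfolding eq by (auto simp: s_def[symmetric] mult.commute)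
  qed
  then show "lac_fun n a \<in> Sp p" "Sp_norm p (lac_fun n a) \<le> (1 + B / (2*pi)) * l2_norm a" by auto
qed

section \<open>The lower bound for the image\<close>

text \<open>\<open>\<theta>\<close> covers small \<open>g\<close>, and
  \<open>\<theta> * g ^ 4\<close> covers \<open>g\<^sup>2 \<ge> 1 / \<theta>\<close>. In between,
  \<open>g powr p\<close> is at least \<open>\<theta> powr (p/2)\<close> and
  \<open>g\<^sup>2\<close> at most \<open>1 / \<theta>\<close>, which explains the exponent
  \<open>- 1 - p/2\<close>. Integrated, this recovers a p-th mean from second and fourth moments;
  the second inequality is for places where no p-th mean is at hand.\<close>

lemma square_le_interpolated:
  fixes g :: real
  assumes l: "0 < \<theta>" "\<theta> \<le> 1" and g: "0 \<le> g" and p: "1 \<le> p"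
  shows "g\<^sup>2 \<le> \<theta> + \<theta> * g ^ 4 + \<theta> powr (- 1 - p/2) * g powr p" "g\<^sup>2 \<le> \<theta> * g ^ 4 + 1 / \<theta>"
proof -
  have g4: "g ^ 4 = g\<^sup>2 * g\<^sup>2" by (simp add: power2_eq_square eval_nat_numeral)
  have nn: "0 \<le> \<theta> * g ^ 4" "0 \<le> \<theta> powr (- 1 - p/2) * g powr p" using l g by auto
  have big: "g\<^sup>2 \<le> \<theta> * g ^ 4" if "1 / \<theta> \<le> g\<^sup>2"
  proof -
    have "1 \<le> \<theta> * g\<^sup>2" using that l by (simp add: divide_le_eq mult.commute)
    then have "1 * g\<^sup>2 \<le> (\<theta> * g\<^sup>2) * g\<^sup>2" by (intro mult_right_mono) auto
    then show ?thesis unfolding g4 by (simp only: mult.assoc mult_1)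
  qed
  show "g\<^sup>2 \<le> \<theta> * g ^ 4 + 1 / \<theta>"
    using big nn(1) l by (cases "1 / \<theta> \<le> g\<^sup>2") (auto intro: add_increasing2 add_increasing)
  show "g\<^sup>2 \<le> \<theta> + \<theta> * g ^ 4 + \<theta> powr (- 1 - p/2) * g powr p"
  proof (cases "g\<^sup>2 \<le> \<theta>")
    case True
    then show ?thesis using nn by linarith
  next
    case low: False
    show ?thesis
    proof (cases "1 / \<theta> \<le> g\<^sup>2")
      case True
      then show ?thesis using big nn l by linarith
    next
      case False
      have g0: "g > 0" using low g l by (cases "g = 0") auto
      have "\<theta> powr (p/2) \<le> (g\<^sup>2) powr (p/2)" using low l p by (intro powr_mono2) auto
      also have "\<dots> = (g powr 2) powr (p/2)" using g0 by simp
      also have "\<dots> = g powr p" unfolding powr_powr by simp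
      finally have "\<theta> powr (- 1 - p/2) * \<theta> powr (p/2) \<le> \<theta> powr (- 1 - p/2) * g powr p"
        by (intro mult_left_mono) auto
      moreover have "\<theta> powr (- 1 - p/2) * \<theta> powr (p/2) = 1 / \<theta>"
        using l by (simp add: powr_add[symmetric] powr_minus_divide)
      ultimately show ?thesis using False nn l by linarith
    qed
  qed
qed

text \<open>The radius may depend on \<open>n\<close>, \<open>a\<close> and \<open>K\<close>, but
  \<open>c\<close> does not. The second and fourth moments of the sum over \<open>E\<close> are
  carried from the boundary to a circle near it. Where \<open>norm h\<close> is at least
  \<open>\<delta>\<close>, the p-th power of the weighted sum controls that of the sum; the
  remaining set is so small that its share of the second moment is negligible.\<close>

lemma weighted_lower_bound:
  fixes h v :: "complex \<Rightarrow> complex"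
  assumes p: "1 \<le> p" and h: "h \<in> hardy p" "\<exists>z\<in>unit_disk. h z \<noteq> 0"
    and v: "v holomorphic_on unit_disk" "v ` unit_disk \<subseteq> unit_disk"
    and E: "E \<in> sets lebesgue" "E \<subseteq> {0..2*pi}" "0 < \<mu>" "\<mu> = measure (lebesgue_on E) E"
    and V: "\<And>t. t \<in> E \<Longrightarrow> ((\<lambda>r. v (of_real r * cis t)) \<longlongrightarrow> V t) (at_left (1::real))"
      "\<And>t. t \<in> E \<Longrightarrow> norm (V t) = 1"
    and N: "N \<ge> 2"
  shows "\<exists>c>0. \<forall>n a K. sparse (lebesgue_on E) V N (\<mu>/8) n \<longrightarrow> (\<Sum>k<K. (norm (a k))\<^sup>2) = 1 \<longrightarrow>
    (\<exists>r\<in>{0..<1}. c \<le> int_mean p (\<lambda>z. h z * (\<Sum>k<K. a k * v z ^ n k)) r)"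
proof -
  let ?C = circle_angles and ?E = "lebesgue_on E"
  have Em: "E \<in> lmeasurable"
    using E by (meson bounded_set_imp_lmeasurable bounded_closed_interval bounded_subset)
  have fE: "finite_measure ?E" by (rule finite_measure_lebesgue_on[OF Em])
  have vc: "continuous_on unit_disk v" by (rule holomorphic_on_imp_continuous_on[OF v(1)])
  have Vm: "V \<in> borel_measurable ?E" by (rule radial_limit_measurable[OF vc V(1)])
  have V1: "norm (V x) = 1" if "x \<in> space ?E" for x using V(2) that by simp
  have \<mu>: "measure ?E (space ?E) = \<mu>" using E(4) by simp
  have \<kappa>: "0 \<le> \<mu> / 8" using E(3) by simp
  obtain B where B: "B \<ge> 0" "\<And>n a K. sparse ?E V N (\<mu>/8) n \<Longrightarrow> (\<Sum>k<K. (norm (a k))\<^sup>2) \<le> 1 \<Longrightarrow>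
      (\<integral>x. norm (\<Sum>k<K. a k * V x ^ n k) ^ 4 \<partial>?E) \<le> B"
    using sparse_moment_le[OF fE Vm V1 N \<kappa>] by auto
  \<comment> \<open>The budget: the second moment exceeds \<open>\<mu> / 4\<close>. The terms
    \<open>\<theta> * \<mu>\<close> and \<open>\<theta> * (B + 1)\<close> together take at most
    \<open>\<mu> / 16\<close>, and the set of small \<open>h\<close>, of measure
    \<open>\<theta> * \<mu> / 16\<close> and weighted by \<open>1 / \<theta>\<close>, takes another
    \<open>\<mu> / 16\<close>. At least \<open>\<mu> / 8\<close> is left for the p-th mean.\<close>
  define \<theta> where "\<theta> = min 1 (\<mu> / (16 * (\<mu> + (B + 1))))"
  have den: "0 < \<mu> + (B + 1)" using E(3) B(1) by simp
  have l: "0 < \<theta>" "\<theta> \<le> 1" using E(3) den by (auto simp: \<theta>_def)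
  have "\<theta> \<le> \<mu> / (16 * (\<mu> + (B + 1)))" by (simp add: \<theta>_def)
  then have l2: "\<theta> * (\<mu> + (B + 1)) \<le> \<mu> / 16" using den by (simp add: field_simps)
  define C where "C = \<theta> powr (- 1 - p/2)"
  have C: "C > 0" using l by (simp add: C_def)
  have bnd: "integral {0..2*pi} (\<lambda>t. norm (h (of_real r * cis t)) powr p) \<le> 2 * pi * hardy_norm p h powr p"
    if "r \<in> {0..<1}" for r
    using int_mean_le_hardy_norm[OF h(1) p that] by (simp add: int_mean_def field_simps)
  have "\<theta> * \<mu> / 16 > 0" using l E(3) by simp
  from small_values_small_measure[OF hardy_holomorphic[OF h(1)] h(2) p bnd this]
  obtain \<delta> and R :: "nat \<Rightarrow> real" where \<delta>: "\<delta> > 0" and R: "\<And>j. R j \<in> {0..<1}" "filterlim R (at_left 1) sequentially"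
    "\<And>j. measure ?C {t \<in> {0..2*pi}. norm (h (of_real (R j) * cis t)) < \<delta>} \<le> \<theta> * \<mu> / 16" by blast
  define c where "c = \<mu> * \<delta> powr p / (16 * pi * C)"
  have c: "c > 0" using E(3) \<delta> C by (simp add: c_def)
  show ?thesis
  proof (intro exI[of _ c] conjI c allI impI)
    fix n and a :: "nat \<Rightarrow> complex" and K
    assume n: "sparse ?E V N (\<mu>/8) n" and a: "(\<Sum>k<K. (norm (a k))\<^sup>2) = 1"
    define G where "G = (\<lambda>z. \<Sum>k<K. a k * z ^ n k)"
    define g where "g = (\<lambda>j t. norm (G (v (of_real (R j) * cis t))))"
    define A where "A = (\<Sum>k<K. norm (a k))"
    have Gc: "continuous_on S G" for S unfolding G_def by (intro continuous_intros)
    have Gvc: "continuous_on unit_disk (\<lambda>z. G (v z))" by (rule continuous_on_compose2[OF Gc vc]) auto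
    have gA: "g j t \<le> A" "0 \<le> g j t" for j t
      unfolding g_def G_def A_def
      by (rule norm_lacunary_le[OF less_imp_le[OF self_map_circle_bound[OF v(2) R(1)]]]) simp
    have gcont: "continuous_on S (\<lambda>t. g j t)" for S j
      unfolding g_def by (intro continuous_on_norm continuous_on_circle[OF Gvc R(1)])
    have gm: "(\<lambda>t. g j t) \<in> borel_measurable (lebesgue_on S)" for j S
      unfolding g_def by (rule measurable_compose[OF circle_measurable[OF Gvc R(1)] borel_measurable_norm])
    have gl: "(\<lambda>j. g j t) \<longlonglongrightarrow> norm (G (V t))" if "t \<in> E" for t
    proof -
      have "(\<lambda>j. v (of_real (R j) * cis t)) \<longlonglongrightarrow> V t" by (rule radial_limit_sequence[OF V(1)[OF that] R(2)])
      from continuous_on_tendsto_compose[OF Gc[of UNIV] this] show ?thesis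
        unfolding g_def by (intro tendsto_norm) simp
    qed
    have lim: "(\<lambda>j. \<integral>t. g j t ^ m \<partial>?E) \<longlonglongrightarrow> (\<integral>t. norm (G (V t)) ^ m \<partial>?E)" for m
    proof (rule bounded_convergence[OF fE, where B = "A ^ m"])
      show "(\<lambda>t. g j t ^ m) \<in> borel_measurable ?E" for j by (intro borel_measurable_power gm)
      show "norm (g j t ^ m) \<le> A ^ m" for j t using gA[of j t] by (simp add: power_mono)
      show "(\<lambda>j. g j t ^ m) \<longlonglongrightarrow> norm (G (V t)) ^ m" if "t \<in> space ?E" for t
        using that by (intro tendsto_power gl) simp
    qed
    \<comment> \<open>With cross terms of size \<open>\<kappa> = \<mu> / 8\<close> half of the mass
      remains. The limits satisfy the weaker bounds \<open>\<mu> / 4\<close> and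
      \<open>B + 1\<close> strictly, so both hold at one common radius \<open>R j\<close>.\<close>
    have "\<mu> * 1 - 4 * (\<mu>/8) \<le> (\<integral>t. norm (G (V t)) ^ 2 \<partial>?E)"
      using sparse_square_ge[OF fE Vm V1 _ \<kappa> n, where a = a and K = K] a N \<mu> unfolding G_def by simp
    then have "\<mu> / 4 < (\<integral>t. norm (G (V t)) ^ 2 \<partial>?E)" using E(3) by simp
    from order_tendstoD(1)[OF lim this]
    have ev1: "\<forall>\<^sub>F j in sequentially. \<mu> / 4 < (\<integral>t. g j t ^ 2 \<partial>?E)" .
    have "(\<integral>t. norm (G (V t)) ^ 4 \<partial>?E) \<le> B" using B(2)[OF n, of a K] a by (simp add: G_def)
    then have "(\<integral>t. norm (G (V t)) ^ 4 \<partial>?E) < B + 1" by simp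
    from order_tendstoD(2)[OF lim this]
    have ev2: "\<forall>\<^sub>F j in sequentially. (\<integral>t. g j t ^ 4 \<partial>?E) < B + 1" .
    from eventually_happens'[OF sequentially_bot eventually_conj[OF ev1 ev2]]
    obtain j where j: "\<mu> / 4 < (\<integral>t. g j t ^ 2 \<partial>?E)" "(\<integral>t. g j t ^ 4 \<partial>?E) < B + 1" by blast
    define r where "r = R j"
    have r: "r \<in> {0..<1}" unfolding r_def by (rule R(1))
    define H where "H = (\<lambda>t. norm (h (of_real r * cis t)))"
    define Y where "Y = {t \<in> {0..2*pi}. H t < \<delta>}"
    define F where "F = (\<lambda>z. h z * (\<Sum>k<K. a k * v z ^ n k))"
    have Fc: "continuous_on unit_disk F"
      unfolding F_def by (intro continuous_intros hardy_continuous[OF h(1)] vc)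
    have nF: "norm (F (of_real r * cis t)) = H t * g j t" for t
      by (simp add: F_def H_def g_def G_def r_def norm_mult)
    have Hm: "H \<in> borel_measurable ?C"
      unfolding H_def by (rule measurable_compose[OF circle_measurable[OF hardy_continuous[OF h(1)] r] borel_measurable_norm])
    have Ys: "Y \<in> sets ?C"
    proof -
      have "{t \<in> space ?C. H t < \<delta>} \<in> sets ?C" by (intro borel_measurable_less Hm borel_measurable_const)
      then show ?thesis by (simp add: Y_def)
    qed
    have Ymeas: "measure ?C Y \<le> \<theta> * \<mu> / 16" using R(3)[of j] by (simp add: Y_def H_def r_def)
    have indE: "indicat_real E \<in> borel_measurable ?C"
      by (rule measurable_restrict_space1, rule borel_measurable_indicator) (use E in auto)
    have intY: "integrable ?C (indicator Y :: real \<Rightarrow> real)"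
      using Ys by (rule integrable_real_indicator)
        (use finite_measure.emeasure_finite[OF finite_circle_angles] in \<open>simp add: less_top[symmetric]\<close>)
    have intE: "integrable ?C (\<lambda>t. indicator E t * g j t ^ m)" for m
    proof (rule integrable_norm_bound[OF finite_circle_angles, where B = "A ^ m"])
      show "(\<lambda>t. indicator E t * g j t ^ m) \<in> borel_measurable ?C"
        by (intro borel_measurable_times indE borel_measurable_power gm)
      show "norm (indicator E t * g j t ^ m) \<le> A ^ m" for t
        using gA[of j t] by (simp add: indicator_def power_mono zero_le_power[OF order_trans[OF gA(2) gA(1)]])
    qed
    have Eint: "(\<integral>t. indicator E t * g j t ^ m \<partial>?C) = (\<integral>t. g j t ^ m \<partial>?E)" for m
      using restrict_integral_eq[OF E(1,2), of "\<lambda>t. g j t ^ m"] by simp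
    have intF: "integrable ?C (\<lambda>t. (H t * g j t) powr p)"
      using integrable_circle_powr[OF Fc r p] unfolding nF .
    \<comment> \<open>The constant 1 on \<open>E\<close> is written as \<open>g j t ^ 0\<close>, so
      that \<open>intE\<close> and \<open>Eint\<close> apply to it as well.\<close>
    have "(\<integral>t. indicator E t * g j t ^ 2 \<partial>?C) \<le>
      (\<integral>t. \<theta> * (indicator E t * g j t ^ 0) + \<theta> * (indicator E t * g j t ^ 4) + (C / \<delta> powr p * (H t * g j t) powr p + 1 / \<theta> * indicator Y t) \<partial>?C)"
    proof (rule integral_mono[OF intE])
      show "integrable ?C (\<lambda>t. \<theta> * (indicator E t * g j t ^ 0) + \<theta> * (indicator E t * g j t ^ 4) + (C / \<delta> powr p * (H t * g j t) powr p + 1 / \<theta> * indicator Y t))"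
        by (intro Bochner_Integration.integrable_add integrable_mult_right intE intF intY)
      fix t assume "t \<in> space ?C"
      then have t: "t \<in> {0..2*pi}" by simp
      have nn: "0 \<le> C / \<delta> powr p * (H t * g j t) powr p" using C by simp
      have nn2: "0 \<le> \<theta> * g j t ^ 4" using l gA by simp
      show "indicator E t * g j t ^ 2 \<le> \<theta> * (indicator E t * g j t ^ 0) + \<theta> * (indicator E t * g j t ^ 4) + (C / \<delta> powr p * (H t * g j t) powr p + 1 / \<theta> * indicator Y t)"
      proof (cases "t \<in> E")
        case False
        then show ?thesis using nn l by (auto simp: indicator_def)
      next
        case tE: True
        show ?thesis
        proof (cases "t \<in> Y")
          case True
          have "g j t ^ 2 \<le> \<theta> * g j t ^ 4 + 1 / \<theta>" by (rule square_le_interpolated(2)[OF l gA(2) p])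
          then have "g j t ^ 2 \<le> \<theta> + \<theta> * g j t ^ 4 + (C / \<delta> powr p * (H t * g j t) powr p + 1 / \<theta>)"
            using nn l by linarith
          then show ?thesis using True tE by simp
        next
          case False
          then have "\<delta> \<le> H t" using t by (simp add: Y_def)
          then have "\<delta> powr p * g j t powr p \<le> H t powr p * g j t powr p"
            using \<delta> p by (intro mult_right_mono powr_mono2) auto
          then have "g j t powr p \<le> (H t * g j t) powr p / \<delta> powr p"
            using \<delta> gA by (simp add: powr_mult H_def field_simps)
          then have "C * g j t powr p \<le> C * ((H t * g j t) powr p / \<delta> powr p)"
            using C by (intro mult_left_mono) auto
          moreover have "g j t ^ 2 \<le> \<theta> + \<theta> * g j t ^ 4 + C * g j t powr p"
            unfolding C_def by (rule square_le_interpolated(1)[OF l gA(2) p])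
          ultimately show ?thesis using False tE by simp
        qed
      qed
    qed
    also have "\<dots> = \<theta> * (\<integral>t. indicator E t * g j t ^ 0 \<partial>?C) + \<theta> * (\<integral>t. indicator E t * g j t ^ 4 \<partial>?C)
      + (C / \<delta> powr p * (\<integral>t. (H t * g j t) powr p \<partial>?C) + 1 / \<theta> * (\<integral>t. indicator Y t \<partial>?C))"
    proof -
      have lin: "(\<integral>t. x1 * f1 t + x2 * f2 t + (x3 * f3 t + x4 * f4 t) \<partial>?C)
        = x1 * integral\<^sup>L ?C f1 + x2 * integral\<^sup>L ?C f2 + (x3 * integral\<^sup>L ?C f3 + x4 * integral\<^sup>L ?C f4)"
        if "integrable ?C f1" "integrable ?C f2" "integrable ?C f3" "integrable ?C f4"
        for x1 x2 x3 x4 :: real and f1 f2 f3 f4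
        using that by (simp add: Bochner_Integration.integral_add)
      show ?thesis by (rule lin[OF intE intE intF intY])
    qed
    also have "(\<integral>t. indicator E t * g j t ^ 0 \<partial>?C) = \<mu>"
      unfolding Eint using \<mu> by simp
    also have "(\<integral>t. indicator Y t \<partial>?C) = measure ?C Y"
    proof -
      have "Y \<inter> {0..2*pi} = Y" by (auto simp: Y_def)
      then show ?thesis using Ys by simp
    qed
    finally have main: "(\<integral>t. g j t ^ 2 \<partial>?E) \<le> \<theta> * \<mu> + \<theta> * (\<integral>t. g j t ^ 4 \<partial>?E)
      + (C / \<delta> powr p * (\<integral>t. (H t * g j t) powr p \<partial>?C) + 1 / \<theta> * measure ?C Y)"
      unfolding Eint .
    have "\<theta> * (\<integral>t. g j t ^ 4 \<partial>?E) \<le> \<theta> * (B + 1)" using l j(2) by (intro mult_left_mono) auto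
    moreover have "1 / \<theta> * measure ?C Y \<le> 1 / \<theta> * (\<theta> * \<mu> / 16)" using l Ymeas by (intro mult_left_mono) auto
    moreover have "1 / \<theta> * (\<theta> * \<mu> / 16) = \<mu> / 16" using l by simp
    moreover have "\<theta> * \<mu> + \<theta> * (B + 1) \<le> \<mu> / 16" using l2 by (simp add: distrib_left)
    ultimately have "\<mu> / 8 \<le> C / \<delta> powr p * (\<integral>t. (H t * g j t) powr p \<partial>?C)"
      using main j(1) by linarith
    then have "\<mu> * \<delta> powr p / (8 * C) \<le> (\<integral>t. (H t * g j t) powr p \<partial>?C)"
      using C \<delta> by (simp add: field_simps)
    then have "\<mu> * \<delta> powr p / (8 * C) / (2*pi) \<le> (\<integral>t. (H t * g j t) powr p \<partial>?C) / (2*pi)"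
      by (rule divide_right_mono) simp
    moreover have "\<mu> * \<delta> powr p / (8 * C) / (2*pi) = c" by (simp add: c_def)
    moreover have "(\<integral>t. (H t * g j t) powr p \<partial>?C) / (2*pi) = int_mean p F r"
      unfolding int_mean_eq[OF Fc r p] nF ..
    ultimately have "c \<le> int_mean p F r" by simp
    then show "\<exists>r\<in>{0..<1}. c \<le> int_mean p (\<lambda>z. h z * (\<Sum>k<K. a k * v z ^ n k)) r"
      using r unfolding F_def by blast
  qed
qed

section \<open>From norm estimates to a fixed copy of \<open>l2\<close>\<close>

lemma wcomp_scale: "wcomp w v (\<lambda>z. c * f z) = (\<lambda>z. c * wcomp w v f z)"
  by (auto simp: wcomp_def)

lemma wcomp_diff: "wcomp w v (\<lambda>z. f z - g z) = (\<lambda>z. wcomp w v f z - wcomp w v g z)"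
  by (auto simp: wcomp_def algebra_simps)

text \<open>A lower bound for the image is also one for the function itself, since \<open>T\<close>
  is bounded. Hence the upper bound for \<open>lac_fun n a\<close> and the lower bound for its image
  together give the isomorphism with \<open>l2\<close>, the closedness of its range, and that
  \<open>T\<close> is bounded below there.\<close>

lemma fixes_copy_of_l2I:
  assumes n: "strict_mono n" and p: "1 \<le> p" and T: "bounded_on_Sp p T"
    and up: "\<And>a. a \<in> l2 \<Longrightarrow> lac_fun n a \<in> Sp p"
      "\<And>a. a \<in> l2 \<Longrightarrow> Sp_norm p (lac_fun n a) \<le> D * l2_norm a" and D: "D > 0"
    and lo: "\<And>a. a \<in> l2 \<Longrightarrow> d * l2_norm a \<le> Sp_norm p (T (lac_fun n a))" and d: "d > 0"
  shows "fixes_copy_of_l2 p T"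
proof -
  define M where "M = lac_fun n ` l2"
  obtain CT where CT: "\<And>f. f \<in> Sp p \<Longrightarrow> Sp_norm p (T f) \<le> CT * Sp_norm p f"
    using T unfolding bounded_on_Sp_def by blast
  \<comment> \<open>The constant of boundedness is only known to exist and may fail to be positive;
    \<open>C\<close> is divided by below.\<close>
  define C where "C = max CT 1"
  have C: "C > 0" by (simp add: C_def)
  have TC: "Sp_norm p (T f) \<le> C * Sp_norm p f" if "f \<in> Sp p" for f
  proof -
    have "CT * Sp_norm p f \<le> C * Sp_norm p f" by (intro mult_right_mono Sp_norm_nonneg) (simp add: C_def)
    then show ?thesis using CT[OF that] by simp
  qed
  have low: "d / C * l2_norm a \<le> Sp_norm p (lac_fun n a)" if "a \<in> l2" for a
    using lo[OF that] TC[OF up(1)[OF that]] C by (simp add: field_simps)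
  have dC: "d / C > 0" using d C by simp
  have zero: "(\<lambda>_. 0) \<in> l2" by (simp add: l2_def)
  have add: "lac_fun n (\<lambda>k. a k + b k) = (\<lambda>z. lac_fun n a z + lac_fun n b z)" if "a \<in> l2" "b \<in> l2" for a b
    using lac_fun_add[OF n that] by (simp add: fun_eq_iff)
  have scale: "lac_fun n (\<lambda>k. c * a k) = (\<lambda>z. c * lac_fun n a z)" if "a \<in> l2" for a c
    using lac_fun_scale[OF n that] by (simp add: fun_eq_iff)
  have diff: "lac_fun n (\<lambda>k. a k - b k) = (\<lambda>z. lac_fun n a z - lac_fun n b z)" if "a \<in> l2" "b \<in> l2" for a b
    using lac_fun_diff[OF n that] by (simp add: fun_eq_iff)
  have inj: "inj_on (lac_fun n) l2"
  proof (rule inj_onI)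
    fix a b assume ab: "a \<in> l2" "b \<in> l2" "lac_fun n a = lac_fun n b"
    have "lac_fun n (\<lambda>k. a k - b k) = (\<lambda>z. 0 * lac_fun n a z)" using diff[OF ab(1,2)] ab(3) by (simp add: fun_eq_iff)
    then have "Sp_norm p (lac_fun n (\<lambda>k. a k - b k)) = 0"
      using Sp_scale(2)[OF up(1)[OF ab(1)] p, of 0] by simp
    then have le: "d / C * l2_norm (\<lambda>k. a k - b k) \<le> 0" using low[OF l2_diff[OF ab(1,2)]] by simp
    have "l2_norm (\<lambda>k. a k - b k) = 0"
    proof (rule ccontr)
      assume "l2_norm (\<lambda>k. a k - b k) \<noteq> 0"
      then have "0 < l2_norm (\<lambda>k. a k - b k)" using l2_norm_nonneg[OF l2_diff[OF ab(1,2)]] by linarith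
      from mult_pos_pos[OF dC this] le show False by linarith
    qed
    from l2_norm_eq_0[OF l2_diff[OF ab(1,2)] this] show "a = b" by (simp add: fun_eq_iff)
  qed
  have "Sp_subspace p M" unfolding Sp_subspace_def
  proof (intro conjI ballI allI)
    show "M \<subseteq> Sp p" using up(1) by (auto simp: M_def)
    have "lac_fun n (\<lambda>_. 0) = (\<lambda>_. 0)" by (simp add: lac_fun_def fun_eq_iff)
    then show "(\<lambda>_. 0) \<in> M" unfolding M_def using zero by (metis imageI)
    show "(\<lambda>z. f z + g z) \<in> M" if "f \<in> M" "g \<in> M" for f g
    proof -
      obtain a b where "a \<in> l2" "b \<in> l2" "f = lac_fun n a" "g = lac_fun n b" using \<open>f \<in> M\<close> \<open>g \<in> M\<close> by (auto simp: M_def)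
      then show ?thesis using add[of a b] l2_add[of a b] unfolding M_def by (metis imageI)
    qed
    show "(\<lambda>z. c * f z) \<in> M" if "f \<in> M" for c f
    proof -
      obtain a where "a \<in> l2" "f = lac_fun n a" using \<open>f \<in> M\<close> by (auto simp: M_def)
      then show ?thesis using scale[of a c] l2_scale(1)[of a c] unfolding M_def by (metis imageI)
    qed
  qed
  moreover have "isomorphic_to_l2 p M" unfolding isomorphic_to_l2_def
    using inj dC D low up(2) add scale
    by (intro exI[of _ "lac_fun n"] exI[of _ "d / C"] exI[of _ D]) (simp add: bij_betw_def M_def)
  \<comment> \<open>The distances \<open>\<epsilon> i\<close> to the limit \<open>g\<close>, scaled
    by the lower bound, control the distances of the coefficient sequences; the factor 4 is the one
    in \<open>Sp_diff\<close>. Their \<open>l2\<close> limit \<open>b\<close> yields an element of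
    \<open>M\<close> whose difference from \<open>g\<close> has norm 0.\<close>
  moreover have "Sp_closed p M" unfolding Sp_closed_def
  proof (intro allI impI)
    fix F g assume F: "\<forall>i. F i \<in> M" and g: "g \<in> Sp p" and lim: "(\<lambda>i. Sp_norm p (\<lambda>z. F i z - g z)) \<longlonglongrightarrow> 0"
    have "\<exists>a. a \<in> l2 \<and> F i = lac_fun n a" for i using F by (auto simp: M_def)
    then obtain a where a: "\<And>i. a i \<in> l2" "\<And>i. F i = lac_fun n (a i)" by metis
    define \<epsilon> where "\<epsilon> = (\<lambda>i. Sp_norm p (\<lambda>z. F i z - g z))"
    have FS: "F i \<in> Sp p" for i unfolding a(2) by (rule up(1)[OF a(1)])
    have "l2_norm (\<lambda>k. a i k - a j k) \<le> 4 * C / d * \<epsilon> i + 4 * C / d * \<epsilon> j" for i j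
    proof -
      have "Sp_norm p (\<lambda>z. F i z - F j z) = Sp_norm p (\<lambda>z. (F i z - g z) - (F j z - g z))" by simp
      also have "\<dots> \<le> 4 * (\<epsilon> i + \<epsilon> j)"
        unfolding \<epsilon>_def by (rule Sp_diff(2)[OF Sp_diff(1)[OF FS g p] Sp_diff(1)[OF FS g p] p])
      finally have "d / C * l2_norm (\<lambda>k. a i k - a j k) \<le> 4 * (\<epsilon> i + \<epsilon> j)"
        using low[OF l2_diff[OF a(1) a(1)], of i j] diff[OF a(1) a(1), of i j] a(2) by simp
      then show ?thesis using d C by (simp add: field_simps)
    qed
    moreover have "(\<lambda>i. 4 * C / d * \<epsilon> i) \<longlonglongrightarrow> 0"
      using tendsto_mult[OF tendsto_const lim, of "4 * C / d"] by (simp add: \<epsilon>_def)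
    ultimately obtain b where b: "b \<in> l2" "\<And>i. l2_norm (\<lambda>k. a i k - b k) \<le> 4 * C / d * \<epsilon> i"
      using l2_complete[of a, OF a(1)] by blast
    have gb: "(\<lambda>z. g z - lac_fun n b z) \<in> Sp p" by (rule Sp_diff(1)[OF g up(1)[OF b(1)] p])
    have "Sp_norm p (\<lambda>z. g z - lac_fun n b z) \<le> 4 * (\<epsilon> i + D * (4 * C / d * \<epsilon> i))" for i
    proof -
      have gs: "Sp_norm p (\<lambda>z. g z - F i z) = \<epsilon> i"
        using Sp_scale(2)[OF Sp_diff(1)[OF FS g p], of "-1" i] p by (simp add: \<epsilon>_def)
      have "Sp_norm p (\<lambda>z. F i z - lac_fun n b z) = Sp_norm p (lac_fun n (\<lambda>k. a i k - b k))"
        using diff[OF a(1) b(1), of i] a(2) by simp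
      also have "\<dots> \<le> D * l2_norm (\<lambda>k. a i k - b k)" by (rule up(2)[OF l2_diff[OF a(1) b(1)]])
      also have "\<dots> \<le> D * (4 * C / d * \<epsilon> i)" using D b(2) by (intro mult_left_mono) auto
      finally have fb: "Sp_norm p (\<lambda>z. F i z - lac_fun n b z) \<le> D * (4 * C / d * \<epsilon> i)" .
      have "Sp_norm p (\<lambda>z. g z - lac_fun n b z) = Sp_norm p (\<lambda>z. (g z - F i z) + (F i z - lac_fun n b z))" by simp
      also have "\<dots> \<le> 4 * (Sp_norm p (\<lambda>z. g z - F i z) + Sp_norm p (\<lambda>z. F i z - lac_fun n b z))"
        by (rule Sp_add(2)[OF Sp_diff(1)[OF g FS p] Sp_diff(1)[OF FS up(1)[OF b(1)] p] p])
      finally show ?thesis using gs fb by simp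
    qed
    moreover have "(\<lambda>i. 4 * (\<epsilon> i + D * (4 * C / d * \<epsilon> i))) \<longlonglongrightarrow> 4 * (0 + D * (4 * C / d * 0))"
      unfolding \<epsilon>_def by (intro tendsto_intros lim)
    ultimately have "Sp_norm p (\<lambda>z. g z - lac_fun n b z) \<le> 0"
      using LIMSEQ_le_const[of "\<lambda>i. 4 * (\<epsilon> i + D * (4 * C / d * \<epsilon> i))" 0] by simp
    then have "Sp_norm p (\<lambda>z. g z - lac_fun n b z) = 0" using Sp_norm_nonneg by (simp add: order.antisym)
    from Sp_norm_eq_0[OF gb p this] have "g = lac_fun n b" by (simp add: fun_eq_iff)
    then show "g \<in> M" using b(1) by (simp add: M_def)
  qed
  moreover have "\<exists>c>0. \<forall>f\<in>M. c * Sp_norm p f \<le> Sp_norm p (T f)"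
  proof (intro exI[of _ "d / D"] conjI ballI)
    show "d / D > 0" using d D by simp
    fix f assume "f \<in> M"
    then obtain a where a: "a \<in> l2" "f = lac_fun n a" by (auto simp: M_def)
    have "d / D * Sp_norm p f \<le> d / D * (D * l2_norm a)"
      unfolding a(2) using d D by (intro mult_left_mono up(2) a) auto
    also have "\<dots> \<le> Sp_norm p (T f)" using lo[OF a(1)] D a(2) by simp
    finally show "d / D * Sp_norm p f \<le> Sp_norm p (T f)" .
  qed
  ultimately show ?thesis unfolding fixes_copy_of_l2_def by blast
qed

text \<open>By the product and chain rules the derivative of the image is the main term plus
  \<open>deriv w * f (v z)\<close>. Integration has divided the coefficients by
  \<open>n k + 1\<close>, so \<open>f\<close> is uniformly at most \<open>\<epsilon>\<close> and
  this second term is at most \<open>\<epsilon>\<close> times the Hardy norm of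
  \<open>deriv w\<close>. Subtracting it from the derivative isolates the main term.\<close>

lemma wcomp_lac_lower:
  assumes p: "1 \<le> p" and w: "w holomorphic_on unit_disk"
    and v: "v holomorphic_on unit_disk" "v ` unit_disk \<subseteq> unit_disk"
    and w': "deriv w \<in> hardy p" and n: "strict_mono n" and e: "\<epsilon> > 0" "\<And>k. 2 ^ (k+1) / \<epsilon> \<le> real (n k)"
    and a: "\<And>k. k < K \<Longrightarrow> norm (a k) \<le> 1"
    and T: "wcomp w v (lac_fun n (\<lambda>k. if k < K then a k else 0)) \<in> Sp p"
    and r: "r \<in> {0..<1}"
  shows "int_mean p (\<lambda>z. (w z * deriv v z) * (\<Sum>k<K. a k * v z ^ n k)) r
    \<le> 2 powr p * (Sp_norm p (wcomp w v (lac_fun n (\<lambda>k. if k < K then a k else 0))) powr p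
        + (\<epsilon> * hardy_norm p (deriv w)) powr p)"
proof -
  define b where "b = (\<lambda>k. if k < K then a k else 0)"
  define f where "f = lac_fun n b"
  have b1: "norm (b k) \<le> 1" for k using a by (simp add: b_def)
  have v1: "v z \<in> unit_disk" if "z \<in> unit_disk" for z using v(2) that by blast
  have fin: "(\<Sum>k. b k * g k) = (\<Sum>k<K. a k * g k)" for g :: "nat \<Rightarrow> complex"
  proof -
    have "(\<Sum>k. b k * g k) = (\<Sum>k<K. b k * g k)" by (rule suminf_finite) (auto simp: b_def)
    then show ?thesis by (simp add: b_def)
  qed
  have der: "lac_deriv n b z = (\<Sum>k<K. a k * z ^ n k)" for z
    unfolding lac_deriv_def by (rule fin)
  \<comment> \<open>The growth of \<open>n\<close> makes term \<open>k\<close> at most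
    \<open>\<epsilon> / 2 ^ (k+1)\<close>, so the sum stays below \<open>\<epsilon>\<close> for any
    number of terms.\<close>
  have fsmall: "norm (f z) \<le> \<epsilon>" if z: "z \<in> unit_disk" for z
  proof -
    have "f z = (\<Sum>k<K. a k * (z ^ (n k + 1) / of_nat (n k + 1)))"
      using z fin[of "\<lambda>k. z ^ (n k + 1) / of_nat (n k + 1)"] by (simp add: f_def lac_fun_def)
    also have "norm \<dots> \<le> (\<Sum>k<K. (\<epsilon> / 2) / 2 ^ k)"
    proof (intro order_trans[OF norm_sum] sum_mono)
      fix k assume k: "k \<in> {..<K}"
      have "0 < 2 ^ (k+1) / \<epsilon>" using e(1) by simp
      then have nk: "0 < real (n k)" using e(2)[of k] by linarith
      have "norm (a k) * (norm z ^ (n k + 1) / real (n k + 1)) \<le> 1 * (1 / real (n k))"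
        using a[of k] k z nk by (intro mult_mono frac_le power_le_one) auto
      also have "\<dots> \<le> (\<epsilon> / 2) / 2 ^ k"
        using e(2)[of k] e(1) nk by (simp add: field_simps)
      finally show "norm (a k * (z ^ (n k + 1) / of_nat (n k + 1))) \<le> (\<epsilon> / 2) / 2 ^ k"
        by (simp add: norm_mult norm_divide norm_power del: of_nat_Suc of_nat_add)
    qed
    also have "\<dots> \<le> 2 * (\<epsilon> / 2)" by (rule sum_half_powers_le) (use e in simp)
    finally show ?thesis by simp
  qed
  note F = lac_fun_holomorphic[of n b 1, OF n b1, folded f_def]
  have fv: "(\<lambda>z. f (v z)) holomorphic_on unit_disk"
    using holomorphic_on_compose_gen[OF v(1) F(1) v(2)] by (simp add: o_def)
  have d: "deriv (wcomp w v f) z = w z * (lac_deriv n b (v z) * deriv v z) + deriv w z * f (v z)" if z: "z \<in> unit_disk" for z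
  proof -
    have dv: "(v has_field_derivative deriv v z) (at z)" and dw: "(w has_field_derivative deriv w z) (at z)"
      using v(1) w z by (auto intro: holomorphic_derivI[OF _ open_ball])
    have df: "(f has_field_derivative lac_deriv n b (v z)) (at (v z))"
      unfolding f_def by (rule lac_fun_has_derivative[OF n b1 v1[OF z]])
    have "((\<lambda>z. w z * f (v z)) has_field_derivative w z * (lac_deriv n b (v z) * deriv v z) + deriv w z * f (v z)) (at z)"
      by (rule DERIV_mult'[OF dw DERIV_chain2[OF df dv]])
    from DERIV_imp_deriv[OF this] show ?thesis
      using deriv_cong_disk[OF _ z, of "wcomp w v f" "\<lambda>z. w z * f (v z)"] by (simp add: wcomp_def)
  qed
  have TS: "wcomp w v f \<in> Sp p" using T by (simp add: f_def b_def)
  then have dT: "deriv (wcomp w v f) \<in> hardy p" by (simp add: Sp_def)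
  note m = hardy_mult_bounded[OF w' fv p fsmall[OF v1] less_imp_le[OF e(1)]]
  have m': "(\<lambda>z. - 1 * (deriv w z * f (v z))) \<in> hardy p"
    "hardy_norm p (\<lambda>z. - 1 * (deriv w z * f (v z))) = hardy_norm p (\<lambda>z. deriv w z * f (v z))"
    using hardy_scale[OF m(1) p, of "-1"] by simp_all
  have "int_mean p (\<lambda>z. (w z * deriv v z) * (\<Sum>k<K. a k * v z ^ n k)) r
     = int_mean p (\<lambda>z. deriv (wcomp w v f) z + - 1 * (deriv w z * f (v z))) r"
    by (rule int_mean_cong[OF r]) (simp add: d der algebra_simps)
  also have "\<dots> \<le> 2 powr p * (int_mean p (deriv (wcomp w v f)) r + int_mean p (\<lambda>z. - 1 * (deriv w z * f (v z))) r)"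
    by (rule int_mean_add_le[OF hardy_continuous[OF dT] hardy_continuous[OF m'(1)] r p])
  also have "\<dots> \<le> 2 powr p * (Sp_norm p (wcomp w v f) powr p + (\<epsilon> * hardy_norm p (deriv w)) powr p)"
  proof (intro mult_left_mono add_mono)
    have "int_mean p (deriv (wcomp w v f)) r \<le> hardy_norm p (deriv (wcomp w v f)) powr p"
      by (rule int_mean_le_hardy_norm[OF dT p r])
    also have "\<dots> \<le> Sp_norm p (wcomp w v f) powr p"
      using p by (intro powr_mono2 hardy_norm_nonneg) (auto simp: Sp_norm_def)
    finally show "int_mean p (deriv (wcomp w v f)) r \<le> Sp_norm p (wcomp w v f) powr p" .
    have "int_mean p (\<lambda>z. - 1 * (deriv w z * f (v z))) r \<le> hardy_norm p (\<lambda>z. deriv w z * f (v z)) powr p"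
      using int_mean_le_hardy_norm[OF m'(1) p r] unfolding m'(2) .
    also have "\<dots> \<le> (\<epsilon> * hardy_norm p (deriv w)) powr p"
      using p m(2) by (intro powr_mono2 hardy_norm_nonneg) auto
    finally show "int_mean p (\<lambda>z. - 1 * (deriv w z * f (v z))) r \<le> (\<epsilon> * hardy_norm p (deriv w)) powr p" .
  qed simp
  finally show ?thesis by (simp add: f_def b_def)
qed

text \<open>Normalisation gives the bound for all finite sums. For general \<open>a\<close> the
  truncation is \<open>a\<close> minus its tail, and the image of the tail tends to 0 because the
  operator is bounded. The loss of 4 is the constant of the triangle inequality
  \<open>Sp_diff\<close>.\<close>

lemma l2_lower_of_truncations:
  assumes n: "strict_mono n" and p: "1 \<le> p" and T: "bounded_on_Sp p (wcomp w v)"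
    and up: "\<And>a. a \<in> l2 \<Longrightarrow> lac_fun n a \<in> Sp p"
      "\<And>a. a \<in> l2 \<Longrightarrow> Sp_norm p (lac_fun n a) \<le> D * l2_norm a"
    and lo: "\<And>a K. (\<Sum>k<K. (norm (a k))\<^sup>2) = 1 \<Longrightarrow>
       d \<le> Sp_norm p (wcomp w v (lac_fun n (\<lambda>k. if k < K then a k else 0)))"
    and a: "a \<in> l2"
  shows "d / 4 * l2_norm a \<le> Sp_norm p (wcomp w v (lac_fun n a))"
proof -
  let ?T = "wcomp w v"
  obtain CT where CT: "\<And>f. f \<in> Sp p \<Longrightarrow> Sp_norm p (?T f) \<le> CT * Sp_norm p f"
    using T unfolding bounded_on_Sp_def by blast
  have TS: "?T f \<in> Sp p" if "f \<in> Sp p" for f using T that unfolding bounded_on_Sp_def by blast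
  define C where "C = max CT 0"
  have TC: "Sp_norm p (?T f) \<le> C * Sp_norm p f" if "f \<in> Sp p" for f
  proof -
    have "CT * Sp_norm p f \<le> C * Sp_norm p f" by (intro mult_right_mono Sp_norm_nonneg) (simp add: C_def)
    then show ?thesis using CT[OF that] by simp
  qed
  define x where "x = (\<lambda>K k. if k < K then a k else 0)"
  define y where "y = (\<lambda>K k. if k < K then 0 else a k)"
  have x: "x K \<in> l2" and y: "y K \<in> l2" for K unfolding x_def y_def by (rule l2_truncate[OF a])+
  have xl: "d * l2_norm (x K) \<le> Sp_norm p (?T (lac_fun n (x K)))" for K
  proof (cases "l2_norm (x K) = 0")
    case True
    then show ?thesis by (simp add: Sp_norm_nonneg)
  next
    case False
    define s where "s = l2_norm (x K)"
    have s: "s > 0" using False l2_norm_nonneg[OF x[of K]] by (simp add: s_def)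
    define q where "q = complex_of_real (1 / s)"
    have q: "norm q = 1 / s" using s by (simp add: q_def norm_divide)
    have "(\<Sum>k<K. (norm (a k))\<^sup>2) = s\<^sup>2"
      unfolding s_def x_def l2_truncate(2)[OF a] by (simp add: sum_nonneg)
    then have "(\<Sum>k<K. (norm (q * a k))\<^sup>2) = 1"
      using s by (simp add: q norm_mult power_divide sum_divide_distrib[symmetric])
    from lo[OF this] have "d \<le> Sp_norm p (?T (lac_fun n (\<lambda>k. if k < K then q * a k else 0)))" .
    also have "(\<lambda>k. if k < K then q * a k else 0) = (\<lambda>k. q * x K k)" by (auto simp: x_def)
    also have "lac_fun n (\<lambda>k. q * x K k) = (\<lambda>z. q * lac_fun n (x K) z)"
      using lac_fun_scale[OF n x, of q K] by (simp add: fun_eq_iff)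
    also have "Sp_norm p (?T (\<lambda>z. q * lac_fun n (x K) z)) = 1 / s * Sp_norm p (?T (lac_fun n (x K)))"
      unfolding wcomp_scale using Sp_scale(2)[OF TS[OF up(1)[OF x[of K]]] p, of q] by (simp only: q)
    finally have "d \<le> 1 / s * Sp_norm p (?T (lac_fun n (x K)))" .
    then show ?thesis using s unfolding s_def[symmetric] by (simp add: field_simps)
  qed
  have est: "d * l2_norm (x K) \<le> 4 * (Sp_norm p (?T (lac_fun n a)) + C * (D * l2_norm (y K)))" for K
  proof -
    have xy: "x K = (\<lambda>k. a k - y K k)" by (auto simp: x_def y_def)
    have "lac_fun n (x K) = (\<lambda>z. lac_fun n a z - lac_fun n (y K) z)"
      unfolding xy using lac_fun_diff[OF n a y] by (simp add: fun_eq_iff)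
    then have 1: "Sp_norm p (?T (lac_fun n (x K))) \<le> 4 * (Sp_norm p (?T (lac_fun n a)) + Sp_norm p (?T (lac_fun n (y K))))"
      using Sp_diff(2)[OF TS[OF up(1)[OF a]] TS[OF up(1)[OF y[of K]]] p] by (simp add: wcomp_diff)
    have "Sp_norm p (?T (lac_fun n (y K))) \<le> C * Sp_norm p (lac_fun n (y K))" by (rule TC[OF up(1)[OF y]])
    also have "\<dots> \<le> C * (D * l2_norm (y K))"
      by (intro mult_left_mono up(2) y) (simp add: C_def)
    finally have "4 * (Sp_norm p (?T (lac_fun n a)) + Sp_norm p (?T (lac_fun n (y K))))
        \<le> 4 * (Sp_norm p (?T (lac_fun n a)) + C * (D * l2_norm (y K)))" by simp
    then show ?thesis using xl[of K] 1 by (meson order_trans)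
  qed
  have "d * l2_norm a \<le> 4 * (Sp_norm p (?T (lac_fun n a)) + C * (D * 0))"
  proof (rule LIMSEQ_le)
    show "(\<lambda>K. d * l2_norm (x K)) \<longlonglongrightarrow> d * l2_norm a"
      unfolding x_def by (intro tendsto_intros l2_truncate(5)[OF a])
    show "(\<lambda>K. 4 * (Sp_norm p (?T (lac_fun n a)) + C * (D * l2_norm (y K))))
      \<longlonglongrightarrow> 4 * (Sp_norm p (?T (lac_fun n a)) + C * (D * 0))"
      unfolding y_def by (intro tendsto_intros l2_truncate(4)[OF a])
    show "\<exists>N. \<forall>K\<ge>N. d * l2_norm (x K) \<le> 4 * (Sp_norm p (?T (lac_fun n a)) + C * (D * l2_norm (y K)))"
      using est by blast
  qed
  then show ?thesis by simp
qed

theorem theorem3: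
  fixes p :: real and w v :: "complex \<Rightarrow> complex"
  assumes "1 \<le> p"
    and "w holomorphic_on unit_disk"
    and "v holomorphic_on unit_disk" and "v ` unit_disk \<subseteq> unit_disk"
    and "bounded_on_Sp p (wcomp w v)"
    and "circle_measure (E_set v) > 0"
    and "\<exists>z\<in>unit_disk. w z * deriv v z \<noteq> 0"
  shows "fixes_copy_of_l2 p (wcomp w v)"
proof -
  note p = assms(1) and w = assms(2) and v = assms(3,4) and T = assms(5)
  have TS: "wcomp w v f \<in> Sp p" if "f \<in> Sp p" for f using T that unfolding bounded_on_Sp_def by blast
  define E where "E = {t \<in> {0..2*pi}. cis t \<in> E_set v}"
  have E2: "E \<subseteq> {0..2*pi}" by (auto simp: E_def)
  have Epos: "measure lebesgue E > 0"
    using assms(6) unfolding circle_measure_def E_def by (simp add: zero_less_divide_iff)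
  \<comment> \<open>A set that is not measurable has \<open>measure\<close> 0 by default, so
    positivity already shows that \<open>E\<close> is measurable.\<close>
  then have E1: "E \<in> sets lebesgue" using measure_notin_sets by force
  define \<mu> where "\<mu> = measure (lebesgue_on E) E"
  have \<mu>: "\<mu> > 0" using Epos E1 by (simp add: \<mu>_def measure_restrict_space)
  define V where "V = (\<lambda>t. SOME l. has_radial_limit v (cis t) l \<and> norm l = 1)"
  have VV: "has_radial_limit v (cis t) (V t) \<and> norm (V t) = 1" if "t \<in> E" for t
    unfolding V_def by (rule someI_ex) (use that in \<open>auto simp: E_def E_set_def\<close>)
  have V: "((\<lambda>r. v (of_real r * cis t)) \<longlongrightarrow> V t) (at_left (1::real))" "norm (V t) = 1" if "t \<in> E" for t
    using VV[OF that] by (auto simp: has_radial_limit_def)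
  note sym = symbol_in_hardy[OF p w v TS]
  \<comment> \<open>The summand 2 provides the fourth moment for the lower bound; the ceiling
    provides an even order \<open>2*N\<close> that is at least \<open>p\<close> for the upper
    bound.\<close>
  define N where "N = nat \<lceil>p\<rceil> + 2"
  have N: "2 \<le> N" "1 \<le> N" "p \<le> real (2*N)"
  proof -
    have "p \<le> real (nat \<lceil>p\<rceil>)" by (rule real_nat_ceiling_ge)
    then show "p \<le> real (2*N)" by (simp add: N_def)
  qed (auto simp: N_def)
  obtain c where c: "c > 0" "\<And>n a K. sparse (lebesgue_on E) V N (\<mu>/8) n \<Longrightarrow> (\<Sum>k<K. (norm (a k))\<^sup>2) = 1 \<Longrightarrow>
    \<exists>r\<in>{0..<1}. c \<le> int_mean p (\<lambda>z. (w z * deriv v z) * (\<Sum>k<K. a k * v z ^ n k)) r"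
    using weighted_lower_bound[OF p sym(2) assms(7) v E1 E2 \<mu> \<mu>_def V N(1)] by blast
  have cism: "cis \<in> borel_measurable circle_angles"
    by (rule continuous_imp_measurable_on_sets_lebesgue) (auto intro!: continuous_intros)
  have \<kappa>: "\<mu> / 8 \<ge> 0" "\<mu> / 8 > 0" using \<mu> by auto
  obtain B where B: "B \<ge> 0" "\<And>n a K. sparse circle_angles cis N (\<mu>/8) n \<Longrightarrow> (\<Sum>k<K. (norm (a k))\<^sup>2) \<le> 1 \<Longrightarrow>
      (\<integral>t. norm (\<Sum>k<K. a k * cis t ^ n k) ^ (2*N) \<partial>circle_angles) \<le> B"
    using sparse_moment_le[OF finite_circle_angles cism _ order_refl \<kappa>(1), of N] by auto
  define W where "W = hardy_norm p (deriv w)"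
  have W: "W \<ge> 0" by (simp add: W_def hardy_norm_nonneg)
  \<comment> \<open>Half of \<open>c\<close> is reserved for the term containing
    \<open>deriv w\<close>: \<open>\<epsilon>\<close> is such that this term costs at most
    \<open>s powr p = c / 2\<close>, with \<open>W + 1\<close> keeping the denominator positive if
    \<open>W = 0\<close>. The other half leaves \<open>s powr p \<le> (2 * S) powr p\<close> for the
    norm \<open>S\<close> of the image.\<close>
  define s where "s = (c / 2) powr (1 / p)"
  have s: "s > 0" "s powr p = c / 2" using c(1) p by (simp_all add: s_def powr_powr)
  define \<epsilon> where "\<epsilon> = s / (2 * (W + 1))"
  have e: "\<epsilon> > 0" "2 * (\<epsilon> * W) \<le> s"
  proof -
    show "\<epsilon> > 0" using s W by (simp add: \<epsilon>_def)
    have "2 * (\<epsilon> * W) = s * (W / (W + 1))" using W by (simp add: \<epsilon>_def field_simps)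
    also have "\<dots> \<le> s * 1" using W s by (intro mult_left_mono) (auto simp: divide_le_eq)
    finally show "2 * (\<epsilon> * W) \<le> s" by simp
  qed
  have eW: "2 powr p * (\<epsilon> * W) powr p \<le> c / 2"
  proof -
    have "2 powr p * (\<epsilon> * W) powr p = (2 * (\<epsilon> * W)) powr p" using e W by (simp add: powr_mult)
    also have "\<dots> \<le> s powr p" using e W p by (intro powr_mono2) auto
    finally show ?thesis using s by simp
  qed
  \<comment> \<open>The prescribed growth is the one \<open>wcomp_lac_lower\<close> needs;
    sparseness on \<open>E\<close> is for the lower bound, sparseness on the full circle for the
    upper one.\<close>
  have "\<exists>n. strict_mono n \<and> (\<forall>K. nat \<lceil>2 ^ (K+1) / \<epsilon>\<rceil> \<le> n K) \<and> sparse (lebesgue_on E) V N (\<mu>/8) n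
      \<and> sparse circle_angles cis N (\<mu>/8) n"
    by (rule ex_sparse[OF boundary_power_mean_small[OF v E1 E2 V(1)] \<kappa>(2) N(2)])
  then obtain n where n: "strict_mono n" "\<And>K. nat \<lceil>2 ^ (K+1) / \<epsilon>\<rceil> \<le> n K"
    "sparse (lebesgue_on E) V N (\<mu>/8) n" "sparse circle_angles cis N (\<mu>/8) n" by blast
  have nX: "2 ^ (k+1) / \<epsilon> \<le> real (n k)" for k
    using n(2)[of k] real_nat_ceiling_ge[of "2 ^ (k+1) / \<epsilon>"] by linarith
  define D where "D = 1 + B / (2*pi)"
  have D: "D > 0" using B(1) by (simp add: D_def add_pos_nonneg)
  have up: "lac_fun n a \<in> Sp p" "Sp_norm p (lac_fun n a) \<le> D * l2_norm a" if "a \<in> l2" for a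
    unfolding D_def by (rule lac_upper[OF n(1) p N(3) B(1) B(2)[OF n(4)] that], assumption)+
  have lo: "s / 2 \<le> Sp_norm p (wcomp w v (lac_fun n (\<lambda>k. if k < K then a k else 0)))"
    if a: "(\<Sum>k<K. (norm (a k))\<^sup>2) = 1" for a K
  proof -
    let ?b = "\<lambda>k. if k < K then a k else 0"
    have b: "?b \<in> l2"
    proof -
      have "finite {k. ?b k \<noteq> 0}" by (rule finite_subset[of _ "{..<K}"]) auto
      then have "summable (\<lambda>k. (norm (?b k))\<^sup>2)"
        by (intro summable_finite[of "{..<K}"]) auto
      then show ?thesis by (simp add: l2_def)
    qed
    define S where "S = Sp_norm p (wcomp w v (lac_fun n ?b))"
    have S: "S \<ge> 0" by (simp add: S_def Sp_norm_nonneg)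
    obtain r where r: "r \<in> {0..<1}" "c \<le> int_mean p (\<lambda>z. (w z * deriv v z) * (\<Sum>k<K. a k * v z ^ n k)) r"
      using c(2)[OF n(3) a] by blast
    have "norm (a k) \<le> 1" if "k < K" for k
      by (rule norm_le_1_of_sum_squares[OF _ that]) (use a in simp)
    from order_trans[OF r(2) wcomp_lac_lower[OF p w v sym(1) n(1) e(1) nX this TS[OF up(1)[OF b]] r(1)]]
    have "c \<le> 2 powr p * (S powr p + (\<epsilon> * W) powr p)" by (simp add: S_def W_def)
    then have "s powr p \<le> 2 powr p * S powr p" using eW s(2) by (simp add: distrib_left)
    also have "\<dots> = (2 * S) powr p" using S by (simp add: powr_mult)
    finally have "s powr p \<le> (2 * S) powr p" .
    moreover have "(2 * S) powr p < s powr p" if "2 * S < s" using that S p by (intro powr_less_mono2) auto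
    ultimately have "s \<le> 2 * S" by linarith
    then show ?thesis by (simp add: S_def)
  qed
  show ?thesis
  proof (rule fixes_copy_of_l2I[OF n(1) p T up D])
    show "s / 2 / 4 > 0" using s by simp
    show "s / 2 / 4 * l2_norm a \<le> Sp_norm p (wcomp w v (lac_fun n a))" if "a \<in> l2" for a
      by (rule l2_lower_of_truncations[OF n(1) p T up lo that])
  qed
qed

end
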